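(* Let $T_1,T_2,T_3$ be commuting contractions on a Hilbert space $\mathcal H$. Let $A_1,A_2$ be two commuting bounded operators on $\mathcal D_{T_3}$ such that $$T_1-T_2^*T_3=D_{T_3}A_1D_{T_3}\quad\text{and}\quad T_2-T_1^*T_3=D_{T_3}A_2D_{T_3}.$$ If $A_1,A_2$ satisfy $[A_1^*,A_1]=[A_2^*,A_2]$ and $\omega(A_1+A_2z)\le1$ for all $z$ in the unit circle, then $(T_1,T_2,T_3)$ is an $\mathbb E$-contraction.
   Context: The tetrablock is $\mathbb E=\{(x_1,x_2,x_3)\in\mathbb C^3: 1-zx_1-wx_2+zwx_3\ne0 \text{ whenever } |z|\le1,|w|\le1\}$. A commuting triple $(T_1,T_2,T_3)$ of bounded Hilbert space operators is an $\mathbb E$-contraction if its Taylor joint spectrum lies in $\overline{\mathbb E}$ and $\|p(T_1,T_2,T_3)\|\le\sup_{\overline{\mathbb E}}|p|$ for every polynomial $p$ in three variables (by polynomial convexity the spectrum condition follows from the norm inequality). For a contraction $T$, $D_T=(I-T^*T)^{1/2}$ and $\mathcal D_T=\overline{\mathrm{Ran}}\,D_T$. $\omega(\cdot)$ is the numerical radius and $[S_1,S_2]=S_1S_2-S_2S_1$. *)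

theory Defs
  imports "HOL-Analysis.Analysis" "HOL-Library.Poly_Mapping"
begin

section \<open>Complex Hilbert spaces and their operators\<close>

text \<open>The class of complex Hilbert spaces refines the real one: the real part of the complex
  inner product is the real inner product, so the norm is the one induced by \<open>cinner\<close>.
  The inner product is linear in its first argument.\<close>

class chilbert_space = real_inner + banach +
  fixes scaleC :: "complex \<Rightarrow> 'a \<Rightarrow> 'a" (infixr \<open>*\<^sub>C\<close> 75)
    and cinner :: "'a \<Rightarrow> 'a \<Rightarrow> complex"
  assumes scaleC_add_right: "a *\<^sub>C (x + y) = a *\<^sub>C x + a *\<^sub>C y"
    and scaleC_add_left: "(a + b) *\<^sub>C x = a *\<^sub>C x + b *\<^sub>C x"
    and scaleC_scaleC: "a *\<^sub>C b *\<^sub>C x = (a * b) *\<^sub>C x"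
    and scaleC_of_real: "complex_of_real r *\<^sub>C x = r *\<^sub>R x"
    and cinner_commute: "cinner x y = cnj (cinner y x)"
    and cinner_add_left: "cinner (x + y) z = cinner x z + cinner y z"
    and cinner_scaleC_left: "cinner (a *\<^sub>C x) y = a * cinner x y"
    and Re_cinner: "Re (cinner x y) = inner x y"

definition bounded_clinear :: "('a::chilbert_space \<Rightarrow> 'a) \<Rightarrow> bool" where
  "bounded_clinear T \<longleftrightarrow> bounded_linear T \<and> (\<forall>c x. T (c *\<^sub>C x) = c *\<^sub>C T x)"

text \<open>A subspace \<open>M\<close> is a set, not a type; an operator on \<open>M\<close> is a function of which only the
  values on \<open>M\<close> matter.\<close>

definition bounded_clinear_on :: "'a::chilbert_space set \<Rightarrow> ('a \<Rightarrow> 'a) \<Rightarrow> bool" where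
  "bounded_clinear_on M A \<longleftrightarrow> A ` M \<subseteq> M \<and>
    (\<forall>x\<in>M. \<forall>y\<in>M. A (x + y) = A x + A y) \<and>
    (\<forall>c. \<forall>x\<in>M. A (c *\<^sub>C x) = c *\<^sub>C A x) \<and>
    (\<exists>K. \<forall>x\<in>M. norm (A x) \<le> K * norm x)"

definition adjoint_on :: "'a::chilbert_space set \<Rightarrow> ('a \<Rightarrow> 'a) \<Rightarrow> 'a \<Rightarrow> 'a" where
  "adjoint_on M A y = (THE z. z \<in> M \<and> (\<forall>x\<in>M. cinner (A x) y = cinner x z))"

abbreviation cadjoint :: "('a::chilbert_space \<Rightarrow> 'a) \<Rightarrow> 'a \<Rightarrow> 'a" where
  "cadjoint \<equiv> adjoint_on UNIV"

definition commutator :: "('a::chilbert_space \<Rightarrow> 'a) \<Rightarrow> ('a \<Rightarrow> 'a) \<Rightarrow> 'a \<Rightarrow> 'a" where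
  "commutator S T x = S (T x) - T (S x)"

text \<open>The element \<open>0\<close> does not affect the supremum unless \<open>M = {0}\<close>, where the set of unit
  vectors is empty and the numerical radius is \<open>0\<close>.\<close>

definition numerical_radius_on :: "'a::chilbert_space set \<Rightarrow> ('a \<Rightarrow> 'a) \<Rightarrow> real" where
  "numerical_radius_on M A = Sup (insert 0 {cmod (cinner (A x) x) |x. x \<in> M \<and> norm x = 1})"

definition contraction :: "('a::chilbert_space \<Rightarrow> 'a) \<Rightarrow> bool" where
  "contraction T \<longleftrightarrow> bounded_clinear T \<and> onorm T \<le> 1"

definition positive_op :: "('a::chilbert_space \<Rightarrow> 'a) \<Rightarrow> bool" where
  "positive_op P \<longleftrightarrow> bounded_clinear P \<and> (\<forall>x. cinner (P x) x \<in> \<real>\<^sub>\<ge>\<^sub>0)"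

definition sqrt_op :: "('a::chilbert_space \<Rightarrow> 'a) \<Rightarrow> 'a \<Rightarrow> 'a" where
  "sqrt_op P = (THE S. positive_op S \<and> S \<circ> S = P)"

definition defect_op :: "('a::chilbert_space \<Rightarrow> 'a) \<Rightarrow> 'a \<Rightarrow> 'a" where
  "defect_op T = sqrt_op (\<lambda>x. x - cadjoint T (T x))"

definition defect_space :: "('a::chilbert_space \<Rightarrow> 'a) \<Rightarrow> 'a set" where
  "defect_space T = closure (range (defect_op T))"

section \<open>The Taylor joint spectrum of a commuting triple\<close>

text \<open>The coboundary maps of the Koszul complex
  \<open>0 \<rightarrow> H \<rightarrow> H\<^sup>3 \<rightarrow> H\<^sup>3 \<rightarrow> H \<rightarrow> 0\<close>, that is, of \<open>H \<otimes> \<Lambda>\<complex>\<^sup>3\<close> with differential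
  \<open>\<xi> \<mapsto> \<Sum>i. S\<^sub>i e\<^sub>i \<and> \<xi>\<close>, in the bases \<open>1\<close>; \<open>e\<^sub>1, e\<^sub>2, e\<^sub>3\<close>;
  \<open>e\<^sub>1\<and>e\<^sub>2, e\<^sub>1\<and>e\<^sub>3, e\<^sub>2\<and>e\<^sub>3\<close>; \<open>e\<^sub>1\<and>e\<^sub>2\<and>e\<^sub>3\<close>.\<close>

context
  fixes S1 S2 S3 :: "'a::chilbert_space \<Rightarrow> 'a"
begin

definition koszul0 :: "'a \<Rightarrow> 'a \<times> 'a \<times> 'a" where
  "koszul0 x = (S1 x, S2 x, S3 x)"

definition koszul1 :: "'a \<times> 'a \<times> 'a \<Rightarrow> 'a \<times> 'a \<times> 'a" where
  "koszul1 = (\<lambda>(x1, x2, x3). (S1 x2 - S2 x1, S1 x3 - S3 x1, S2 x3 - S3 x2))"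

definition koszul2 :: "'a \<times> 'a \<times> 'a \<Rightarrow> 'a" where
  "koszul2 = (\<lambda>(y12, y13, y23). S1 y23 - S2 y13 + S3 y12)"

definition koszul_exact :: bool where
  "koszul_exact \<longleftrightarrow> {x. koszul0 x = 0} = {0} \<and> {x. koszul1 x = 0} = range koszul0 \<and>
     {y. koszul2 y = 0} = range koszul1 \<and> range koszul2 = UNIV"

end

definition taylor_spectrum ::
  "('a::chilbert_space \<Rightarrow> 'a) \<Rightarrow> ('a \<Rightarrow> 'a) \<Rightarrow> ('a \<Rightarrow> 'a) \<Rightarrow> (complex \<times> complex \<times> complex) set" where
  "taylor_spectrum T1 T2 T3 = {(l1, l2, l3).
     \<not> koszul_exact (\<lambda>x. T1 x - l1 *\<^sub>C x) (\<lambda>x. T2 x - l2 *\<^sub>C x) (\<lambda>x. T3 x - l3 *\<^sub>C x)}"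

section \<open>The tetrablock and tetrablock contractions\<close>

definition tetrablock :: "(complex \<times> complex \<times> complex) set" where
  "tetrablock = {(x1, x2, x3).
     \<forall>z w. cmod z \<le> 1 \<and> cmod w \<le> 1 \<longrightarrow> 1 - z * x1 - w * x2 + z * w * x3 \<noteq> 0}"

text \<open>A polynomial in three variables is its coefficient family: the coefficient at \<open>(i, j, k)\<close>
  belongs to the monomial with exponents \<open>i\<close>, \<open>j\<close>, \<open>k\<close>.\<close>

type_synonym poly3 = "(nat \<times> nat \<times> nat) \<Rightarrow>\<^sub>0 complex"

definition poly3_eval :: "poly3 \<Rightarrow> complex \<times> complex \<times> complex \<Rightarrow> complex" where
  "poly3_eval p = (\<lambda>(x1, x2, x3).
     \<Sum>(i, j, k)\<in>Poly_Mapping.keys p. Poly_Mapping.lookup p (i, j, k) * (x1 ^ i * x2 ^ j * x3 ^ k))"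

definition poly3_op ::
  "poly3 \<Rightarrow> ('a::chilbert_space \<Rightarrow> 'a) \<Rightarrow> ('a \<Rightarrow> 'a) \<Rightarrow> ('a \<Rightarrow> 'a) \<Rightarrow> 'a \<Rightarrow> 'a" where
  "poly3_op p T1 T2 T3 x =
     (\<Sum>(i, j, k)\<in>Poly_Mapping.keys p. Poly_Mapping.lookup p (i, j, k) *\<^sub>C (T1 ^^ i) ((T2 ^^ j) ((T3 ^^ k) x)))"

definition commuting_triple ::
  "('a::chilbert_space \<Rightarrow> 'a) \<Rightarrow> ('a \<Rightarrow> 'a) \<Rightarrow> ('a \<Rightarrow> 'a) \<Rightarrow> bool" where
  "commuting_triple T1 T2 T3 \<longleftrightarrow> T1 \<circ> T2 = T2 \<circ> T1 \<and> T1 \<circ> T3 = T3 \<circ> T1 \<and> T2 \<circ> T3 = T3 \<circ> T2"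

definition tetrablock_contraction ::
  "('a::chilbert_space \<Rightarrow> 'a) \<Rightarrow> ('a \<Rightarrow> 'a) \<Rightarrow> ('a \<Rightarrow> 'a) \<Rightarrow> bool" where
  "tetrablock_contraction T1 T2 T3 \<longleftrightarrow>
     bounded_clinear T1 \<and> bounded_clinear T2 \<and> bounded_clinear T3 \<and>
     commuting_triple T1 T2 T3 \<and>
     taylor_spectrum T1 T2 T3 \<subseteq> closure tetrablock \<and>
     (\<forall>p. onorm (poly3_op p T1 T2 T3) \<le> (SUP x\<in>closure tetrablock. cmod (poly3_eval p x)))"

end

theory Submission
  imports Defs
begin

text \<open>The triple is dilated to an isometric triple \<open>V1, V2, V3\<close> with \<open>V1\<^sup>* V3 = V2\<close> and
  \<open>V2\<^sup>* V3 = V1\<close> on \<open>H \<oplus> D \<oplus> D \<oplus> \<dots>\<close>, where \<open>D\<close> is the defect space of \<open>T3\<close>, by block Toeplitz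
  operators with the symbols \<open>A1 + z A2\<^sup>*\<close>, \<open>A2 + z A1\<^sup>*\<close>; finitely supported sequences suffice,
  so no completion is needed. The commutation hypotheses make \<open>V1, V2, V3\<close> commute and the symbols
  normal; a normal operator of numerical radius at most \<open>1\<close> is a contraction, so the powers of
  \<open>V2\<close> grow at most linearly.

  Polynomials \<open>p\<close> in such a triple satisfy \<open>\<parallel>p(V) x\<parallel>\<^sup>2 \<le> \<parallel>x\<parallel> \<parallel>p(V)\<^sup>2 x\<parallel>\<close>, as if \<open>p(V)\<close> were normal.
  Hence linear growth already gives \<open>\<parallel>V2\<parallel> \<le> 1\<close>, and a von Neumann inequality up to a factor
  polynomial in the degree already gives the sharp one. Such a crude inequality holds because a
  component of \<open>p\<close> that is homogeneous under the two circle actions on the distinguished boundary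
  \<open>{(cnj x * u, x, u). cmod x \<le> 1, cmod u = 1}\<close> reduces to the Hausdorff moment sequence
  \<open>a \<mapsto> \<parallel>V2\<^sup>a x\<parallel>\<^sup>2\<close>, and the number of components is quadratic in the degree.

  A point outside the closed tetrablock is a zero of \<open>1 - z x1 - w x2 + z w x3\<close> for some \<open>z, w\<close> in the
  open disc. The operator \<open>1 - z T1 - w T2 + z w T3\<close> is invertible because
  \<open>\<parallel>T1 x - w T3 x\<parallel> \<le> \<parallel>x - w T2 x\<parallel>\<close>, so the Koszul complex at that point is exact.\<close>

text \<open>The classical argument extends the isometric triple to commuting normal operators with
  joint spectrum in the distinguished boundary and applies the spectral theorem. What remains of it
  here is one algebraic fact: for p of degree at most n, p(V)^* V3^n is again a polynomial in the
  triple. So p(V) has an adjoint, up to the isometry V3^n, inside a commutative algebra.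

  In the commutation of A1 + z A2^* with A2 + z A1^*, the coefficients of 1, z and z^2 are A1 A2 =
  A2 A1, the equation [A1^*, A1] = [A2^*, A2], and the adjoint of the first relation. For cmod z = 1
  the adjoint of A2 + z A1^* is cnj z times A1 + z A2^*, so the same relations say that the symbol
  is normal. The numerical radius hypothesis passes from A1 + z A2 to A2 + z A1^* because, taken
  over the whole circle, it bounds the sum of the moduli of two quadratic forms, and these do not
  change when A1 is replaced by its adjoint.

  Growth of V2^n comes from the column below T2 alone: T2 and the Toeplitz part are each
  contractive.\<close>

text \<open>Applied to \<open>a k = \<parallel>P\<^sup>n x\<parallel>\<close> with \<open>n = 2^k\<close> and \<open>e = \<parallel>x\<parallel>\<close>, this removes a loss that is
  polynomial in \<open>n\<close> from a bound for \<open>P\<close>.\<close>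

lemma doubling_growth_bound:
  fixes a :: "nat \<Rightarrow> real"
  assumes nonneg: "\<And>k. 0 \<le> a k" "0 \<le> e" "0 \<le> b"
    and sq: "\<And>k. (a k)\<^sup>2 \<le> e * a (Suc k)"
    and growth: "\<And>k. a k \<le> C * 4 ^ k * b ^ (2 ^ k)"
  shows "a 0 \<le> b * e"
proof (cases "e = 0")
  case True
  with sq[of 0] show ?thesis by simp
next
  case False
  with nonneg have e: "e > 0" by simp
  have pw: "(a 0 / e) ^ (2 ^ k) \<le> a k / e" for k
  proof (induction k)
    case (Suc k)
    have "(a 0 / e) ^ (2 ^ Suc k) = ((a 0 / e) ^ (2 ^ k))\<^sup>2"
      by (simp add: power_mult mult.commute flip: power_mult)
    also have "\<dots> \<le> (a k / e)\<^sup>2"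
      using Suc nonneg e by (intro power_mono) auto
    also have "\<dots> \<le> a (Suc k) / e"
      using sq[of k] e by (simp add: power2_eq_square field_simps)
    finally show ?case .
  qed auto
  show ?thesis
  proof (rule ccontr)
    assume "\<not> a 0 \<le> b * e"
    hence gt: "a 0 > b * e" by simp
    have bpos: "b > 0"
    proof (rule ccontr)
      assume "\<not> 0 < b"
      with nonneg have "b = 0" by simp
      with growth[of 0] gt e nonneg(1)[of 0] show False by simp
    qed
    define c where "c = a 0 / e / b"
    have c: "c > 1" using gt bpos e by (simp add: c_def field_simps)
    \<comment> \<open>The loss is 4^k = n^2 for n = 2^k. Bernoulli bounds d^n below by n (d - 1), so
      the cube root makes c^n at least (n (d - 1))^3, one power of n more than the loss.\<close>
    define d where "d = root 3 c"
    have d: "d > 1" "d ^ 3 = c" using c by (auto simp: d_def)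
    have "real (2 ^ k) * (d - 1) ^ 3 \<le> C / e" for k
    proof -
      let ?n = "2 ^ k :: nat"
      have "c ^ ?n = (a 0 / e) ^ ?n / b ^ ?n" by (simp add: c_def power_divide power_mult_distrib)
      also have "\<dots> \<le> (a k / e) / b ^ ?n" using pw[of k] bpos by (intro divide_right_mono) auto
      also have "\<dots> \<le> (C * 4 ^ k * b ^ ?n / e) / b ^ ?n"
        using growth[of k] e bpos by (intro divide_right_mono) auto
      also have "\<dots> = C / e * 4 ^ k" using bpos by simp
      finally have up: "c ^ ?n \<le> C / e * 4 ^ k" .
      have "1 + real ?n * (d - 1) \<le> (1 + (d - 1)) ^ ?n"
        using d by (intro Bernoulli_inequality) auto
      hence "real ?n * (d - 1) \<le> d ^ ?n" by simp
      hence "(real ?n * (d - 1)) ^ 3 \<le> (d ^ ?n) ^ 3"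
        using d by (intro power_mono) auto
      also have "(d ^ ?n) ^ 3 = c ^ ?n" by (simp add: d(2)[symmetric] mult.commute flip: power_mult)
      also note up
      finally have "(real ?n * (d - 1) ^ 3) * (real ?n)\<^sup>2 \<le> C / e * 4 ^ k"
        by (simp add: power_mult_distrib power2_eq_square power3_eq_cube algebra_simps)
      moreover have "(real ?n)\<^sup>2 = 4 ^ k" by (simp add: power2_eq_square flip: power_mult_distrib)
      ultimately have "(real ?n * (d - 1) ^ 3) * 4 ^ k \<le> C / e * 4 ^ k" by simp
      thus ?thesis by (subst (asm) mult_le_cancel_right_pos) auto
    qed
    moreover obtain k where "C / e / (d - 1) ^ 3 < 2 ^ k"
      using real_arch_pow[of 2 "C / e / (d - 1) ^ 3"] by auto
    hence "C / e < 2 ^ k * (d - 1) ^ 3" by (subst (asm) pos_divide_less_eq) (use d in auto)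
    ultimately show False by (metis of_nat_power of_nat_numeral linorder_not_less)
  qed
qed

section \<open>Completely monotone sequences\<close>

text \<open>For the moments of a measure, \<open>d b a\<close> is the integral of t^a (1 - t)^b, and
  the identity comes from the binomial expansion of ((1 - t) + t)^m under the integral.\<close>

lemma iterated_difference_expansion:
  fixes d :: "nat \<Rightarrow> nat \<Rightarrow> real"
  assumes diff: "\<And>b a. d (Suc b) a = d b a - d b (Suc a)"
  shows "d b a = (\<Sum>k\<le>m. real (m choose k) * d (b + m - k) (a + k))"
proof (induction m arbitrary: a b)
  case (Suc m)
  have "d b a = d (Suc b) a + d b (Suc a)" using diff by simp
  also have "d (Suc b) a = (\<Sum>k\<le>m. real (m choose k) * d (Suc b + m - k) (a + k))" by (rule Suc)
  also have "\<dots> = (\<Sum>k\<le>Suc m. real (m choose k) * d (Suc b + m - k) (a + k))" by simp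
  also have "\<dots> = d (Suc b + m) a + (\<Sum>k\<le>m. real (m choose Suc k) * d (b + m - k) (a + Suc k))"
    by (subst sum.atMost_Suc_shift) simp
  also have "d b (Suc a) = (\<Sum>k\<le>m. real (m choose k) * d (b + m - k) (Suc a + k))" by (rule Suc)
  finally have "d b a = d (Suc b + m) a
      + (\<Sum>k\<le>m. real (Suc m choose Suc k) * d (b + m - k) (a + Suc k))"
    by (simp add: sum.distrib algebra_simps)
  also have "\<dots> = (\<Sum>k\<le>Suc m. real (Suc m choose k) * d (b + Suc m - k) (a + k))"
    by (subst sum.atMost_Suc_shift) simp
  finally show ?case .
qed simp

text \<open>Both quantities are products of j factors, (k - i) / (n - i) against k / n, and products
  of numbers of modulus at most 1 differ by at most the sum of the differences of their
  factors.\<close>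

lemma binomial_quotient_approx:
  assumes "k \<le> n" "2 * j \<le> n" "0 < n"
  shows "\<bar>real (k choose j) / real (n choose j) - (real k / real n) ^ j\<bar> \<le> real j * (real j / (real n - real j))"
proof (cases "j = 0")
  case False
  have jn: "j < n" using assms False by simp
  have *: "real (m choose j) = (\<Prod>i<j. (real m - real i)) / fact j" for m
    by (simp add: binomial_gbinomial gbinomial_prod_rev lessThan_atLeast0)
  have nz: "(\<Prod>i<j. (real n - real i)) \<noteq> 0" using jn by auto
  have eq: "real (k choose j) / real (n choose j) = (\<Prod>i<j. (real k - real i) / (real n - real i))"
    by (simp add: * prod_dividef)
  \<comment> \<open>For k < i the factor (k - i) / (n - i) is negative; 2 * j \<le> n keeps its
    modulus at most 1.\<close>
  have "\<bar>(\<Prod>i<j. (real k - real i) / (real n - real i)) - (\<Prod>i<j. real k / real n)\<bar>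
    \<le> (\<Sum>i<j. \<bar>(real k - real i) / (real n - real i) - real k / real n\<bar>)"
    using assms jn
    by (intro norm_prod_diff[where 'a = real, unfolded real_norm_def]) (auto simp: field_simps abs_le_iff)
  also have "\<dots> \<le> (\<Sum>i<j. real j / (real n - real j))"
  proof (rule sum_mono)
    fix i assume "i \<in> {..<j}"
    hence i: "i < j" by simp
    have "\<bar>(real k - real i) / (real n - real i) - real k / real n\<bar>
        = (real i / (real n - real i)) * ((real n - real k) / real n)"
    proof -
      have "(real k - real i) / (real n - real i) - real k / real n
          = - ((real i / (real n - real i)) * ((real n - real k) / real n))"
        using i jn assms by (simp add: field_simps)
      thus ?thesis using i jn assms by (simp add: abs_mult)
    qed
    also have "\<dots> \<le> (real j / (real n - real j)) * 1"
      using i jn assms by (intro mult_mono frac_le) (auto simp: field_simps)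
    finally show "\<bar>(real k - real i) / (real n - real i) - real k / real n\<bar> \<le> real j / (real n - real j)"
      by simp
  qed
  finally show ?thesis by (simp add: eq)
qed auto

text \<open>Evaluating a polynomial at a Hausdorff moment sequence is a limit of averages of its values
  at the points \<open>k/n\<close>, with the Bernstein weights \<open>(n choose k) \<Delta>\<^sup>n\<^sup>-\<^sup>k \<mu>\<^sub>k \<ge> 0\<close>.\<close>

lemma hausdorff_moment_bound:
  fixes d :: "nat \<Rightarrow> nat \<Rightarrow> real" and c :: "'i \<Rightarrow> complex"
  assumes diff: "\<And>b a. d (Suc b) a = d b a - d b (Suc a)"
    and nonneg: "\<And>b a. 0 \<le> d b a"
    and fin: "finite S"
    and bound: "\<And>t. 0 \<le> t \<Longrightarrow> t \<le> 1 \<Longrightarrow> cmod (\<Sum>i\<in>S. c i * complex_of_real (t ^ e i)) \<le> M"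
  shows "cmod (\<Sum>i\<in>S. c i * complex_of_real (d 0 (e i))) \<le> M * d 0 0"
proof -
  define J where "J = Max (insert 0 (e ` S))"
  have eJ: "e i \<le> J" if "i \<in> S" for i using that fin by (auto simp: J_def)
  \<comment> \<open>Total error of replacing each quotient
    \<open>(k choose e i) / (n choose e i)\<close> by (k / n) ^ e i; it vanishes as n grows.\<close>
  define \<delta> where "\<delta> n = (\<Sum>i\<in>S. cmod (c i) * (real (e i) * (real (e i) / (real n - real (e i)))))" for n
  have main: "cmod (\<Sum>i\<in>S. c i * complex_of_real (d 0 (e i))) \<le> (M + \<delta> n) * d 0 0"
    if n: "n \<ge> 2 * J + 1" for n
  proof -
    define w where "w k = real (n choose k) * d (n - k) k" for k
    have w0: "w k \<ge> 0" for k by (simp add: w_def nonneg)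
    \<comment> \<open>Expanding with m = n - j leaves only the differences d (n - k) k of total
      index n. Trading binomial coefficients then produces weights w k that are the same for every
      j.\<close>
    have moment: "d 0 j = (\<Sum>k\<le>n. real (k choose j) / real (n choose j) * w k)" if "j \<le> n" for j
    proof -
      have "d 0 j = (\<Sum>k\<le>n-j. real (n - j choose k) * d (0 + (n - j) - k) (j + k))"
        by (rule iterated_difference_expansion) (rule diff)
      also have "\<dots> = (\<Sum>k\<in>{j..n}. real (n - j choose (k - j)) * d (n - k) k)"
        by (rule sum.reindex_bij_witness[of _ "\<lambda>k. k - j" "\<lambda>k. k + j"]) (use that in \<open>auto simp: add.commute\<close>)
      also have "\<dots> = (\<Sum>k\<in>{j..n}. real (k choose j) / real (n choose j) * w k)"
      proof (rule sum.cong[OF refl])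
        fix k assume k: "k \<in> {j..n}"
        have "(n choose k) * (k choose j) = (n choose j) * (n - j choose (k - j))"
          using k by (intro choose_mult) auto
        hence "real (n choose k) * real (k choose j) = real (n choose j) * real (n - j choose (k - j))"
          by (metis of_nat_mult)
        moreover have "real (n choose j) > 0" using that by simp
        ultimately show "real (n - j choose (k - j)) * d (n - k) k = real (k choose j) / real (n choose j) * w k"
          by (simp add: w_def field_simps)
      qed
      also have "\<dots> = (\<Sum>k\<le>n. real (k choose j) / real (n choose j) * w k)"
        by (rule sum.mono_neutral_left) auto
      finally show ?thesis .
    qed
    have total: "(\<Sum>k\<le>n. w k) = d 0 0" using moment[of 0] by simp
    define q where "q k i = real (k choose e i) / real (n choose e i)" for k i
    have eq: "(\<Sum>i\<in>S. c i * complex_of_real (d 0 (e i)))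
        = (\<Sum>k\<le>n. (\<Sum>i\<in>S. c i * complex_of_real (q k i)) * complex_of_real (w k))"
    proof -
      have "(\<Sum>i\<in>S. c i * complex_of_real (d 0 (e i)))
          = (\<Sum>i\<in>S. \<Sum>k\<le>n. c i * complex_of_real (q k i) * complex_of_real (w k))"
      proof (rule sum.cong[OF refl])
        fix i assume "i \<in> S"
        hence "e i \<le> n" using eJ n by fastforce
        from moment[OF this]
        have "complex_of_real (d 0 (e i)) = (\<Sum>k\<le>n. complex_of_real (q k i) * complex_of_real (w k))"
          by (simp add: q_def)
        thus "c i * complex_of_real (d 0 (e i)) = (\<Sum>k\<le>n. c i * complex_of_real (q k i) * complex_of_real (w k))"
          by (simp add: sum_distrib_left mult.assoc)
      qed
      thus ?thesis by (subst (asm) sum.swap) (simp add: sum_distrib_right)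
    qed
    have pt: "cmod (\<Sum>i\<in>S. c i * complex_of_real (q k i)) \<le> M + \<delta> n" if "k \<le> n" for k
    proof -
      let ?t = "real k / real n"
      have "cmod (\<Sum>i\<in>S. c i * complex_of_real (q k i))
         = cmod ((\<Sum>i\<in>S. c i * complex_of_real (?t ^ e i)) + (\<Sum>i\<in>S. c i * complex_of_real (q k i - ?t ^ e i)))"
        by (simp add: algebra_simps flip: sum.distrib)
      also have "\<dots> \<le> M + \<delta> n"
      proof (rule order_trans[OF norm_triangle_ineq add_mono])
        show "cmod (\<Sum>i\<in>S. c i * complex_of_real (?t ^ e i)) \<le> M"
          using that n by (intro bound) auto
        show "cmod (\<Sum>i\<in>S. c i * complex_of_real (q k i - ?t ^ e i)) \<le> \<delta> n"
          unfolding \<delta>_def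
        proof (rule order_trans[OF norm_sum sum_mono])
          fix i assume "i \<in> S"
          hence "e i \<le> J" by (rule eJ)
          hence "\<bar>q k i - ?t ^ e i\<bar> \<le> real (e i) * (real (e i) / (real n - real (e i)))"
            unfolding q_def using that n by (intro binomial_quotient_approx) auto
          thus "cmod (c i * complex_of_real (q k i - ?t ^ e i))
             \<le> cmod (c i) * (real (e i) * (real (e i) / (real n - real (e i))))"
            by (simp only: norm_mult norm_of_real mult_left_mono norm_ge_zero)
        qed
      qed
      finally show ?thesis .
    qed
    have "cmod (\<Sum>i\<in>S. c i * complex_of_real (d 0 (e i))) \<le> (\<Sum>k\<le>n. (M + \<delta> n) * w k)"
      unfolding eq
    proof (rule order_trans[OF norm_sum sum_mono])
      fix k assume "k \<in> {..n}"
      thus "cmod ((\<Sum>i\<in>S. c i * complex_of_real (q k i)) * complex_of_real (w k)) \<le> (M + \<delta> n) * w k"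
        using pt[of k] w0[of k] by (simp add: norm_mult mult_right_mono)
    qed
    thus ?thesis by (simp add: total flip: sum_distrib_left)
  qed
  have lim0: "(\<lambda>n. real (e i) / (real n - real (e i))) \<longlonglongrightarrow> 0" for i
    by (rule real_tendsto_divide_at_top[OF tendsto_const])
       (simp add: filterlim_real_sequentially filterlim_tendsto_add_at_top[OF tendsto_const, where c = "- real (e i)", simplified])
  have "\<delta> \<longlonglongrightarrow> (\<Sum>i\<in>S. cmod (c i) * (real (e i) * 0))"
    unfolding \<delta>_def by (intro tendsto_sum tendsto_mult tendsto_const lim0)
  hence "(\<lambda>n. (M + \<delta> n) * d 0 0) \<longlonglongrightarrow> (M + 0) * d 0 0"
    by (intro tendsto_intros) simp
  from tendsto_lowerbound[OF this, of "cmod (\<Sum>i\<in>S. c i * complex_of_real (d 0 (e i)))"] main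
  show ?thesis by (auto simp: eventually_sequentially)
qed

section \<open>Fourier coefficients\<close>

text \<open>A geometric sum over roots of unity. The bound on s rules out the nonzero multiples of
  R, at which the sum would also be R.\<close>

lemma sum_cis_multiples:
  fixes s :: int
  assumes "\<bar>s\<bar> < int R"
  shows "(\<Sum>a<R. cis (2 * pi * real a / real R * of_int s)) = (if s = 0 then of_nat R else 0)"
proof (cases "s = 0")
  case False
  have R: "R > 0" using assms by linarith
  define z where "z = cis (2 * pi * of_int s / real R)"
  have "z \<noteq> 1"
  proof
    assume "z = 1"
    hence "cos (2 * pi * of_int s / real R) = 1" by (simp add: z_def complex_eq_iff)
    then obtain n :: int where n: "2 * pi * of_int s / real R = of_int n * 2 * pi"
      by (metis cos_one_2pi_int)
    hence "of_int s = real_of_int n * real R" using R by (simp add: field_simps)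
    hence sn: "s = n * int R" by (metis of_int_eq_iff of_int_mult of_int_of_nat_eq)
    hence "n \<noteq> 0" using False by auto
    hence "\<bar>n\<bar> * int R \<ge> 1 * int R" by (intro mult_right_mono) auto
    thus False using assms sn by (simp add: abs_mult)
  qed
  have "(\<Sum>a<R. cis (2 * pi * real a / real R * of_int s)) = (\<Sum>a<R. z ^ a)"
    by (intro sum.cong refl) (simp add: z_def Complex.DeMoivre mult_ac)
  also have "\<dots> = (z ^ R - 1) / (z - 1)" using \<open>z \<noteq> 1\<close> by (rule geometric_sum)
  also have "z ^ R = 1"
    using R cis_multiple_2pi[of "of_int s"] by (simp add: z_def Complex.DeMoivre)
  finally show ?thesis using False by simp
qed auto

lemma sum_sum_list_swap:
  fixes f :: "'b \<Rightarrow> 'a \<Rightarrow> 'c::comm_monoid_add"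
  shows "(\<Sum>a\<in>A. \<Sum>t\<leftarrow>ts. f a t) = (\<Sum>t\<leftarrow>ts. \<Sum>a\<in>A. f a t)"
  by (induction ts) (simp_all add: sum.distrib)

text \<open>The coefficient is a mean over R equally spaced angles of the trigonometric polynomial
  times a phase. R exceeds every modulus of s t - m, so no other frequency is aliased onto
  m.\<close>

lemma fourier_coefficient_bound:
  fixes g :: "'t \<Rightarrow> complex" and s :: "'t \<Rightarrow> int"
  assumes "\<And>\<theta>. cmod (\<Sum>t\<leftarrow>ts. g t * cis (\<theta> * of_int (s t))) \<le> M"
  shows "cmod (\<Sum>t\<leftarrow>filter (\<lambda>t. s t = m) ts. g t) \<le> M"
proof -
  \<comment> \<open>For the empty list this \<open>Max\<close> is unspecified; N enters only as a
    bound over the members of the list.\<close>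
  define N where "N = Max ((\<lambda>t. nat \<bar>s t - m\<bar>) ` set ts)"
  have N: "nat \<bar>s t - m\<bar> \<le> N" if "t \<in> set ts" for t
    unfolding N_def using that by (intro Max_ge) auto
  define R where "R = Suc N"
  define \<theta> where "\<theta> a = 2 * pi * real a / real R" for a
  have "(\<Sum>a<R. cis (- \<theta> a * of_int m) * (\<Sum>t\<leftarrow>ts. g t * cis (\<theta> a * of_int (s t))))
      = (\<Sum>t\<leftarrow>ts. g t * (\<Sum>a<R. cis (\<theta> a * of_int (s t - m))))"
    by (simp add: sum_list_const_mult[symmetric] sum_sum_list_swap sum_distrib_left mult_ac
        cis_mult algebra_simps del: sum_list_const_mult)
  also have "\<dots> = (\<Sum>t\<leftarrow>ts. if s t = m then of_nat R * g t else 0)"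
  proof (intro arg_cong[where f = sum_list] map_cong refl)
    fix t assume t: "t \<in> set ts"
    have "(\<Sum>a<R. cis (\<theta> a * of_int (s t - m))) = (if s t - m = 0 then of_nat R else 0)"
      unfolding \<theta>_def using N[OF t] by (intro sum_cis_multiples) (auto simp: R_def)
    thus "g t * (\<Sum>a<R. cis (\<theta> a * of_int (s t - m))) = (if s t = m then of_nat R * g t else 0)"
      by simp
  qed
  also have "\<dots> = of_nat R * (\<Sum>t\<leftarrow>filter (\<lambda>t. s t = m) ts. g t)"
    by (induction ts) (simp_all add: algebra_simps)
  finally have eq: "of_nat R * (\<Sum>t\<leftarrow>filter (\<lambda>t. s t = m) ts. g t)
      = (\<Sum>a<R. cis (- \<theta> a * of_int m) * (\<Sum>t\<leftarrow>ts. g t * cis (\<theta> a * of_int (s t))))" ..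
  have "real R * cmod (\<Sum>t\<leftarrow>filter (\<lambda>t. s t = m) ts. g t)
      = cmod (of_nat R * (\<Sum>t\<leftarrow>filter (\<lambda>t. s t = m) ts. g t))" by (simp add: norm_mult)
  also have "\<dots> \<le> (\<Sum>a<R. M)"
    unfolding eq by (intro order_trans[OF norm_sum] sum_mono) (simp add: norm_mult assms)
  also have "\<dots> = real R * M" by simp
  finally show ?thesis by (simp add: R_def)
qed

section \<open>Positive semidefinite Hermitian forms\<close>

text \<open>Semidefinite and without completeness, so that one Cauchy-Schwarz inequality serves the
  Hilbert space, the finitely supported sequences, and the possibly degenerate form x, y \<mapsto>
  cinner (S x) y of a positive operator S.\<close>

locale hermitian_form = vector_space sc
  for sc :: "complex \<Rightarrow> 'v \<Rightarrow> 'v::ab_group_add" +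
  fixes ip :: "'v \<Rightarrow> 'v \<Rightarrow> complex"
  assumes ip_add_left: "ip (x + y) z = ip x z + ip y z"
    and ip_sc_left: "ip (sc a x) y = a * ip x y"
    and ip_commute: "ip x y = cnj (ip y x)"
    and ip_nonneg: "0 \<le> Re (ip x x)"
begin

definition nrm :: "'v \<Rightarrow> real" where "nrm x = sqrt (Re (ip x x))"

lemma ip_add_right: "ip x (y + z) = ip x y + ip x z"
  by (metis ip_add_left ip_commute complex_cnj_add)

lemma ip_sc_right: "ip x (sc a y) = cnj a * ip x y"
  by (metis ip_sc_left ip_commute complex_cnj_mult)

lemma ip_zero_left [simp]: "ip 0 y = 0"
  using ip_sc_left[of 0 0 y] by simp

lemma ip_zero_right [simp]: "ip x 0 = 0"
  using ip_sc_right[of x 0 0] by simp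

lemma ip_minus_left: "ip (- x) y = - ip x y"
  using ip_add_left[of x "- x" y] by (simp add: eq_neg_iff_add_eq_0 add.commute)

lemma ip_minus_right: "ip x (- y) = - ip x y"
  using ip_add_right[of x y "- y"] by (simp add: eq_neg_iff_add_eq_0 add.commute)

lemma ip_diff_left: "ip (x - y) z = ip x z - ip y z"
  using ip_add_left[of x "- y" z] by (simp add: ip_minus_left)

lemma ip_diff_right: "ip x (y - z) = ip x y - ip x z"
  using ip_add_right[of x y "- z"] by (simp add: ip_minus_right)

lemma ip_sum_list_right: "ip x (\<Sum>t\<leftarrow>ts. f t) = (\<Sum>t\<leftarrow>ts. ip x (f t))"
  by (induction ts) (simp_all add: ip_add_right)

lemma ip_sum_left: "ip (\<Sum>t\<in>A. f t) y = (\<Sum>t\<in>A. ip (f t) y)"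
  by (induction A rule: infinite_finite_induct) (simp_all add: ip_add_left)

lemma ip_sum_right: "ip y (\<Sum>t\<in>A. f t) = (\<Sum>t\<in>A. ip y (f t))"
  by (induction A rule: infinite_finite_induct) (simp_all add: ip_add_right)

lemma ip_self: "ip x x = complex_of_real ((nrm x)\<^sup>2)"
proof -
  have "Im (ip x x) = 0" using ip_commute[of x x] by (simp add: complex_eq_iff)
  thus ?thesis by (simp add: nrm_def ip_nonneg complex_eq_iff)
qed

lemma nrm_nonneg [simp]: "0 \<le> nrm x"
  by (simp add: nrm_def ip_nonneg)

lemma nrm_zero [simp]: "nrm 0 = 0"
  by (simp add: nrm_def)

lemma nrm_eqI: "ip x x = ip y y \<Longrightarrow> nrm x = nrm y"
  by (simp add: nrm_def)

lemma nrm_sc: "nrm (sc a x) = cmod a * nrm x"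
proof -
  have "a * cnj a = complex_of_real ((cmod a)\<^sup>2)" by (simp only: complex_norm_square)
  moreover have "ip (sc a x) (sc a x) = (a * cnj a) * ip x x" by (simp add: ip_sc_left ip_sc_right)
  ultimately have "complex_of_real ((nrm (sc a x))\<^sup>2) = complex_of_real ((cmod a * nrm x)\<^sup>2)"
    by (simp add: ip_self power_mult_distrib)
  hence "(nrm (sc a x))\<^sup>2 = (cmod a * nrm x)\<^sup>2" by (simp only: of_real_eq_iff)
  thus ?thesis by (simp add: power2_eq_iff_nonneg)
qed

lemma cauchy_schwarz: "cmod (ip x y) \<le> nrm x * nrm y"
proof -
  define b where "b = ip x y"
  have key: "0 \<le> (nrm x)\<^sup>2 - 2 * t * (cmod b)\<^sup>2 + t\<^sup>2 * (cmod b)\<^sup>2 * (nrm y)\<^sup>2" for t :: real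
  proof -
    let ?z = "x - sc (of_real t * b) y"
    have "ip ?z ?z = ip x x - of_real t * (cnj b * b) - of_real t * (b * cnj b)
        + (of_real t)\<^sup>2 * (b * cnj b) * ip y y"
      by (simp add: ip_diff_left ip_diff_right ip_sc_left ip_sc_right b_def ip_commute[of y x]
          power2_eq_square algebra_simps)
    also have "\<dots> = complex_of_real ((nrm x)\<^sup>2 - 2 * t * (cmod b)\<^sup>2 + t\<^sup>2 * (cmod b)\<^sup>2 * (nrm y)\<^sup>2)"
      by (simp add: ip_self complex_norm_square mult_ac del: of_real_power)
         (simp add: algebra_simps complex_norm_square)
    finally show ?thesis using ip_nonneg[of ?z] by (metis Re_complex_of_real)
  qed
  have "(cmod b)\<^sup>2 \<le> (nrm x)\<^sup>2 * (nrm y)\<^sup>2"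
  proof (cases "nrm y = 0")
    case True
    have "cmod b = 0"
    proof (rule ccontr)
      assume "cmod b \<noteq> 0"
      \<comment> \<open>When nrm y = 0 the quadratic is affine in t, and this t makes it -1.\<close>
      with key[of "((nrm x)\<^sup>2 + 1) / (2 * (cmod b)\<^sup>2)"] True show False by simp
    qed
    thus ?thesis by simp
  next
    case False
    define s where "s = (nrm y)\<^sup>2"
    have s: "s > 0" using False by (simp add: s_def)
    hence "(1 / s)\<^sup>2 * (cmod b)\<^sup>2 * s = (cmod b)\<^sup>2 / s" by (simp add: power2_eq_square)
    with key[of "1 / s"] have "(cmod b)\<^sup>2 / s \<le> (nrm x)\<^sup>2" by (simp add: s_def)
    thus ?thesis using s by (simp add: field_simps s_def)
  qed
  hence "(cmod b)\<^sup>2 \<le> (nrm x * nrm y)\<^sup>2" by (simp add: power_mult_distrib)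
  thus ?thesis unfolding b_def by (rule power2_le_imp_le) simp
qed

lemma nrm_triangle: "nrm (x + y) \<le> nrm x + nrm y"
proof -
  have "complex_of_real ((nrm (x + y))\<^sup>2) = of_real ((nrm x)\<^sup>2) + of_real ((nrm y)\<^sup>2) + (ip x y + cnj (ip x y))"
    unfolding ip_self[symmetric] by (simp add: ip_add_left ip_add_right flip: ip_commute)
  also have "\<dots> = of_real ((nrm x)\<^sup>2 + (nrm y)\<^sup>2 + 2 * Re (ip x y))"
    by (simp add: complex_add_cnj)
  finally have "(nrm (x + y))\<^sup>2 = (nrm x)\<^sup>2 + (nrm y)\<^sup>2 + 2 * Re (ip x y)"
    by (simp only: of_real_eq_iff)
  also have "\<dots> \<le> (nrm x)\<^sup>2 + (nrm y)\<^sup>2 + 2 * (nrm x * nrm y)"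
    using cauchy_schwarz[of x y] complex_Re_le_cmod[of "ip x y"] by linarith
  finally have "(nrm (x + y))\<^sup>2 \<le> (nrm x + nrm y)\<^sup>2" by (simp add: power2_sum)
  thus ?thesis by (rule power2_le_imp_le) simp
qed

lemma nrm_sum: "nrm (\<Sum>t\<in>A. f t) \<le> (\<Sum>t\<in>A. nrm (f t))"
  by (induction A rule: infinite_finite_induct) (auto intro: order_trans[OF nrm_triangle])

end

section \<open>Polynomials as lists of terms\<close>

text \<open>Exponents may repeat in a list, so products and filters by bidegree never have to
  collect coefficients.\<close>

type_synonym term3 = "complex \<times> nat \<times> nat \<times> nat"

definition terms_eval :: "term3 list \<Rightarrow> complex \<Rightarrow> complex \<Rightarrow> complex \<Rightarrow> complex" where
  "terms_eval ts x1 x2 x3 = (\<Sum>(c, i, j, k)\<leftarrow>ts. c * (x1 ^ i * x2 ^ j * x3 ^ k))"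

fun term_mult :: "term3 \<Rightarrow> term3 \<Rightarrow> term3" where
  "term_mult (c, i, j, k) (c', i', j', k') = (c * c', i + i', j + j', k + k')"

definition terms_mult :: "term3 list \<Rightarrow> term3 list \<Rightarrow> term3 list" where
  "terms_mult ts us = concat (map (\<lambda>t. map (term_mult t) us) ts)"

definition terms_degree_le :: "nat \<Rightarrow> term3 list \<Rightarrow> bool" where
  "terms_degree_le d ts \<longleftrightarrow> (\<forall>(c, i, j, k)\<in>set ts. i + j + k \<le> d)"

text \<open>On the distinguished boundary \<open>x1 = cnj x2 * x3\<close>, \<open>cmod x3 = 1\<close> this is
  \<open>x3 ^ n\<close> times the complex conjugate; exponents are truncated unless the degree is at most \<open>n\<close>.\<close>

definition terms_conj :: "nat \<Rightarrow> term3 list \<Rightarrow> term3 list" where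
  "terms_conj n ts = map (\<lambda>(c, i, j, k). (cnj c, j, i, n - (i + j + k))) ts"

lemma terms_eval_mult: "terms_eval (terms_mult ts us) x1 x2 x3 = terms_eval ts x1 x2 x3 * terms_eval us x1 x2 x3"
proof (induction ts)
  case (Cons t ts)
  have "(\<Sum>(c, i, j, k)\<leftarrow>map (term_mult t) us. c * (x1 ^ i * x2 ^ j * x3 ^ k))
      = (case t of (c, i, j, k) \<Rightarrow> c * (x1 ^ i * x2 ^ j * x3 ^ k)) * terms_eval us x1 x2 x3"
    by (induction us) (auto simp: terms_eval_def power_add algebra_simps split: prod.splits)
  with Cons show ?case by (simp add: terms_eval_def terms_mult_def algebra_simps)
qed (simp add: terms_eval_def terms_mult_def)

lemma terms_degree_le_mult:
  "terms_degree_le d ts \<Longrightarrow> terms_degree_le e us \<Longrightarrow> terms_degree_le (d + e) (terms_mult ts us)"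
  by (fastforce simp: terms_degree_le_def terms_mult_def)

lemma terms_eval_conj_real: "terms_eval (terms_conj n ts) (of_real r) (of_real r) 1 = cnj (terms_eval ts (of_real r) (of_real r) 1)"
  by (induction ts) (auto simp: terms_eval_def terms_conj_def mult_ac)

section \<open>Tetrablock isometries\<close>

lemma funpow_commute_both:
  assumes "\<And>x. f (g x) = g (f x)"
  shows "(f ^^ m) ((g ^^ n) x) = (g ^^ n) ((f ^^ m) x)"
proof -
  have 1: "f ((g ^^ n) x) = (g ^^ n) (f x)" for x
    by (induction n) (simp_all add: assms)
  show ?thesis by (induction m) (simp_all add: 1)
qed

lemma module_hom_funpow: "module_hom s s f \<Longrightarrow> module_hom s s (f ^^ n)"
proof (induction n)
  case 0
  thus ?case by (simp add: module_hom_def module_hom_axioms_def)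
next
  case (Suc n)
  hence "module_hom s s (f \<circ> f ^^ n)" by (intro module_hom_compose) auto
  thus ?case by (simp only: funpow.simps)
qed

text \<open>On an incomplete space V1 and V2 may lack adjoints, so V1^* V3 = V2 and V2^* V3 = V1 are
  stated by pairing with V3 y. Contractivity of V2 is absent because it is derived from a growth
  bound within this locale.\<close>

locale tetrablock_isometry_form = hermitian_form sc ip
  for sc :: "complex \<Rightarrow> 'v \<Rightarrow> 'v::ab_group_add" and ip +
  fixes V1 V2 V3 :: "'v \<Rightarrow> 'v"
  assumes hom: "module_hom sc sc V1" "module_hom sc sc V2" "module_hom sc sc V3"
    and V12: "V1 (V2 x) = V2 (V1 x)"
    and V13: "V1 (V3 x) = V3 (V1 x)"
    and V23: "V2 (V3 x) = V3 (V2 x)"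
    and V3_isometry: "ip (V3 x) (V3 y) = ip x y"
    and V1_adj: "ip (V1 x) (V3 y) = ip x (V2 y)"
    and V2_adj: "ip (V2 x) (V3 y) = ip x (V1 y)"
begin

lemmas hom_add = hom[THEN module_hom.add]
lemmas hom_sc = hom[THEN module_hom.scale]
lemmas hom_diff = hom[THEN module_hom.diff]

definition mon :: "nat \<Rightarrow> nat \<Rightarrow> nat \<Rightarrow> 'v \<Rightarrow> 'v" where
  "mon i j k x = (V1 ^^ i) ((V2 ^^ j) ((V3 ^^ k) x))"

definition opl :: "term3 list \<Rightarrow> 'v \<Rightarrow> 'v" where
  "opl ts x = (\<Sum>(c, i, j, k)\<leftarrow>ts. sc c (mon i j k x))"

lemma funpow_commutes:
  "(V1 ^^ i) ((V2 ^^ j) x) = (V2 ^^ j) ((V1 ^^ i) x)"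
  "(V1 ^^ i) ((V3 ^^ k) x) = (V3 ^^ k) ((V1 ^^ i) x)"
  "(V2 ^^ j) ((V3 ^^ k) x) = (V3 ^^ k) ((V2 ^^ j) x)"
  by (intro funpow_commute_both V12 V13 V23)+

lemma mon_mon: "mon i j k (mon i' j' k' x) = mon (i + i') (j + j') (k + k') x"
  by (simp add: mon_def funpow_add funpow_commutes)

lemma module_hom_mon: "module_hom sc sc (mon i j k)"
proof -
  have "mon i j k = (V1 ^^ i) \<circ> ((V2 ^^ j) \<circ> (V3 ^^ k))" by (auto simp: mon_def)
  thus ?thesis by (auto intro!: module_hom_compose module_hom_funpow hom)
qed

lemmas mon_add = module_hom_mon[THEN module_hom.add]
lemmas mon_sc = module_hom_mon[THEN module_hom.scale]
lemmas mon_zero = module_hom_mon[THEN module_hom.zero]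

lemma opl_Nil: "opl [] x = 0" and opl_Cons: "opl ((c, i, j, k) # ts) x = sc c (mon i j k x) + opl ts x"
  by (simp_all add: opl_def)

lemma mon_opl: "mon i j k (opl ts x) = opl ts (mon i j k x)"
proof (induction ts)
  case (Cons t ts)
  thus ?case
    by (cases t) (simp add: opl_Cons mon_add mon_sc mon_mon add.commute)
qed (simp add: opl_Nil mon_zero)

lemma opl_append: "opl (ts @ us) x = opl ts x + opl us x"
  by (simp add: opl_def)

lemma opl_mult: "opl (terms_mult ts us) x = opl ts (opl us x)"
proof (induction ts)
  case (Cons t ts)
  obtain c i j k where t: "t = (c, i, j, k)" by (cases t)
  have "opl (map (term_mult t) us) x = sc c (mon i j k (opl us x))"
    by (induction us) (auto simp: opl_Nil opl_Cons t mon_zero mon_add mon_sc mon_mon scale_right_distrib)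
  moreover have "opl (terms_mult (t # ts) us) x = opl (map (term_mult t) us) x + opl (terms_mult ts us) x"
    by (simp add: terms_mult_def opl_append)
  ultimately show ?case by (simp add: Cons opl_Cons t)
qed (simp add: terms_mult_def opl_Nil)

section \<open>Adjoints of polynomials up to a power of V3\<close>

lemma V3_funpow_isometry: "ip ((V3 ^^ n) x) ((V3 ^^ n) y) = ip x y"
  by (induction n) (simp_all add: V3_isometry)

lemma nrm_V3_funpow: "nrm ((V3 ^^ n) x) = nrm x"
  by (rule nrm_eqI) (rule V3_funpow_isometry)

lemma V1_funpow_adj: "ip ((V1 ^^ n) x) ((V3 ^^ n) y) = ip x ((V2 ^^ n) y)"
proof (induction n arbitrary: x y)
  case (Suc n)
  have "ip ((V1 ^^ Suc n) x) ((V3 ^^ Suc n) y) = ip ((V1 ^^ n) (V1 x)) ((V3 ^^ n) (V3 y))"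
    by (simp add: funpow_swap1)
  also have "\<dots> = ip (V1 x) ((V2 ^^ n) (V3 y))" by (rule Suc)
  also have "(V2 ^^ n) (V3 y) = V3 ((V2 ^^ n) y)" using funpow_commutes(3)[of n 1] by simp
  finally show ?case by (simp add: V1_adj)
qed simp

lemma V2_funpow_adj: "ip ((V2 ^^ n) x) ((V3 ^^ n) y) = ip x ((V1 ^^ n) y)"
proof (induction n arbitrary: x y)
  case (Suc n)
  have "ip ((V2 ^^ Suc n) x) ((V3 ^^ Suc n) y) = ip ((V2 ^^ n) (V2 x)) ((V3 ^^ n) (V3 y))"
    by (simp add: funpow_swap1)
  also have "\<dots> = ip (V2 x) ((V1 ^^ n) (V3 y))" by (rule Suc)
  also have "(V1 ^^ n) (V3 y) = V3 ((V1 ^^ n) y)" using funpow_commutes(2)[of n 1] by simp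
  finally show ?case by (simp add: V2_adj)
qed simp

text \<open>Moving a factor V1, V2 or V3 across the form uses up one V3 on the right and leaves V2,
  V1 or nothing in its place.\<close>

lemma mon_adj:
  assumes "i + j + k \<le> n"
  shows "ip (mon i j k x) ((V3 ^^ n) y) = ip x (mon j i (n - (i + j + k)) y)"
proof -
  define r where "r = n - (i + j + k)"
  have n: "n = i + (j + (k + r))" using assms by (simp add: r_def)
  have "ip (mon i j k x) ((V3 ^^ n) y)
      = ip ((V2 ^^ j) ((V3 ^^ k) x)) ((V2 ^^ i) ((V3 ^^ (j + (k + r))) y))"
    unfolding n funpow_add[of i] comp_apply mon_def by (rule V1_funpow_adj)
  also have "(V2 ^^ i) ((V3 ^^ (j + (k + r))) y) = (V3 ^^ j) ((V2 ^^ i) ((V3 ^^ (k + r)) y))"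
    by (simp add: funpow_add funpow_commutes)
  also have "ip ((V2 ^^ j) ((V3 ^^ k) x)) \<dots> = ip ((V3 ^^ k) x) ((V1 ^^ j) ((V2 ^^ i) ((V3 ^^ (k + r)) y)))"
    by (rule V2_funpow_adj)
  also have "(V1 ^^ j) ((V2 ^^ i) ((V3 ^^ (k + r)) y)) = (V3 ^^ k) (mon j i r y)"
    by (simp add: mon_def funpow_add funpow_commutes)
  finally show ?thesis by (simp add: V3_funpow_isometry r_def)
qed

lemma opl_adj:
  assumes "terms_degree_le n ts"
  shows "ip (opl ts x) ((V3 ^^ n) y) = ip x (opl (terms_conj n ts) y)"
  using assms
proof (induction ts)
  case (Cons t ts)
  obtain c i j k where t: "t = (c, i, j, k)" by (cases t)
  from Cons show ?case
    by (simp add: t opl_Cons terms_conj_def terms_degree_le_def ip_add_left ip_add_right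
        ip_sc_left ip_sc_right mon_adj)
qed (simp add: opl_Nil terms_conj_def)

lemma opl_V3: "opl ts ((V3 ^^ n) x) = (V3 ^^ n) (opl ts x)"
  using mon_opl[of 0 0 n ts x] by (simp add: mon_def)

lemma opl_add: "opl ts (x + y) = opl ts x + opl ts y"
  by (induction ts) (auto simp: opl_Nil opl_Cons mon_add scale_right_distrib)

lemma opl_sc: "opl ts (sc c x) = sc c (opl ts x)"
  by (induction ts) (auto simp: opl_Nil opl_Cons mon_sc scale_right_distrib mult.commute)

lemma opl_commute: "opl ts (opl us x) = opl us (opl ts x)"
proof (induction ts)
  case Nil
  have "opl us 0 = 0" using opl_sc[of us 0 0] by simp
  thus ?case by (simp add: opl_Nil)
next
  case (Cons t ts)
  thus ?case by (cases t) (simp add: opl_Cons opl_add opl_sc mon_opl)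
qed

lemma ip_opl_self:
  assumes "terms_degree_le n ts"
  shows "ip (opl ts x) (opl ts x) = ip ((V3 ^^ n) x) (opl (terms_conj n ts) (opl ts x))"
proof -
  have "ip (opl ts x) (opl ts x) = ip (opl ts ((V3 ^^ n) x)) ((V3 ^^ n) (opl ts x))"
    by (simp add: opl_V3 V3_funpow_isometry)
  also have "\<dots> = ip ((V3 ^^ n) x) (opl (terms_conj n ts) (opl ts x))"
    by (rule opl_adj[OF assms])
  finally show ?thesis .
qed

text \<open>The computation that gives \<parallel>N^* x\<parallel> = \<parallel>N x\<parallel> for
  normal N, with \<open>terms_conj\<close> in the role of the adjoint: the two polynomials commute,
  and V3^n between them is isometric.\<close>

lemma nrm_opl_conj:
  assumes "terms_degree_le n ts"
  shows "nrm (opl (terms_conj n ts) x) = nrm (opl ts x)"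
proof (rule nrm_eqI)
  have "ip (opl ts x) (opl ts x) = ip ((V3 ^^ n) x) (opl ts (opl (terms_conj n ts) x))"
    by (simp add: ip_opl_self[OF assms] opl_commute)
  also have "\<dots> = cnj (ip (opl ts (opl (terms_conj n ts) x)) ((V3 ^^ n) x))"
    by (rule ip_commute)
  also have "\<dots> = cnj (ip (opl (terms_conj n ts) x) (opl (terms_conj n ts) x))"
    by (simp add: opl_adj[OF assms])
  also have "\<dots> = ip (opl (terms_conj n ts) x) (opl (terms_conj n ts) x)"
    by (rule ip_commute[symmetric])
  finally show "ip (opl (terms_conj n ts) x) (opl (terms_conj n ts) x) = ip (opl ts x) (opl ts x)" ..
qed

lemma terms_degree_le_ex: "\<exists>n. terms_degree_le n ts"
proof (induction ts)
  case Nil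
  show ?case by (simp add: terms_degree_le_def)
next
  case (Cons t ts)
  then obtain n where n: "terms_degree_le n ts" by blast
  obtain c i j k where t: "t = (c, i, j, k)" by (cases t)
  have "terms_degree_le (max n (i + j + k)) (t # ts)"
    using n by (auto simp: terms_degree_le_def t le_max_iff_disj)
  thus ?case by blast
qed

text \<open>Cauchy-Schwarz in \<open>ip_opl_self\<close>; then V3^n drops out and
  \<open>nrm_opl_conj\<close> turns the conjugate polynomial back into the original one.\<close>

lemma nrm_opl_square: "(nrm (opl ts x))\<^sup>2 \<le> nrm x * nrm (opl (terms_mult ts ts) x)"
proof -
  obtain n where n: "terms_degree_le n ts" using terms_degree_le_ex by blast
  have "(nrm (opl ts x))\<^sup>2 = cmod (ip (opl ts x) (opl ts x))"
    unfolding ip_self by (simp add: norm_power)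
  also have "\<dots> \<le> nrm ((V3 ^^ n) x) * nrm (opl (terms_conj n ts) (opl ts x))"
    unfolding ip_opl_self[OF n] by (rule cauchy_schwarz)
  also have "\<dots> = nrm x * nrm (opl (terms_mult ts ts) x)"
    by (simp add: nrm_V3_funpow nrm_opl_conj[OF n] opl_mult)
  finally show ?thesis .
qed

text \<open>\<open>terms_conj 1\<close> sends the monomial x2 to x1.\<close>

lemma nrm_V1: "nrm (V1 x) = nrm (V2 x)"
proof -
  have "terms_degree_le 1 [(1, 0, 1, 0)]" by (simp add: terms_degree_le_def)
  from nrm_opl_conj[OF this, of x] show ?thesis
    by (simp add: terms_conj_def opl_Cons opl_Nil mon_def)
qed

lemma V2_contractive_if_linear_growth:
  assumes "\<And>n. nrm ((V2 ^^ n) x) \<le> C * real (n + 1)"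
  shows "nrm (V2 x) \<le> nrm x"
proof -
  have C: "C \<ge> 0" using assms[of 0] order_trans[OF nrm_nonneg] by fastforce
  have "nrm ((V2 ^^ (2 ^ 0)) x) \<le> 1 * nrm x"
  proof (rule doubling_growth_bound)
    fix k
    have eq: "opl [(1, 0, j, 0)] x = (V2 ^^ j) x" for j
      by (simp add: opl_Cons opl_Nil mon_def)
    have "terms_mult [(1, 0, 2 ^ k, 0)] [(1, 0, 2 ^ k, 0)] = [(1, 0, 2 ^ Suc k, 0)]"
      by (simp add: terms_mult_def)
    with nrm_opl_square[of "[(1, 0, 2 ^ k, 0)]" x]
    show "(nrm ((V2 ^^ (2 ^ k)) x))\<^sup>2 \<le> nrm x * nrm ((V2 ^^ (2 ^ Suc k)) x)"
      by (simp only: eq)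
    \<comment> \<open>Linear growth in n = 2^k stays within the n^2 that
      \<open>doubling_growth_bound\<close> tolerates.\<close>
    have "(2 ^ k + 1 :: real) \<le> 2 * 4 ^ k"
      using power_mono[of "2::real" 4 k] one_le_power[of "4::real" k] by linarith
    hence "C * real (2 ^ k + 1) \<le> C * (2 * 4 ^ k)" using C by (intro mult_left_mono) auto
    thus "nrm ((V2 ^^ (2 ^ k)) x) \<le> (2 * C) * 4 ^ k * 1 ^ (2 ^ k)"
      using assms[of "2 ^ k"] by simp
  qed auto
  thus ?thesis by simp
qed

end

section \<open>The defect of V2 and complete monotonicity\<close>

locale tetrablock_isometry = tetrablock_isometry_form +
  assumes V2_contractive: "nrm (V2 x) \<le> nrm x"
begin

text \<open>Stands in for 1 - V2^* V2: pairing with V3 y gives exactly that form, by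
  \<open>ip_defect_map\<close>. On the distinguished boundary it is x3 - x1 x2 = u (1 -
  |x|^2).\<close>

definition defect_map :: "'a \<Rightarrow> 'a" where "defect_map x = V3 x - V1 (V2 x)"

lemma defect_map_commutes:
  "defect_map (V2 x) = V2 (defect_map x)" "defect_map (V3 x) = V3 (defect_map x)"
  by (simp_all add: defect_map_def hom_diff V12 V13 V23)

lemma ip_defect_map:
  "ip (defect_map x) (V3 y) = ip x y - ip (V2 x) (V2 y)"
  "ip (V3 x) (defect_map y) = ip x y - ip (V2 x) (V2 y)"
proof -
  show *: "ip (defect_map x) (V3 y) = ip x y - ip (V2 x) (V2 y)" for x y
    by (simp add: defect_map_def ip_diff_left V3_isometry V1_adj)
  show "ip (V3 x) (defect_map y) = ip x y - ip (V2 x) (V2 y)"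
    using *[of y x] by (metis ip_commute complex_cnj_diff complex_cnj_cnj)
qed

text \<open>The \<open>b\<close>-th iterated difference of the sequence \<open>a \<mapsto> \<parallel>V2\<^sup>a x\<parallel>\<^sup>2\<close>.\<close>

definition norm_difference :: "nat \<Rightarrow> 'a \<Rightarrow> real" where
  "norm_difference b x = Re (ip ((defect_map ^^ b) x) ((V3 ^^ b) x))"

lemma norm_difference_Suc: "norm_difference (Suc b) x = norm_difference b x - norm_difference b (V2 x)"
proof -
  have "(defect_map ^^ b) (V2 x) = V2 ((defect_map ^^ b) x)" "(V3 ^^ b) (V2 x) = V2 ((V3 ^^ b) x)"
    using funpow_commute_both[of defect_map V2 b 1 x] funpow_commutes(3)[of 1 b x]
    by (simp_all add: defect_map_commutes)
  thus ?thesis by (simp add: norm_difference_def ip_defect_map)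
qed

lemma defect_map_V3_funpow:
  "(defect_map ^^ a) ((V3 ^^ b) x) = (V3 ^^ b) ((defect_map ^^ a) x)"
  by (rule funpow_commute_both) (rule defect_map_commutes)

text \<open>Self-adjointness of (1 - V2^* V2)^n, each of whose factors is a
  \<open>defect_map\<close> facing a V3.\<close>

lemma defect_map_funpow_adj: "ip ((defect_map ^^ n) x) ((V3 ^^ n) y) = ip ((V3 ^^ n) x) ((defect_map ^^ n) y)"
proof (induction n arbitrary: x y)
  case (Suc n)
  have "ip ((defect_map ^^ Suc n) x) ((V3 ^^ Suc n) y)
      = ip ((V3 ^^ n) (defect_map x)) ((defect_map ^^ n) (V3 y))"
    using Suc[of "defect_map x" "V3 y"] by (simp add: funpow_swap1)
  also have "\<dots> = ip (defect_map ((V3 ^^ n) x)) (V3 ((defect_map ^^ n) y))"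
    using defect_map_V3_funpow[of 1 n x] defect_map_V3_funpow[of n 1 y] by simp
  also have "\<dots> = ip (V3 ((V3 ^^ n) x)) (defect_map ((defect_map ^^ n) y))"
    by (simp add: ip_defect_map)
  finally show ?case by simp
qed simp

text \<open>The form is that of (1 - V2^* V2)^b. Half of the factors move to the other side. For
  even b a square remains; for odd b one factor stays in the middle and is nonnegative because V2 is
  contractive.\<close>

lemma norm_difference_nonneg: "0 \<le> norm_difference b x"
proof -
  define c where "c = b div 2"
  define z where "z = (defect_map ^^ c) x"
  show ?thesis
  proof (cases "even b")
    case True
    hence b: "b = c + c" unfolding c_def by presburger
    have "ip ((defect_map ^^ b) x) ((V3 ^^ b) x)
        = ip ((V3 ^^ c) z) ((defect_map ^^ c) ((V3 ^^ c) x))"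
      unfolding b funpow_add comp_apply z_def by (rule defect_map_funpow_adj)
    also have "\<dots> = ip z z"
      by (simp add: defect_map_V3_funpow V3_funpow_isometry z_def)
    finally show ?thesis by (simp add: norm_difference_def ip_nonneg)
  next
    case False
    hence b: "b = c + (1 + c)" unfolding c_def by presburger
    have "ip ((defect_map ^^ b) x) ((V3 ^^ b) x)
        = ip ((V3 ^^ c) (defect_map z)) ((defect_map ^^ c) (V3 ((V3 ^^ c) x)))"
      unfolding b funpow_add comp_apply z_def by (simp add: defect_map_funpow_adj)
    also have "(defect_map ^^ c) (V3 ((V3 ^^ c) x)) = (V3 ^^ c) (V3 z)"
      using defect_map_V3_funpow[of c "Suc c" x] by (simp add: z_def funpow_swap1)
    also have "ip ((V3 ^^ c) (defect_map z)) ((V3 ^^ c) (V3 z)) = ip z z - ip (V2 z) (V2 z)"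
      by (simp add: V3_funpow_isometry ip_defect_map)
    also have "\<dots> = complex_of_real ((nrm z)\<^sup>2 - (nrm (V2 z))\<^sup>2)" by (simp add: ip_self)
    finally show ?thesis
      by (simp add: norm_difference_def V2_contractive power_mono del: of_real_diff of_real_power)
  qed
qed

text \<open>If all terms of \<open>q\<close> have the same bidegree \<open>(j - i, i + k)\<close>, then \<open>\<parallel>q(V) x\<parallel>\<^sup>2\<close> is a linear
  combination of the completely monotone sequence \<open>a \<mapsto> \<parallel>V2\<^sup>a x\<parallel>\<^sup>2\<close>.\<close>

lemma nrm_opl_homogeneous:
  assumes modes: "\<And>c i j k. (c, i, j, k) \<in> set q \<Longrightarrow> int j - int i = m \<and> i + k = l"
    and bound: "\<And>r. 0 \<le> r \<Longrightarrow> r \<le> 1 \<Longrightarrow> cmod (terms_eval q (of_real r) (of_real r) 1) \<le> M"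
  shows "nrm (opl q x) \<le> M * nrm x"
proof -
  obtain n where n: "terms_degree_le n q" using terms_degree_le_ex by blast
  define S where "S = terms_mult (terms_conj n q) q"
  have M0: "M \<ge> 0" using bound[of 0] order_trans[OF norm_ge_zero] by fastforce
  \<comment> \<open>Conjugation reverses j - i and replaces i + k by n - (i + k). Against q of a
    single bidegree this leaves only terms in (x1 * x2) ^ i * x3 ^ (n - i).\<close>
  have shape: "i = j \<and> i \<le> n \<and> k = n - i" if "(e, i, j, k) \<in> set S" for e i j k
  proof -
    from that obtain c i1 j1 k1 c' i2 j2 k2 where
      mem: "(c, i1, j1, k1) \<in> set q" "(c', i2, j2, k2) \<in> set q"
      and eq: "i = j1 + i2" "j = i1 + j2" "k = n - (i1 + j1 + k1) + k2"
      by (auto simp: S_def terms_mult_def terms_conj_def)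
    have "i1 + j1 + k1 \<le> n" using n mem(1) by (auto simp: terms_degree_le_def)
    with modes[OF mem(1)] modes[OF mem(2)] eq show ?thesis by linarith
  qed
  \<comment> \<open>The conjugate appears because S is applied in the second argument of the form,
    which is conjugate linear.\<close>
  define e where "e p = cnj (fst (S ! p))" for p
  define a where "a p = fst (snd (S ! p))" for p
  have to_index: "(\<Sum>(c, i, j, k)\<leftarrow>S. f c i j k) = (\<Sum>p<length S. f (cnj (e p)) (a p) (a p) (n - a p))"
    for f :: "complex \<Rightarrow> nat \<Rightarrow> nat \<Rightarrow> nat \<Rightarrow> complex"
  proof -
    have "(\<Sum>(c, i, j, k)\<leftarrow>S. f c i j k) = (\<Sum>p<length S. (\<lambda>(c, i, j, k). f c i j k) (S ! p))"
      by (simp add: sum_list_sum_nth lessThan_atLeast0)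
    also have "\<dots> = (\<Sum>p<length S. f (cnj (e p)) (a p) (a p) (n - a p))"
    proof (rule sum.cong[OF refl])
      fix p assume "p \<in> {..<length S}"
      hence mem: "S ! p \<in> set S" by simp
      obtain c i j k where "S ! p = (c, i, j, k)" by (cases "S ! p")
      with shape mem show "(\<lambda>(c, i, j, k). f c i j k) (S ! p) = f (cnj (e p)) (a p) (a p) (n - a p)"
        by (auto simp: e_def a_def)
    qed
    finally show ?thesis .
  qed
  have a_le: "a p \<le> n" if "p < length S" for p
  proof -
    have mem: "S ! p \<in> set S" using that by simp
    obtain c i j k where "S ! p = (c, i, j, k)" by (cases "S ! p")
    with shape mem show ?thesis by (auto simp: a_def)
  qed
  define d where "d b c = norm_difference b ((V2 ^^ c) x)" for b c
  have "ip (opl q x) (opl q x) = ip ((V3 ^^ n) x) (opl S x)"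
    by (simp add: ip_opl_self[OF n] opl_mult S_def)
  also have "\<dots> = (\<Sum>(c, i, j, k)\<leftarrow>S. cnj c * ip ((V3 ^^ n) x) (mon i j k x))"
    by (auto simp: opl_def ip_sum_list_right ip_sc_right intro!: arg_cong[where f = sum_list] map_cong)
  also have "\<dots> = (\<Sum>p<length S. e p * ip ((V3 ^^ n) x) (mon (a p) (a p) (n - a p) x))"
    by (simp add: to_index)
  also have "\<dots> = (\<Sum>p<length S. e p * complex_of_real (d 0 (a p)))"
  proof (rule sum.cong[OF refl])
    fix p assume "p \<in> {..<length S}"
    hence le: "a p \<le> n" using a_le by simp
    let ?y = "(V2 ^^ a p) ((V3 ^^ (n - a p)) x)"
    have "(V3 ^^ n) x = (V3 ^^ a p) ((V3 ^^ (n - a p)) x)"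
      using le by (simp flip: funpow_add[THEN fun_cong, unfolded comp_apply])
    hence "ip (mon (a p) (a p) (n - a p) x) ((V3 ^^ n) x) = ip ?y ?y"
      by (simp add: mon_def V1_funpow_adj)
    also have "\<dots> = ip ((V2 ^^ a p) x) ((V2 ^^ a p) x)"
      by (simp add: funpow_commutes V3_funpow_isometry)
    also have "\<dots> = complex_of_real (d 0 (a p))"
      by (simp add: d_def norm_difference_def ip_self)
    finally have "ip ((V3 ^^ n) x) (mon (a p) (a p) (n - a p) x) = cnj (complex_of_real (d 0 (a p)))"
      by (metis ip_commute)
    thus "e p * ip ((V3 ^^ n) x) (mon (a p) (a p) (n - a p) x) = e p * complex_of_real (d 0 (a p))"
      by simp
  qed
  finally have "(nrm (opl q x))\<^sup>2 = cmod (\<Sum>p<length S. e p * complex_of_real (d 0 (a p)))"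
    unfolding ip_self by (metis norm_of_real abs_of_nonneg zero_le_power2)
  also have "\<dots> \<le> M\<^sup>2 * d 0 0"
  proof (rule hausdorff_moment_bound)
    show "d (Suc b) c = d b c - d b (Suc c)" for b c
      by (simp add: d_def norm_difference_Suc)
    show "0 \<le> d b c" for b c by (simp add: d_def norm_difference_nonneg)
    fix t :: real assume t: "0 \<le> t" "t \<le> 1"
    \<comment> \<open>At (r, r, 1) the product x1 * x2 is t, so up to conjugation the moment
      polynomial at t is the value of S there, whose modulus is the squared modulus of q.\<close>
    define r where "r = sqrt t"
    have r: "0 \<le> r" "r \<le> 1" "r * r = t" using t by (auto simp: r_def)
    have "(\<Sum>p<length S. cnj (e p) * complex_of_real (t ^ a p))
        = (\<Sum>p<length S. cnj (e p) * (complex_of_real r ^ a p * complex_of_real r ^ a p * 1 ^ (n - a p)))"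
      by (simp add: r(3)[symmetric] power_mult_distrib)
    also have "\<dots> = terms_eval S (of_real r) (of_real r) 1"
      unfolding terms_eval_def by (simp add: to_index)
    also have "\<dots> = cnj (terms_eval q (of_real r) (of_real r) 1) * terms_eval q (of_real r) (of_real r) 1"
      by (simp add: S_def terms_eval_mult terms_eval_conj_real)
    finally have "cnj (\<Sum>p<length S. e p * complex_of_real (t ^ a p))
        = cnj (terms_eval q (of_real r) (of_real r) 1) * terms_eval q (of_real r) (of_real r) 1"
      by simp
    hence "cmod (\<Sum>p<length S. e p * complex_of_real (t ^ a p))
        = (cmod (terms_eval q (of_real r) (of_real r) 1))\<^sup>2"
      by (metis complex_mod_cnj norm_mult power2_eq_square)
    also have "\<dots> \<le> M\<^sup>2" using bound[OF r(1,2)] by (intro power_mono) auto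
    finally show "cmod (\<Sum>p<length S. e p * complex_of_real (t ^ a p)) \<le> M\<^sup>2" .
  qed auto
  also have "d 0 0 = (nrm x)\<^sup>2" by (simp add: d_def norm_difference_def ip_self)
  finally have "(nrm (opl q x))\<^sup>2 \<le> (M * nrm x)\<^sup>2" by (simp add: power_mult_distrib)
  thus ?thesis by (rule power2_le_imp_le) (simp add: M0)
qed

end

section \<open>Reduction to components of one bidegree\<close>

lemma sum_list_filter_partition:
  fixes f :: "'t \<Rightarrow> 'b::comm_monoid_add"
  assumes "finite S" "\<And>t. t \<in> set ts \<Longrightarrow> key t \<in> S"
  shows "(\<Sum>t\<leftarrow>ts. f t) = (\<Sum>s\<in>S. \<Sum>t\<leftarrow>filter (\<lambda>t. key t = s) ts. f t)"
  using assms(2)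
proof (induction ts)
  case (Cons t ts)
  have "(\<Sum>s\<in>S. \<Sum>t\<leftarrow>filter (\<lambda>t. key t = s) (t # ts). f t)
      = (\<Sum>s\<in>S. (if key t = s then f t else 0) + (\<Sum>t\<leftarrow>filter (\<lambda>t. key t = s) ts. f t))"
    by (intro sum.cong) auto
  also have "\<dots> = f t + (\<Sum>s\<in>S. \<Sum>t\<leftarrow>filter (\<lambda>t. key t = s) ts. f t)"
    using Cons.prems assms(1) by (simp add: sum.distrib sum.delta)
  finally show ?case using Cons by simp
qed simp

text \<open>The frequencies of a monomial at (cnj x * u, x, u) when x is rotated by an angle
  \<theta> and u by an angle \<phi>.\<close>

definition bidegree :: "term3 \<Rightarrow> int \<times> int" where
  "bidegree = (\<lambda>(c, i, j, k). (int j - int i, int i + int k))"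

lemma terms_eval_bidegree_bound:
  assumes bound: "\<And>x u. cmod x \<le> 1 \<Longrightarrow> cmod u = 1 \<Longrightarrow> cmod (terms_eval p (cnj x * u) x u) \<le> M"
    and r: "0 \<le> r" "r \<le> 1"
  shows "cmod (terms_eval (filter (\<lambda>t. bidegree t = s) p) (of_real r) (of_real r) 1) \<le> M"
proof -
  define w :: "term3 \<Rightarrow> complex" where "w = (\<lambda>(c, i, j, k). c * complex_of_real r ^ (i + j))"
  \<comment> \<open>The two frequencies are extracted in turn: first in the argument of x with u =
    cis \<phi> fixed, then in \<phi>.\<close>
  have step: "cmod (\<Sum>t\<leftarrow>filter (\<lambda>t. fst (bidegree t) = fst s) p. w t * cis (\<phi> * of_int (snd (bidegree t)))) \<le> M" for \<phi>
  proof (rule fourier_coefficient_bound)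
    fix \<theta>
    define x where "x = complex_of_real r * cis \<theta>"
    have "terms_eval p (cnj x * cis \<phi>) x (cis \<phi>)
        = (\<Sum>t\<leftarrow>p. w t * cis (\<phi> * of_int (snd (bidegree t))) * cis (\<theta> * of_int (fst (bidegree t))))"
      unfolding terms_eval_def
    proof (intro arg_cong[where f = sum_list] map_cong refl)
      fix t :: term3
      obtain c i j k where t: "t = (c, i, j, k)" by (cases t)
      have "(cnj x * cis \<phi>) ^ i * x ^ j * cis \<phi> ^ k
          = complex_of_real r ^ (i + j) * (cis (- \<theta>) ^ i * cis \<theta> ^ j * (cis \<phi> ^ i * cis \<phi> ^ k))"
        by (simp add: x_def cis_cnj power_mult_distrib power_add mult_ac)
      also have "\<dots> = complex_of_real r ^ (i + j) * cis (\<phi> * of_int (int i + int k)) * cis (\<theta> * of_int (int j - int i))"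
        by (simp add: Complex.DeMoivre cis_mult algebra_simps)
      finally show "(case t of (c, i, j, k) \<Rightarrow> c * ((cnj x * cis \<phi>) ^ i * x ^ j * cis \<phi> ^ k))
          = w t * cis (\<phi> * of_int (snd (bidegree t))) * cis (\<theta> * of_int (fst (bidegree t)))"
        by (simp add: t w_def bidegree_def)
    qed
    moreover have "cmod x \<le> 1" using r by (simp add: x_def norm_mult)
    ultimately show "cmod (\<Sum>t\<leftarrow>p. w t * cis (\<phi> * of_int (snd (bidegree t))) * cis (\<theta> * of_int (fst (bidegree t)))) \<le> M"
      using bound[of x "cis \<phi>"] by simp
  qed
  have "cmod (\<Sum>t\<leftarrow>filter (\<lambda>t. snd (bidegree t) = snd s) (filter (\<lambda>t. fst (bidegree t) = fst s) p). w t) \<le> M"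
    by (rule fourier_coefficient_bound) (rule step)
  moreover have "filter (\<lambda>t. snd (bidegree t) = snd s) (filter (\<lambda>t. fst (bidegree t) = fst s) p)
      = filter (\<lambda>t. bidegree t = s) p"
    by (auto intro!: filter_cong simp: prod_eq_iff)
  moreover have "terms_eval ts (of_real r) (of_real r) 1 = (\<Sum>t\<leftarrow>ts. w t)" for ts
    by (auto simp: terms_eval_def w_def power_add intro!: arg_cong[where f = sum_list] map_cong)
  ultimately show ?thesis by simp
qed

context tetrablock_isometry
begin

text \<open>The factor counts the possible bidegrees: j - i runs from -d to d and i + k from 0 to d.
  Each component obeys the bound M on its own.\<close>

lemma nrm_opl_crude:
  assumes deg: "terms_degree_le d p"
    and bound: "\<And>x u. cmod x \<le> 1 \<Longrightarrow> cmod u = 1 \<Longrightarrow> cmod (terms_eval p (cnj x * u) x u) \<le> M"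
  shows "nrm (opl p x) \<le> real ((2 * d + 1) * (d + 1)) * M * nrm x"
proof -
  define S where "S = {- int d..int d} \<times> {0..int d}"
  have "card {- int d..int d} = 2 * d + 1" "card {0..int d} = d + 1"
    unfolding card_atLeastAtMost_int by linarith+
  hence card: "card S = (2 * d + 1) * (d + 1)"
    by (simp add: S_def card_cartesian_product)
  have key: "bidegree t \<in> S" if "t \<in> set p" for t
  proof -
    obtain c i j k where t: "t = (c, i, j, k)" by (cases t)
    have "i + j + k \<le> d" using that deg by (auto simp: t terms_degree_le_def)
    thus ?thesis by (simp add: t bidegree_def S_def)
  qed
  have "opl p x = (\<Sum>s\<in>S. opl (filter (\<lambda>t. bidegree t = s) p) x)"
    unfolding opl_def by (rule sum_list_filter_partition[OF _ key]) (simp add: S_def)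
  also have "nrm \<dots> \<le> (\<Sum>s\<in>S. nrm (opl (filter (\<lambda>t. bidegree t = s) p) x))"
    by (rule nrm_sum)
  also have "\<dots> \<le> (\<Sum>s\<in>S. M * nrm x)"
  proof (rule sum_mono)
    fix s
    show "nrm (opl (filter (\<lambda>t. bidegree t = s) p) x) \<le> M * nrm x"
    proof (rule nrm_opl_homogeneous)
      fix c i j k assume "(c, i, j, k) \<in> set (filter (\<lambda>t. bidegree t = s) p)"
      thus "int j - int i = fst s \<and> i + k = nat (snd s)" by (auto simp: bidegree_def)
    qed (rule terms_eval_bidegree_bound[OF bound])
  qed
  finally show ?thesis by (simp add: card mult.assoc)
qed

theorem von_neumann_inequality:
  assumes bound: "\<And>x u. cmod x \<le> 1 \<Longrightarrow> cmod u = 1 \<Longrightarrow> cmod (terms_eval p (cnj x * u) x u) \<le> M"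
  shows "nrm (opl p x) \<le> M * nrm x"
proof -
  obtain d where d: "terms_degree_le d p" using terms_degree_le_ex by blast
  define P where "P k = ((\<lambda>t. terms_mult t t) ^^ k) p" for k
  have P0: "P 0 = p" and PS: "P (Suc k) = terms_mult (P k) (P k)" for k
    by (simp_all add: P_def)
  have M0: "M \<ge> 0" using bound[of 0 1] order_trans[OF norm_ge_zero] by fastforce
  have deg: "terms_degree_le (2 ^ k * d) (P k)" for k
  proof (induction k)
    case (Suc k)
    from terms_degree_le_mult[OF Suc Suc] show ?case by (simp add: PS mult_2 add_mult_distrib)
  qed (simp add: P0 d)
  have ev: "cmod (terms_eval (P k) (cnj x * u) x u) \<le> M ^ (2 ^ k)" if "cmod x \<le> 1" "cmod u = 1" for x u k
  proof (induction k)
    case (Suc k)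
    have "cmod (terms_eval (P (Suc k)) (cnj x * u) x u) = (cmod (terms_eval (P k) (cnj x * u) x u))\<^sup>2"
      by (simp add: PS terms_eval_mult norm_mult power2_eq_square)
    also have "\<dots> \<le> (M ^ (2 ^ k))\<^sup>2" using Suc by (intro power_mono) auto
    finally show ?case by (simp add: power_mult mult.commute flip: power_mult)
  qed (use bound that in \<open>simp add: P0\<close>)
  have "nrm (opl (P 0) x) \<le> M * nrm x"
  proof (rule doubling_growth_bound)
    fix k
    show "(nrm (opl (P k) x))\<^sup>2 \<le> nrm x * nrm (opl (P (Suc k)) x)"
      unfolding PS by (rule nrm_opl_square)
    \<comment> \<open>Each squaring doubles the degree, so the crude factor grows at most fourfold,
      the rate that \<open>doubling_growth_bound\<close> removes.\<close>
    have le: "(2 * (2 ^ k * d) + 1) * (2 ^ k * d + 1) \<le> 4 ^ k * ((2 * d + 1) * (d + 1))"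
    proof -
      have "(2 * (2 ^ k * d) + 1) * (2 ^ k * d + 1) \<le> (2 ^ k * (2 * d + 1)) * (2 ^ k * (d + 1))"
        by (intro mult_mono) (auto simp: algebra_simps)
      also have "\<dots> = (2 ^ k * 2 ^ k) * ((2 * d + 1) * (d + 1))" by (simp only: mult_ac)
      also have "(2 ^ k * 2 ^ k :: nat) = 4 ^ k" by (simp flip: power_mult_distrib)
      finally show ?thesis .
    qed
    have "nrm (opl (P k) x) \<le> real ((2 * (2 ^ k * d) + 1) * (2 ^ k * d + 1)) * M ^ (2 ^ k) * nrm x"
      by (rule nrm_opl_crude[OF deg ev])
    also have "\<dots> \<le> real (4 ^ k * ((2 * d + 1) * (d + 1))) * M ^ (2 ^ k) * nrm x"
      using le M0 by (intro mult_right_mono of_nat_mono) auto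
    finally show "nrm (opl (P k) x) \<le> (real ((2 * d + 1) * (d + 1)) * nrm x) * 4 ^ k * M ^ (2 ^ k)"
      by (simp only: of_nat_mult of_nat_power of_nat_numeral mult_ac)
  qed (auto simp: M0)
  thus ?thesis by (simp add: P0)
qed

text \<open>The squared norms differ by (1 - |w|^2) (\<parallel>x\<parallel>^2 - \<parallel>V2
  x\<parallel>^2): the cross terms cancel by V1^* V3 = V2, and \<open>nrm_V1\<close> and the
  isometry V3 account for the rest.\<close>

lemma nrm_pencil:
  assumes "cmod w \<le> 1"
  shows "nrm (V1 x - sc w (V3 x)) \<le> nrm (x - sc w (V2 x))"
proof -
  let ?l = "V1 x - sc w (V3 x)" and ?r = "x - sc w (V2 x)"
  have cross: "ip (V1 x) (V3 x) = ip x (V2 x)" by (rule V1_adj)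
  have cross': "ip (V3 x) (V1 x) = ip (V2 x) x" using cross by (metis ip_commute)
  have V1V1: "ip (V1 x) (V1 x) = ip (V2 x) (V2 x)" by (simp add: ip_self nrm_V1)
  have "ip ?r ?r - ip ?l ?l = (1 - w * cnj w) * (ip x x - ip (V2 x) (V2 x))"
    by (simp add: ip_diff_left ip_diff_right ip_sc_left ip_sc_right cross cross' V1V1 V3_isometry algebra_simps)
  also have "\<dots> = complex_of_real ((1 - (cmod w)\<^sup>2) * ((nrm x)\<^sup>2 - (nrm (V2 x))\<^sup>2))"
    by (simp add: ip_self complex_norm_square del: of_real_power)
  finally have "(nrm ?r)\<^sup>2 - (nrm ?l)\<^sup>2 = (1 - (cmod w)\<^sup>2) * ((nrm x)\<^sup>2 - (nrm (V2 x))\<^sup>2)"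
    unfolding ip_self by (metis of_real_diff of_real_eq_iff)
  also have "\<dots> \<ge> 0"
    using assms V2_contractive by (intro mult_nonneg_nonneg) (auto simp: power_mono power_le_one)
  finally have "(nrm ?l)\<^sup>2 \<le> (nrm ?r)\<^sup>2" by simp
  thus ?thesis by (rule power2_le_imp_le) simp
qed

end

section \<open>Operators on complex Hilbert spaces\<close>

interpretation chilbert: hermitian_form "scaleC :: complex \<Rightarrow> 'a::chilbert_space \<Rightarrow> 'a" cinner
  rewrites "hermitian_form.nrm cinner = norm"
proof -
  show loc: "hermitian_form (scaleC :: complex \<Rightarrow> 'a \<Rightarrow> 'a) cinner"
  proof
    show "1 *\<^sub>C x = x" for x :: 'a using scaleC_of_real[of 1 x] by simp
    show "cinner x y = cnj (cinner y x)" for x y :: 'a by (rule cinner_commute)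
  qed (simp_all add: scaleC_add_right scaleC_add_left scaleC_scaleC cinner_add_left
      cinner_scaleC_left Re_cinner)
  show "hermitian_form.nrm cinner = (norm :: 'a \<Rightarrow> real)"
    by (auto simp: hermitian_form.nrm_def[OF loc] Re_cinner norm_eq_sqrt_inner)
qed

lemma bounded_bilinear_cinner: "bounded_bilinear (cinner :: 'a::chilbert_space \<Rightarrow> 'a \<Rightarrow> complex)"
proof
  show "cinner (r *\<^sub>R a) b = r *\<^sub>R cinner a b" for r and a b :: 'a
    by (simp add: chilbert.ip_sc_left scaleR_conv_of_real flip: scaleC_of_real)
  show "cinner a (r *\<^sub>R b) = r *\<^sub>R cinner a b" for r and a b :: 'a
    by (simp add: chilbert.ip_sc_right scaleR_conv_of_real flip: scaleC_of_real)
  show "\<exists>K. \<forall>a b :: 'a. cmod (cinner a b) \<le> norm a * norm b * K"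
    using chilbert.cauchy_schwarz by (auto intro!: exI[of _ 1])
qed (simp_all add: chilbert.ip_add_left chilbert.ip_add_right)

lemmas tendsto_cinner = bounded_bilinear.tendsto[OF bounded_bilinear_cinner]

lemma cinner_eqI:
  assumes "\<And>x. cinner x y = cinner x z"
  shows "y = (z :: 'a::chilbert_space)"
proof -
  have "cinner (y - z) (y - z) = 0" using assms[of "y - z"] by (simp add: chilbert.ip_diff_right)
  thus ?thesis by (simp add: chilbert.ip_self)
qed

lemma bounded_clinearI:
  assumes "\<And>x y. T (x + y) = T x + T y" "\<And>c x. T (c *\<^sub>C x) = c *\<^sub>C T x"
    and "\<And>x. norm (T x) \<le> K * norm x"
  shows "bounded_clinear T"
  unfolding bounded_clinear_def
proof (intro conjI allI)
  show "bounded_linear T"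
  proof (rule bounded_linear_intro[of T K])
    show "T (r *\<^sub>R x) = r *\<^sub>R T x" for r x
      using assms(2)[of "of_real r" x] by (simp only: scaleC_of_real)
    show "norm (T x) \<le> norm x * K" for x using assms(3)[of x] by (simp only: mult.commute)
  qed (rule assms(1))
qed (rule assms(2))

lemma bounded_clinear_bound:
  assumes "bounded_clinear T"
  obtains K where "K \<ge> 0" "\<And>x. norm (T x) \<le> K * norm x"
proof -
  have "bounded_linear T" using assms by (simp add: bounded_clinear_def)
  from bounded_linear.nonneg_bounded[OF this] that show thesis by (auto simp: mult.commute)
qed

context
  fixes T :: "'a::chilbert_space \<Rightarrow> 'a"
  assumes T: "bounded_clinear T"
begin

lemma bounded_clinear_add: "T (x + y) = T x + T y"
  and bounded_clinear_diff: "T (x - y) = T x - T y"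
  and bounded_clinear_zero: "T 0 = 0"
  and bounded_clinear_sum: "T (\<Sum>i\<in>I. f i) = (\<Sum>i\<in>I. T (f i))"
proof -
  have "linear T" using T by (simp add: bounded_clinear_def bounded_linear.linear)
  thus "T (x + y) = T x + T y" "T (x - y) = T x - T y" "T 0 = 0"
    "T (\<Sum>i\<in>I. f i) = (\<Sum>i\<in>I. T (f i))"
    by (rule linear_add linear_diff linear_0 linear_sum)+
qed

lemma bounded_clinear_scaleC: "T (c *\<^sub>C x) = c *\<^sub>C T x"
  using T by (simp add: bounded_clinear_def)

lemma bounded_clinear_tendsto: "(f \<longlongrightarrow> l) F \<Longrightarrow> ((\<lambda>n. T (f n)) \<longlongrightarrow> T l) F"
  using T bounded_linear.tendsto by (auto simp: bounded_clinear_def)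

lemma bounded_clinear_compose:
  assumes "bounded_clinear S"
  shows "bounded_clinear (\<lambda>x. T (S x))"
  using T assms bounded_linear_compose[of T S] by (auto simp: bounded_clinear_def)

lemma bounded_clinear_plus:
  assumes "bounded_clinear S"
  shows "bounded_clinear (\<lambda>x. T x + S x)"
  using T assms by (auto simp: bounded_clinear_def bounded_linear_add chilbert.scale_right_distrib)

lemma bounded_clinear_minus:
  assumes "bounded_clinear S"
  shows "bounded_clinear (\<lambda>x. T x - S x)"
  using T assms by (auto simp: bounded_clinear_def bounded_linear_sub chilbert.scale_right_diff_distrib)

lemma bounded_clinear_scale: "bounded_clinear (\<lambda>x. c *\<^sub>C T x)"
proof -
  obtain K where K: "K \<ge> 0" "\<And>x. norm (T x) \<le> K * norm x"
    using bounded_clinear_bound[OF T] by metis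
  show ?thesis
  proof (rule bounded_clinearI)
    show "norm (c *\<^sub>C T x) \<le> (cmod c * K) * norm x" for x
      using K(2)[of x] by (simp add: chilbert.nrm_sc mult.assoc mult_left_mono)
  qed (simp_all add: bounded_clinear_add bounded_clinear_scaleC chilbert.scale_right_distrib mult.commute)
qed

end

lemma bounded_clinear_id: "bounded_clinear (\<lambda>x. x)"
  by (simp add: bounded_clinear_def bounded_linear_ident)

lemma bounded_clinear_zero_op: "bounded_clinear (\<lambda>x. 0)"
  by (simp add: bounded_clinear_def)

lemma contractionD: "contraction T \<Longrightarrow> bounded_clinear T" "contraction T \<Longrightarrow> norm (T x) \<le> norm x"
proof -
  assume T: "contraction T"
  thus "bounded_clinear T" by (simp add: contraction_def)
  hence "norm (T x) \<le> onorm T * norm x" by (simp add: bounded_clinear_def onorm)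
  also have "\<dots> \<le> 1 * norm x" using T by (intro mult_right_mono) (auto simp: contraction_def)
  finally show "norm (T x) \<le> norm x" by simp
qed

subsection \<open>Riesz representation, adjoints and projections\<close>

definition closed_csubspace :: "'a::chilbert_space set \<Rightarrow> bool" where
  "closed_csubspace M \<longleftrightarrow> chilbert.subspace M \<and> closed M"

lemma closed_csubspaceD:
  assumes "closed_csubspace M"
  shows "closed M" "0 \<in> M" "x \<in> M \<Longrightarrow> y \<in> M \<Longrightarrow> x + y \<in> M" "x \<in> M \<Longrightarrow> y \<in> M \<Longrightarrow> x - y \<in> M"
    "x \<in> M \<Longrightarrow> c *\<^sub>C x \<in> M" "x \<in> M \<Longrightarrow> r *\<^sub>R x \<in> M"
proof -
  from assms have M: "chilbert.subspace M" "closed M" by (simp_all add: closed_csubspace_def)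
  show "closed M" by (rule M)
  show "0 \<in> M" by (rule chilbert.subspace_0[OF M(1)])
  show "x \<in> M \<Longrightarrow> y \<in> M \<Longrightarrow> x + y \<in> M" by (rule chilbert.subspace_add[OF M(1)])
  show "x \<in> M \<Longrightarrow> y \<in> M \<Longrightarrow> x - y \<in> M" by (rule chilbert.subspace_diff[OF M(1)])
  show scale: "x \<in> M \<Longrightarrow> c *\<^sub>C x \<in> M" for c by (rule chilbert.subspace_scale[OF M(1)])
  show "x \<in> M \<Longrightarrow> r *\<^sub>R x \<in> M" using scale[of "of_real r"] by (simp add: scaleC_of_real)
qed

text \<open>The representing vector minimizes \<open>\<parallel>x\<parallel>\<^sup>2 - 2 Re (f x)\<close> on \<open>M\<close>.\<close>

lemma riesz_representation:
  fixes f :: "'a::chilbert_space \<Rightarrow> complex"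
  assumes M: "closed_csubspace M"
    and add: "\<And>x y. x \<in> M \<Longrightarrow> y \<in> M \<Longrightarrow> f (x + y) = f x + f y"
    and scale: "\<And>c x. x \<in> M \<Longrightarrow> f (c *\<^sub>C x) = c * f x"
    and bound: "\<And>x. x \<in> M \<Longrightarrow> cmod (f x) \<le> K * norm x"
  shows "\<exists>!z. z \<in> M \<and> (\<forall>x\<in>M. f x = cinner x z)"
proof -
  note M' = closed_csubspaceD[OF M]
  define J where "J x = (norm x)\<^sup>2 - 2 * Re (f x)" for x
  have scaleR: "f (r *\<^sub>R x) = of_real r * f x" if "x \<in> M" for r x
    using scale[OF that, of "of_real r"] by (simp add: scaleC_of_real)
  have diff: "f (x - y) = f x - f y" if "x \<in> M" "y \<in> M" for x y
    using add[of "x - y" y] M'(4)[OF that] that by simp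
  have lower: "- (K\<^sup>2) \<le> J x" if "x \<in> M" for x
  proof -
    have "Re (f x) \<le> K * norm x" using bound[OF that] complex_Re_le_cmod[of "f x"] by linarith
    moreover have "0 \<le> (norm x - K)\<^sup>2" by simp
    ultimately show ?thesis unfolding J_def power2_diff by (simp add: mult.commute)
  qed
  define m where "m = Inf (J ` M)"
  have bdd: "bdd_below (J ` M)" by (rule bdd_belowI2[of _ "- (K\<^sup>2)"]) (rule lower)
  have m_le: "m \<le> J x" if "x \<in> M" for x
    unfolding m_def using that bdd by (intro cInf_lower) auto
  have "\<exists>x. x \<in> M \<and> J x < m + 1 / real (Suc n)" for n
  proof -
    have "Inf (J ` M) < m + 1 / real (Suc n)" by (simp add: m_def)
    thus ?thesis using bdd M'(2) by (subst (asm) cInf_less_iff) auto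
  qed
  hence "\<forall>n. \<exists>x. x \<in> M \<and> J x < m + 1 / real (Suc n)" by blast
  then obtain X where X: "\<And>n. X n \<in> M" "\<And>n. J (X n) < m + 1 / real (Suc n)"
    by (auto dest!: choice)
  \<comment> \<open>The midpoint also lies in M, where J is at least m; hence near-minimizers of J
    are close to each other.\<close>
  have parallelogram: "(norm (x - y))\<^sup>2 \<le> 2 * (J x - m) + 2 * (J y - m)" if "x \<in> M" "y \<in> M" for x y
  proof -
    let ?w = "(1/2) *\<^sub>R (x + y)"
    have w: "?w \<in> M" using that by (intro M'(3,6))
    have "(norm ?w)\<^sup>2 = (norm (x + y))\<^sup>2 / 4" by (simp add: power_divide)
    moreover have "(norm (x + y))\<^sup>2 + (norm (x - y))\<^sup>2 = 2 * (norm x)\<^sup>2 + 2 * (norm y)\<^sup>2"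
      by (simp add: power2_norm_eq_inner inner_add_left inner_add_right inner_diff_left inner_diff_right inner_commute)
    moreover have "Re (f ?w) = (Re (f x) + Re (f y)) / 2"
      using that M'(3)[OF that] by (simp add: scaleR add)
    ultimately have "(norm (x - y))\<^sup>2 = 2 * J x + 2 * J y - 4 * J ?w"
      by (simp add: J_def algebra_simps)
    thus ?thesis using m_le[OF w] by simp
  qed
  have close: "dist (X p) (X q) < e" if "e > 0" "p \<ge> N" "q \<ge> N" "4 / real (Suc N) < e\<^sup>2" for e p q N
  proof -
    have le: "1 / real (Suc r) \<le> 1 / real (Suc N)" if "r \<ge> N" for r
      using that by (simp add: frac_le)
    have J_le: "J (X r) - m \<le> 1 / real (Suc N)" if "r \<ge> N" for r
      using order_less_le_trans[OF X(2)[of r] add_left_mono[OF le[OF that]]]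
      by (simp only: diff_le_eq add.commute less_imp_le)
    have "(norm (X p - X q))\<^sup>2 \<le> 2 * (1 / real (Suc N)) + 2 * (1 / real (Suc N))"
      by (rule order_trans[OF parallelogram[OF X(1) X(1)]])
        (intro add_mono mult_left_mono J_le that, simp_all)
    also have "\<dots> = 4 / real (Suc N)" by simp
    also have "\<dots> < e\<^sup>2" by (rule that)
    finally show ?thesis unfolding dist_norm by (rule power2_less_imp_less) (use that(1) in simp)
  qed
  have "Cauchy X"
  proof (rule metric_CauchyI)
    fix e :: real assume e: "0 < e"
    obtain N where "inverse (real (Suc N)) < e\<^sup>2 / 4"
      using reals_Archimedean[of "e\<^sup>2 / 4"] e by auto
    hence "4 / real (Suc N) < e\<^sup>2" by (simp add: field_simps)
    thus "\<exists>N. \<forall>p\<ge>N. \<forall>q\<ge>N. dist (X p) (X q) < e" using close e by blast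
  qed
  then obtain z where z: "X \<longlonglongrightarrow> z" using Cauchy_convergent convergent_def by blast
  have zM: "z \<in> M" using M'(1) X(1) z closed_sequentially by blast
  have flim: "(\<lambda>n. f (X n)) \<longlonglongrightarrow> f z"
  proof (rule LIM_zero_cancel, rule Lim_null_comparison)
    show "\<forall>\<^sub>F n in sequentially. cmod (f (X n) - f z) \<le> K * norm (X n - z)"
      using bound X(1) zM M'(4) by (simp flip: diff)
    show "(\<lambda>n. K * norm (X n - z)) \<longlonglongrightarrow> 0"
      using tendsto_mult_right_zero[OF tendsto_norm_zero[OF LIM_zero[OF z]]] .
  qed
  have "(\<lambda>n. J (X n)) \<longlonglongrightarrow> J z"
    unfolding J_def by (intro tendsto_intros flim z)
  moreover have "(\<lambda>n. m + 1 / real (Suc n)) \<longlonglongrightarrow> m + 0"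
    by (intro tendsto_add tendsto_const LIMSEQ_Suc[OF lim_1_over_n])
  ultimately have Jz: "J z \<le> m"
    using X(2) by (intro tendsto_le[OF sequentially_bot]) (auto intro!: always_eventually less_imp_le)
  have re: "Re (f x) = Re (cinner x z)" if x: "x \<in> M" for x
  proof -
    define b where "b = Re (cinner x z) - Re (f x)"
    have q: "0 \<le> t\<^sup>2 * (norm x)\<^sup>2 + 2 * t * b" for t :: real
    proof -
      have tx: "t *\<^sub>R x \<in> M" by (rule M'(6)[OF x])
      have "J z \<le> J (z + t *\<^sub>R x)" using m_le[OF M'(3)[OF zM tx]] Jz by simp
      moreover have "(norm (z + t *\<^sub>R x))\<^sup>2 = (norm z)\<^sup>2 + 2 * t * Re (cinner x z) + t\<^sup>2 * (norm x)\<^sup>2"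
        unfolding power2_norm_eq_inner Re_cinner
        by (simp add: inner_add_left inner_add_right inner_commute power2_eq_square algebra_simps)
      moreover have "Re (f (z + t *\<^sub>R x)) = Re (f z) + t * Re (f x)"
        using zM x tx by (simp add: add scaleR)
      ultimately show ?thesis by (simp add: J_def b_def algebra_simps)
    qed
    \<comment> \<open>The optimal step is - b / \<parallel>x\<parallel>^2; adding 1 to the
      denominator covers x = 0 and still forces b = 0.\<close>
    define a where "a = (norm x)\<^sup>2 + 1"
    have a: "a > 0" by (simp add: a_def add_nonneg_pos)
    have "0 \<le> (b / a)\<^sup>2 * (a - 1) - 2 * (b / a) * b"
      using q[of "- (b / a)"] by (simp add: a_def)
    also have "\<dots> = - (b\<^sup>2 / a) - (b / a)\<^sup>2" using a by (simp add: field_simps power2_eq_square)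
    finally have "b\<^sup>2 / a \<le> 0" by (smt (verit) zero_le_power2)
    hence "b\<^sup>2 \<le> 0" using a by (simp add: divide_le_0_iff)
    hence "b = 0" by simp
    thus ?thesis by (simp add: b_def)
  qed
  have rep: "f x = cinner x z" if x: "x \<in> M" for x
  proof (rule complex_eqI)
    show "Re (f x) = Re (cinner x z)" by (rule re[OF x])
    have "Re (f (\<i> *\<^sub>C x)) = Re (cinner (\<i> *\<^sub>C x) z)" by (rule re) (rule M'(5)[OF x])
    thus "Im (f x) = Im (cinner x z)" by (simp add: scale x chilbert.ip_sc_left)
  qed
  show ?thesis
  proof (intro ex1I[of _ z] conjI ballI zM rep)
    fix w assume w: "w \<in> M \<and> (\<forall>x\<in>M. f x = cinner x w)"
    have "w - z \<in> M" using w zM by (intro M'(4)) auto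
    hence "cinner (w - z) (w - z) = 0" using w rep by (simp add: chilbert.ip_diff_right)
    thus "w = z" by (simp add: chilbert.ip_self)
  qed
qed

lemma adjoint_on_props:
  assumes M: "closed_csubspace M" and A: "bounded_clinear_on M A"
  shows adjoint_on_mem: "adjoint_on M A y \<in> M"
    and adjoint_on: "x \<in> M \<Longrightarrow> cinner (A x) y = cinner x (adjoint_on M A y)"
    and adjoint_on_unique: "z \<in> M \<Longrightarrow> (\<And>x. x \<in> M \<Longrightarrow> cinner (A x) y = cinner x z) \<Longrightarrow> adjoint_on M A y = z"
proof -
  obtain K where K: "\<And>x. x \<in> M \<Longrightarrow> norm (A x) \<le> K * norm x"
    using A unfolding bounded_clinear_on_def by blast
  have ex1: "\<exists>!z. z \<in> M \<and> (\<forall>x\<in>M. cinner (A x) y = cinner x z)"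
  proof (rule riesz_representation[OF M])
    fix x assume "x \<in> M"
    have "cmod (cinner (A x) y) \<le> norm (A x) * norm y" by (rule chilbert.cauchy_schwarz)
    also have "\<dots> \<le> (K * norm x) * norm y" using K \<open>x \<in> M\<close> by (intro mult_right_mono) auto
    finally show "cmod (cinner (A x) y) \<le> (K * norm y) * norm x" by (simp add: mult_ac)
  qed (use A in \<open>auto simp: bounded_clinear_on_def chilbert.ip_add_left chilbert.ip_sc_left\<close>)
  from theI'[OF ex1] show "adjoint_on M A y \<in> M" "x \<in> M \<Longrightarrow> cinner (A x) y = cinner x (adjoint_on M A y)"
    by (auto simp: adjoint_on_def)
  show "z \<in> M \<Longrightarrow> (\<And>x. x \<in> M \<Longrightarrow> cinner (A x) y = cinner x z) \<Longrightarrow> adjoint_on M A y = z"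
    unfolding adjoint_on_def using ex1 by (intro the1_equality) auto
qed

lemma closed_csubspace_UNIV: "closed_csubspace UNIV"
  by (simp add: closed_csubspace_def)

lemma bounded_clinear_on_UNIV: "bounded_clinear T \<Longrightarrow> bounded_clinear_on UNIV T"
  using bounded_clinear_bound[of T]
  by (auto simp: bounded_clinear_on_def bounded_clinear_add bounded_clinear_scaleC)

context
  fixes T :: "'a::chilbert_space \<Rightarrow> 'a"
  assumes T: "bounded_clinear T"
begin

lemma cadjoint: "cinner (T x) y = cinner x (cadjoint T y)"
  by (rule adjoint_on[OF closed_csubspace_UNIV bounded_clinear_on_UNIV[OF T]]) simp

lemma cadjoint': "cinner (cadjoint T x) y = cinner x (T y)"
  by (subst (1 2) cinner_commute) (simp add: cadjoint)

lemma cadjoint_unique: "(\<And>x. cinner (T x) y = cinner x z) \<Longrightarrow> cadjoint T y = z"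
  by (rule adjoint_on_unique[OF closed_csubspace_UNIV bounded_clinear_on_UNIV[OF T]]) simp_all

lemma norm_cadjoint_le:
  assumes "K \<ge> 0" "\<And>x. norm (T x) \<le> K * norm x"
  shows "norm (cadjoint T y) \<le> K * norm y"
proof (cases "cadjoint T y = 0")
  case False
  let ?z = "cadjoint T y"
  have "(norm ?z)\<^sup>2 = cmod (cinner ?z ?z)" by (simp add: chilbert.ip_self norm_power)
  also have "cinner ?z ?z = cinner (T ?z) y" by (simp add: cadjoint)
  also have "cmod \<dots> \<le> norm (T ?z) * norm y" by (rule chilbert.cauchy_schwarz)
  also have "\<dots> \<le> (K * norm ?z) * norm y" by (intro mult_right_mono assms) simp
  finally have "norm ?z * norm ?z \<le> (K * norm y) * norm ?z" by (simp add: power2_eq_square mult_ac)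
  thus ?thesis using False by (subst (asm) mult_le_cancel_right_pos) auto
qed (simp add: assms)

lemma bounded_clinear_cadjoint: "bounded_clinear (cadjoint T)"
proof -
  obtain K where K: "K \<ge> 0" "\<And>x. norm (T x) \<le> K * norm x"
    using bounded_clinear_bound[OF T] by metis
  show ?thesis
  proof (rule bounded_clinearI)
    show "cadjoint T (x + y) = cadjoint T x + cadjoint T y" for x y
      by (rule cadjoint_unique) (simp add: chilbert.ip_add_right cadjoint)
    show "cadjoint T (c *\<^sub>C x) = c *\<^sub>C cadjoint T x" for c x
      by (rule cadjoint_unique) (simp add: chilbert.ip_sc_right cadjoint)
    show "norm (cadjoint T y) \<le> K * norm y" for y by (rule norm_cadjoint_le[OF K])
  qed
qed

end

text \<open>The adjoint of the inclusion of M: \<open>adjoint_on\<close> accepts vectors outside M,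
  and there it yields the orthogonal projection.\<close>

definition proj_on :: "'a::chilbert_space set \<Rightarrow> 'a \<Rightarrow> 'a" where
  "proj_on M = adjoint_on M (\<lambda>x. x)"

context
  fixes M :: "'a::chilbert_space set"
  assumes M: "closed_csubspace M"
begin

lemma bounded_clinear_on_id: "bounded_clinear_on M (\<lambda>x. x)"
  by (auto simp: bounded_clinear_on_def intro!: exI[of _ 1])

lemma proj_on_mem: "proj_on M y \<in> M"
  and cinner_proj_on: "x \<in> M \<Longrightarrow> cinner x (proj_on M y) = cinner x y"
  and proj_on_unique: "z \<in> M \<Longrightarrow> (\<And>x. x \<in> M \<Longrightarrow> cinner x y = cinner x z) \<Longrightarrow> proj_on M y = z"
  unfolding proj_on_def
  by (rule adjoint_on_mem[OF M bounded_clinear_on_id])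
    (rule adjoint_on[OF M bounded_clinear_on_id, symmetric] adjoint_on_unique[OF M bounded_clinear_on_id]; simp)+

lemma proj_on_id: "y \<in> M \<Longrightarrow> proj_on M y = y"
  by (rule proj_on_unique) auto

lemma norm_proj_on_le: "norm (proj_on M y) \<le> norm y"
proof (cases "proj_on M y = 0")
  case False
  let ?z = "proj_on M y"
  have "(norm ?z)\<^sup>2 = cmod (cinner ?z ?z)" by (simp add: chilbert.ip_self norm_power)
  also have "cinner ?z ?z = cinner ?z y" by (rule cinner_proj_on) (rule proj_on_mem)
  also have "cmod \<dots> \<le> norm ?z * norm y" by (rule chilbert.cauchy_schwarz)
  finally show ?thesis using False by (simp add: power2_eq_square)
qed simp

lemma bounded_clinear_proj_on: "bounded_clinear (proj_on M)"
proof (rule bounded_clinearI)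
  note M' = closed_csubspaceD[OF M]
  show "proj_on M (x + y) = proj_on M x + proj_on M y" for x y
    by (rule proj_on_unique) (auto simp: chilbert.ip_add_right cinner_proj_on proj_on_mem intro: M'(3,5))
  show "proj_on M (c *\<^sub>C x) = c *\<^sub>C proj_on M x" for c x
    by (rule proj_on_unique) (auto simp: chilbert.ip_sc_right cinner_proj_on proj_on_mem intro: M'(3,5))
  show "norm (proj_on M x) \<le> 1 * norm x" for x using norm_proj_on_le by simp
qed

lemma cinner_proj_on_left: "y \<in> M \<Longrightarrow> cinner (proj_on M x) y = cinner x y"
  by (subst (1 2) cinner_commute) (simp add: cinner_proj_on)

text \<open>Extension by 0 on the orthogonal complement makes operators on the defect space act on
  the whole type, as the block operators require.\<close>

lemma bounded_clinear_extension:
  assumes A: "bounded_clinear_on M A"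
  shows "bounded_clinear (\<lambda>x. A (proj_on M x))"
proof -
  obtain K where K: "\<And>x. x \<in> M \<Longrightarrow> norm (A x) \<le> K * norm x"
    using A unfolding bounded_clinear_on_def by blast
  note P = bounded_clinear_proj_on
  show ?thesis
  proof (rule bounded_clinearI)
    fix x
    have "norm (A (proj_on M x)) \<le> K * norm (proj_on M x)" by (rule K) (rule proj_on_mem)
    also have "\<dots> \<le> \<bar>K\<bar> * norm x" by (intro mult_mono norm_proj_on_le) auto
    finally show "norm (A (proj_on M x)) \<le> \<bar>K\<bar> * norm x" .
  qed (use A proj_on_mem in \<open>auto simp: bounded_clinear_on_def bounded_clinear_add[OF P] bounded_clinear_scaleC[OF P]\<close>)
qed

text \<open>Valid at every y, in M or not: both sides see y only through its pairing with vectors of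
  M.\<close>

lemma cadjoint_extension:
  assumes A: "bounded_clinear_on M A"
  shows "cadjoint (\<lambda>x. A (proj_on M x)) = adjoint_on M A"
proof
  fix y
  show "cadjoint (\<lambda>x. A (proj_on M x)) y = adjoint_on M A y"
    by (rule cadjoint_unique[OF bounded_clinear_extension[OF A]])
       (simp add: adjoint_on[OF M A] proj_on_mem cinner_proj_on_left adjoint_on_mem[OF M A])
qed

end

subsection \<open>Positive square roots and defect operators\<close>

text \<open>Polarization: the form is real at x + y and at x + \<i> y, which fixes the imaginary and
  the real part of the off-diagonal value.\<close>

lemma positive_op_selfadjoint:
  assumes "positive_op P"
  shows "cinner (P x) y = cinner x (P y)"
proof -
  have P: "bounded_clinear P" and real: "\<And>x. Im (cinner (P x) x) = 0"
    using assms by (auto simp: positive_op_def complex_nonneg_Reals_iff)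
  note simps = bounded_clinear_add[OF P] bounded_clinear_scaleC[OF P] chilbert.ip_add_left
    chilbert.ip_add_right chilbert.ip_sc_left chilbert.ip_sc_right
  have "Im (cinner (P (x + y)) (x + y)) = 0" "Im (cinner (P (x + \<i> *\<^sub>C y)) (x + \<i> *\<^sub>C y)) = 0"
    by (rule real)+
  hence "Im (cinner (P x) y) = - Im (cinner (P y) x)" "Re (cinner (P x) y) = Re (cinner (P y) x)"
    using real[of x] real[of y] by (simp_all add: simps)
  hence "cinner (P x) y = cnj (cinner (P y) x)" by (simp add: complex_eq_iff)
  also have "\<dots> = cinner x (P y)" by (rule cinner_commute[symmetric])
  finally show ?thesis .
qed

text \<open>Cauchy-Schwarz for the semidefinite form of S, at the vectors y and S y.\<close>

lemma positive_op_kernel: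
  assumes S: "positive_op S" and zero: "cinner (S y) y = 0"
  shows "S y = 0"
proof -
  have bS: "bounded_clinear S" using S by (simp add: positive_op_def)
  interpret S: hermitian_form scaleC "\<lambda>x y. cinner (S x) y"
  proof
    fix x y
    show "cinner (S x) y = cnj (cinner (S y) x)"
      unfolding positive_op_selfadjoint[OF S, of x y] by (rule cinner_commute)
  qed (use S in \<open>auto simp: bounded_clinear_add[OF bS] bounded_clinear_scaleC[OF bS]
      chilbert.ip_add_left chilbert.ip_sc_left positive_op_def complex_nonneg_Reals_iff\<close>)
  have "cmod (cinner (S y) (S y)) \<le> S.nrm y * S.nrm (S y)" by (rule S.cauchy_schwarz)
  also have "S.nrm y = 0" by (simp add: S.nrm_def zero)
  finally show ?thesis by (simp add: chilbert.ip_self)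
qed

text \<open>A fixed point Y = (B + Y^2) / 2 satisfies (1 - Y)^2 = 1 - B, so 1 - Y is a square root
  of 1 - B. For the defect operator, B is T^* T.\<close>

primrec sqrt_iteration :: "('a::chilbert_space \<Rightarrow> 'a) \<Rightarrow> nat \<Rightarrow> 'a \<Rightarrow> 'a" where
  "sqrt_iteration B 0 = (\<lambda>x. 0)"
| "sqrt_iteration B (Suc n) = (\<lambda>x. (1 / 2) *\<^sub>C (B x + sqrt_iteration B n (sqrt_iteration B n x)))"

text \<open>The same iteration for B = 1; it dominates the norms and the increments of the operator
  iterates.\<close>

primrec scalar_sqrt_iteration :: "nat \<Rightarrow> real" where
  "scalar_sqrt_iteration 0 = 0"
| "scalar_sqrt_iteration (Suc n) = (1 + (scalar_sqrt_iteration n)\<^sup>2) / 2"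

lemma scalar_sqrt_iteration_bounds: "0 \<le> scalar_sqrt_iteration n" "scalar_sqrt_iteration n \<le> 1"
  by (induction n) (simp_all add: power_le_one)

lemma scalar_sqrt_iteration_mono: "scalar_sqrt_iteration n \<le> scalar_sqrt_iteration (Suc n)"
proof -
  have "0 \<le> (1 - scalar_sqrt_iteration n)\<^sup>2" by simp
  thus ?thesis by (simp add: power2_diff)
qed

context
  fixes B :: "'a::chilbert_space \<Rightarrow> 'a"
  assumes B: "bounded_clinear B" and B_norm: "\<And>x. norm (B x) \<le> norm x"
    and B_selfadjoint: "\<And>x y. cinner (B x) y = cinner x (B y)"
begin

lemma bounded_clinear_sqrt_iteration: "bounded_clinear (sqrt_iteration B n)"
proof (induction n)
  case (Suc n)
  show ?case unfolding sqrt_iteration.simps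
    by (rule bounded_clinear_scale[OF bounded_clinear_plus[OF B bounded_clinear_compose[OF Suc Suc]]])
qed (simp add: bounded_clinear_zero_op)

lemma norm_sqrt_iteration: "norm (sqrt_iteration B n x) \<le> scalar_sqrt_iteration n * norm x"
proof (induction n arbitrary: x)
  case (Suc n)
  let ?s = "scalar_sqrt_iteration n"
  have "norm (sqrt_iteration B n (sqrt_iteration B n x)) \<le> ?s * norm (sqrt_iteration B n x)" by (rule Suc)
  also have "\<dots> \<le> ?s * (?s * norm x)" by (intro mult_left_mono Suc scalar_sqrt_iteration_bounds)
  finally have "norm (B x + sqrt_iteration B n (sqrt_iteration B n x)) \<le> norm x + ?s * (?s * norm x)"
    by (rule order_trans[OF norm_triangle_ineq add_mono[OF B_norm]])
  thus ?case by (simp add: chilbert.nrm_sc power2_eq_square algebra_simps del: chilbert.scale_right_distrib)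
qed simp

lemma sqrt_iteration_commutes:
  assumes C: "bounded_clinear C" and comm: "\<And>x. C (B x) = B (C x)"
  shows "C (sqrt_iteration B n x) = sqrt_iteration B n (C x)"
  by (induction n arbitrary: x)
     (simp_all add: bounded_clinear_add[OF C] bounded_clinear_scaleC[OF C] bounded_clinear_zero[OF C] comm)

lemma sqrt_iteration_commute: "sqrt_iteration B m (sqrt_iteration B n x) = sqrt_iteration B n (sqrt_iteration B m x)"
proof (rule sqrt_iteration_commutes[OF bounded_clinear_sqrt_iteration])
  show "sqrt_iteration B m (B x) = B (sqrt_iteration B m x)" for x
    by (rule sqrt_iteration_commutes[OF B, symmetric]) simp
qed

lemma sqrt_iteration_selfadjoint: "cinner (sqrt_iteration B n x) y = cinner x (sqrt_iteration B n y)"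
  by (induction n arbitrary: x y)
     (simp_all add: chilbert.ip_add_left chilbert.ip_add_right chilbert.ip_sc_left chilbert.ip_sc_right B_selfadjoint)

text \<open>The iterates commute, so Y^2 - Z^2 = (Y - Z) (Y + Z) for consecutive ones, as for the
  scalars that bound the two factors.\<close>

lemma sqrt_iteration_step:
  "norm (sqrt_iteration B (Suc n) x - sqrt_iteration B n x)
    \<le> (scalar_sqrt_iteration (Suc n) - scalar_sqrt_iteration n) * norm x"
proof (induction n arbitrary: x)
  case 0
  show ?case using B_norm[of x] by (simp add: chilbert.nrm_sc)
next
  case (Suc n)
  define Y where "Y = sqrt_iteration B"
  define s where "s = scalar_sqrt_iteration"
  note lin = bounded_clinear_add[OF bounded_clinear_sqrt_iteration, folded Y_def]
  have "Y (Suc (Suc n)) x - Y (Suc n) x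
      = (1 / 2) *\<^sub>C (Y (Suc n) (Y (Suc n) x) - Y n (Y n x))"
    unfolding Y_def sqrt_iteration.simps(2)[of B "Suc n"]
    by (subst (2) sqrt_iteration.simps(2)) (simp only: chilbert.scale_right_diff_distrib[symmetric] add_diff_add diff_self add_0)
  also have "Y (Suc n) (Y (Suc n) x) - Y n (Y n x)
      = Y (Suc n) (Y (Suc n) x + Y n x) - Y n (Y (Suc n) x + Y n x)"
    using sqrt_iteration_commute[of "Suc n" n x] unfolding Y_def[symmetric] lin by (simp add: algebra_simps)
  also have "norm ((1 / 2) *\<^sub>C \<dots>) \<le> 1 / 2 * ((s (Suc n) - s n) * norm (Y (Suc n) x + Y n x))"
    using Suc.IH[of "Y (Suc n) x + Y n x"] by (simp only: chilbert.nrm_sc Y_def s_def) simp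
  also have "\<dots> \<le> 1 / 2 * ((s (Suc n) - s n) * ((s (Suc n) + s n) * norm x))"
  proof (intro mult_left_mono)
    have "norm (Y (Suc n) x + Y n x) \<le> norm (Y (Suc n) x) + norm (Y n x)" by (rule norm_triangle_ineq)
    also have "\<dots> \<le> s (Suc n) * norm x + s n * norm x"
      unfolding Y_def s_def by (intro add_mono norm_sqrt_iteration)
    finally show "norm (Y (Suc n) x + Y n x) \<le> (s (Suc n) + s n) * norm x" by (simp add: algebra_simps)
    show "0 \<le> s (Suc n) - s n" using scalar_sqrt_iteration_mono[of n] by (simp add: s_def)
  qed simp
  also have "\<dots> = ((s (Suc n))\<^sup>2 - (s n)\<^sup>2) / 2 * norm x"
    by (simp add: power2_eq_square algebra_simps)
  also have "((s (Suc n))\<^sup>2 - (s n)\<^sup>2) / 2 = s (Suc (Suc n)) - s (Suc n)"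
    unfolding s_def scalar_sqrt_iteration.simps(2)[of "Suc n"]
    by (subst (3) scalar_sqrt_iteration.simps(2)) (simp add: diff_divide_distrib add_divide_distrib)
  finally show ?case by (simp only: Y_def s_def)
qed

lemma sqrt_iteration_diff:
  "norm (sqrt_iteration B (n + k) x - sqrt_iteration B n x)
    \<le> (scalar_sqrt_iteration (n + k) - scalar_sqrt_iteration n) * norm x"
proof (induction k)
  case (Suc k)
  have "norm (sqrt_iteration B (n + Suc k) x - sqrt_iteration B n x)
     \<le> norm (sqrt_iteration B (Suc (n + k)) x - sqrt_iteration B (n + k) x)
       + norm (sqrt_iteration B (n + k) x - sqrt_iteration B n x)"
    unfolding add_Suc_right by (rule norm_diff_triangle_ineq[THEN order_trans[rotated]] norm_triangle_le_diff) (simp_all add: norm_triangle_sub)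
  also have "\<dots> \<le> (scalar_sqrt_iteration (Suc (n + k)) - scalar_sqrt_iteration (n + k)) * norm x
       + (scalar_sqrt_iteration (n + k) - scalar_sqrt_iteration n) * norm x"
    by (intro add_mono sqrt_iteration_step Suc)
  finally show ?case by (simp only: add_Suc_right flip: distrib_right) simp
qed simp

text \<open>The increments are dominated by those of a bounded increasing real sequence.\<close>

lemma sqrt_iteration_convergent: "convergent (\<lambda>n. sqrt_iteration B n x)"
proof -
  define s where "s = scalar_sqrt_iteration"
  have mono: "incseq s" unfolding s_def by (rule incseq_SucI) (rule scalar_sqrt_iteration_mono)
  have "\<forall>i. s i \<le> 1" by (simp add: s_def scalar_sqrt_iteration_bounds)
  from incseq_convergent[OF mono this] obtain l where l: "s \<longlonglongrightarrow> l" "\<And>i. s i \<le> l"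
    by auto
  have "Cauchy (\<lambda>n. sqrt_iteration B n x)"
  proof (rule metric_CauchyI)
    fix e :: real assume e: "0 < e"
    define a where "a = norm x + 1"
    have a: "a > 0" "norm x \<le> a" using norm_ge_zero[of x] unfolding a_def by linarith+
    have "e / (2 * a) > 0" using e a by simp
    from LIMSEQ_D[OF l(1) this] obtain N where N: "\<And>n. n \<ge> N \<Longrightarrow> \<bar>s n - l\<bar> < e / (2 * a)"
      unfolding real_norm_def by blast
    have tail: "dist (sqrt_iteration B m x) (sqrt_iteration B N x) < e / 2" if "m \<ge> N" for m
    proof -
      define k where "k = m - N"
      have m: "m = N + k" using that by (simp add: k_def)
      have "dist (sqrt_iteration B m x) (sqrt_iteration B N x) \<le> (s m - s N) * norm x"
        unfolding m dist_norm s_def by (rule sqrt_iteration_diff)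
      also have "\<dots> \<le> (l - s N) * a"
        using l(2)[of m] l(2)[of N] a by (intro mult_mono) auto
      also have "\<dots> < e / (2 * a) * a"
        using N[of N] a by (intro mult_strict_right_mono) auto
      also have "\<dots> = e / 2" using a by simp
      finally show ?thesis .
    qed
    show "\<exists>M. \<forall>m\<ge>M. \<forall>n\<ge>M. dist (sqrt_iteration B m x) (sqrt_iteration B n x) < e"
      by (intro exI[of _ N] allI impI dist_triangle_half_l[OF tail tail])
  qed
  thus ?thesis by (rule Cauchy_convergent)
qed

definition sqrt_limit :: "'a \<Rightarrow> 'a" where "sqrt_limit x = lim (\<lambda>n. sqrt_iteration B n x)"

lemma sqrt_limit: "(\<lambda>n. sqrt_iteration B n x) \<longlonglongrightarrow> sqrt_limit x"
  unfolding sqrt_limit_def using sqrt_iteration_convergent by (simp add: convergent_LIMSEQ_iff)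

lemma norm_sqrt_iteration_le: "norm (sqrt_iteration B n x) \<le> norm x"
  using norm_sqrt_iteration[of n x] mult_right_mono[OF scalar_sqrt_iteration_bounds(2), of "norm x" n]
  by simp

lemma norm_sqrt_limit: "norm (sqrt_limit x) \<le> norm x"
  by (rule Lim_norm_ubound[OF sequentially_bot sqrt_limit]) (simp add: norm_sqrt_iteration_le)

lemma bounded_clinear_sqrt_limit: "bounded_clinear sqrt_limit"
proof (rule bounded_clinearI)
  note Y = bounded_clinear_sqrt_iteration
  fix x y c
  have "(\<lambda>n. sqrt_iteration B n (x + y)) \<longlonglongrightarrow> sqrt_limit x + sqrt_limit y"
    unfolding bounded_clinear_add[OF Y] by (intro tendsto_add sqrt_limit)
  thus "sqrt_limit (x + y) = sqrt_limit x + sqrt_limit y" using sqrt_limit LIMSEQ_unique by blast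
  have "(\<lambda>n. c *\<^sub>C sqrt_iteration B n x) \<longlonglongrightarrow> c *\<^sub>C sqrt_limit x"
    by (rule bounded_clinear_tendsto[OF bounded_clinear_scale[OF bounded_clinear_id] sqrt_limit])
  hence "(\<lambda>n. sqrt_iteration B n (c *\<^sub>C x)) \<longlonglongrightarrow> c *\<^sub>C sqrt_limit x"
    unfolding bounded_clinear_scaleC[OF Y] .
  thus "sqrt_limit (c *\<^sub>C x) = c *\<^sub>C sqrt_limit x" using sqrt_limit LIMSEQ_unique by blast
  show "norm (sqrt_limit x) \<le> 1 * norm x" using norm_sqrt_limit by simp
qed

lemma sqrt_limit_selfadjoint: "cinner (sqrt_limit x) y = cinner x (sqrt_limit y)"
proof -
  have "(\<lambda>n. cinner (sqrt_iteration B n x) y) \<longlonglongrightarrow> cinner (sqrt_limit x) y"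
    by (intro tendsto_cinner sqrt_limit tendsto_const)
  moreover have "(\<lambda>n. cinner (sqrt_iteration B n x) y) \<longlonglongrightarrow> cinner x (sqrt_limit y)"
    unfolding sqrt_iteration_selfadjoint by (intro tendsto_cinner sqrt_limit tendsto_const)
  ultimately show ?thesis by (rule LIMSEQ_unique)
qed

lemma sqrt_limit_equation: "sqrt_limit x = (1 / 2) *\<^sub>C (B x + sqrt_limit (sqrt_limit x))"
proof -
  note Y = bounded_clinear_sqrt_iteration
  have "(\<lambda>n. sqrt_iteration B n (sqrt_iteration B n x)) \<longlonglongrightarrow> sqrt_limit (sqrt_limit x)"
  proof (rule LIM_zero_cancel, rule Lim_null_comparison)
    show "\<forall>\<^sub>F n in sequentially. norm (sqrt_iteration B n (sqrt_iteration B n x) - sqrt_limit (sqrt_limit x))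
        \<le> norm (sqrt_iteration B n x - sqrt_limit x) + norm (sqrt_iteration B n (sqrt_limit x) - sqrt_limit (sqrt_limit x))"
    proof (intro always_eventually allI)
      fix n
      have "sqrt_iteration B n (sqrt_iteration B n x) - sqrt_limit (sqrt_limit x)
        = sqrt_iteration B n (sqrt_iteration B n x - sqrt_limit x) + (sqrt_iteration B n (sqrt_limit x) - sqrt_limit (sqrt_limit x))"
        by (simp add: bounded_clinear_diff[OF Y])
      also have "norm \<dots> \<le> norm (sqrt_iteration B n x - sqrt_limit x) + norm (sqrt_iteration B n (sqrt_limit x) - sqrt_limit (sqrt_limit x))"
        by (rule order_trans[OF norm_triangle_ineq add_right_mono]) (rule norm_sqrt_iteration_le)
      finally show "norm (sqrt_iteration B n (sqrt_iteration B n x) - sqrt_limit (sqrt_limit x))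
        \<le> norm (sqrt_iteration B n x - sqrt_limit x) + norm (sqrt_iteration B n (sqrt_limit x) - sqrt_limit (sqrt_limit x))" .
    qed
    show "(\<lambda>n. norm (sqrt_iteration B n x - sqrt_limit x) + norm (sqrt_iteration B n (sqrt_limit x) - sqrt_limit (sqrt_limit x))) \<longlonglongrightarrow> 0"
      by (rule tendsto_add_zero[OF tendsto_norm_zero[OF LIM_zero[OF sqrt_limit]] tendsto_norm_zero[OF LIM_zero[OF sqrt_limit]]])
  qed
  hence "(\<lambda>n. sqrt_iteration B (Suc n) x) \<longlonglongrightarrow> (1 / 2) *\<^sub>C (B x + sqrt_limit (sqrt_limit x))"
    unfolding sqrt_iteration.simps
    by (intro bounded_clinear_tendsto[OF bounded_clinear_scale[OF bounded_clinear_id]] tendsto_add[OF tendsto_const])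
  moreover have "(\<lambda>n. sqrt_iteration B (Suc n) x) \<longlonglongrightarrow> sqrt_limit x"
    using sqrt_limit by (rule LIMSEQ_Suc)
  ultimately show ?thesis by (rule LIMSEQ_unique[rotated])
qed

lemma sqrt_limit_commutes:
  assumes C: "bounded_clinear C" and comm: "\<And>x. C (B x) = B (C x)"
  shows "C (sqrt_limit x) = sqrt_limit (C x)"
proof -
  have "(\<lambda>n. C (sqrt_iteration B n x)) \<longlonglongrightarrow> C (sqrt_limit x)"
    by (rule bounded_clinear_tendsto[OF C sqrt_limit])
  hence "(\<lambda>n. sqrt_iteration B n (C x)) \<longlonglongrightarrow> C (sqrt_limit x)"
    by (simp only: sqrt_iteration_commutes[OF C comm])
  thus ?thesis using sqrt_limit LIMSEQ_unique by blast
qed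

lemma ex1_positive_sqrt: "\<exists>!S. positive_op S \<and> S \<circ> S = (\<lambda>x. x - B x)"
proof -
  define S where "S x = x - sqrt_limit x" for x
  have bS: "bounded_clinear S"
    unfolding S_def by (rule bounded_clinear_minus[OF bounded_clinear_id bounded_clinear_sqrt_limit])
  have S_pos: "positive_op S"
    unfolding positive_op_def
  proof (intro conjI allI bS)
    fix x
    have "cinner (sqrt_limit x) x = cnj (cinner (sqrt_limit x) x)"
      by (rule trans[OF sqrt_limit_selfadjoint cinner_commute])
    hence "Im (cinner (sqrt_limit x) x) = 0" by (simp add: complex_eq_iff)
    moreover have "Re (cinner (sqrt_limit x) x) \<le> (norm x)\<^sup>2"
    proof -
      have "Re (cinner (sqrt_limit x) x) \<le> cmod (cinner (sqrt_limit x) x)" by (rule complex_Re_le_cmod)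
      also have "\<dots> \<le> norm (sqrt_limit x) * norm x" by (rule chilbert.cauchy_schwarz)
      also have "\<dots> \<le> norm x * norm x" by (intro mult_right_mono norm_sqrt_limit) simp
      finally show ?thesis by (simp add: power2_eq_square)
    qed
    ultimately show "cinner (S x) x \<in> \<real>\<^sub>\<ge>\<^sub>0"
      by (simp add: S_def chilbert.ip_diff_left chilbert.ip_self complex_nonneg_Reals_iff)
  qed
  have S_sq: "S (S x) = x - B x" for x
  proof -
    have "2 *\<^sub>C sqrt_limit x = B x + sqrt_limit (sqrt_limit x)"
      by (subst sqrt_limit_equation) (simp add: chilbert.scale_right_distrib)
    moreover have "2 *\<^sub>C sqrt_limit x = sqrt_limit x + sqrt_limit x"
      using chilbert.scale_left_distrib[of 1 1 "sqrt_limit x"] by simp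
    ultimately have "sqrt_limit (sqrt_limit x) = sqrt_limit x + sqrt_limit x - B x" by (simp add: algebra_simps)
    thus ?thesis by (simp add: S_def bounded_clinear_diff[OF bounded_clinear_sqrt_limit])
  qed
  show ?thesis
  proof (rule ex1I[of _ S])
    show "positive_op S \<and> S \<circ> S = (\<lambda>x. x - B x)" using S_pos S_sq by auto
    fix S' assume S': "positive_op S' \<and> S' \<circ> S' = (\<lambda>x. x - B x)"
    hence bS': "bounded_clinear S'" and S'_sq: "\<And>x. S' (S' x) = x - B x"
      by (auto simp: positive_op_def fun_eq_iff)
    \<comment> \<open>Uniqueness: S' commutes with B = 1 - S'^2, hence with the limit of polynomials
      in B, hence with S. Then (S + S') (S - S') = 0, and positivity of both forms makes S and S'
      vanish on the range of S - S'.\<close>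
    have "S' (B x) = B (S' x)" for x
      using S'_sq[of x] S'_sq[of "S' x"] bounded_clinear_diff[OF bS', of x "B x"] by simp
    from sqrt_limit_commutes[OF bS' this] have comm: "S' (S x) = S (S' x)" for x
      by (simp add: S_def bounded_clinear_diff[OF bS'])
    show "S' = S"
    proof
      fix x
      define y where "y = S x - S' x"
      have sum0: "S y + S' y = 0"
        using comm[of x] by (simp add: y_def bounded_clinear_diff[OF bS] bounded_clinear_diff[OF bS'] S_sq S'_sq)
      have "cinner (S y) y + cinner (S' y) y = 0"
        using sum0 by (simp flip: chilbert.ip_add_left)
      moreover have "cinner (S y) y \<in> \<real>\<^sub>\<ge>\<^sub>0" "cinner (S' y) y \<in> \<real>\<^sub>\<ge>\<^sub>0"
        using S_pos S' by (auto simp: positive_op_def)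
      ultimately have "cinner (S y) y = 0" "cinner (S' y) y = 0"
        by (auto simp: complex_nonneg_Reals_iff complex_eq_iff)
      hence "S y = 0" "S' y = 0" using positive_op_kernel[OF S_pos] positive_op_kernel[OF conjunct1[OF S']] by blast+
      have "cinner y y = cinner (S x) y - cinner (S' x) y"
        by (subst (1) y_def) (simp add: chilbert.ip_diff_left)
      also have "\<dots> = cinner x (S y) - cinner x (S' y)"
        by (simp only: positive_op_selfadjoint[OF S_pos] positive_op_selfadjoint[OF conjunct1[OF S']])
      also have "\<dots> = 0" by (simp add: \<open>S y = 0\<close> \<open>S' y = 0\<close>)
      finally have "y = 0" by (simp add: chilbert.ip_self)
      thus "S' x = S x" by (simp add: y_def)
    qed
  qed
qed

end

context
  fixes T :: "'a::chilbert_space \<Rightarrow> 'a"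
  assumes T: "contraction T"
begin

lemma positive_op_defect: "positive_op (defect_op T)"
  and defect_op_square: "defect_op T (defect_op T x) = x - cadjoint T (T x)"
proof -
  note bT = contractionD(1)[OF T]
  have "\<exists>!S. positive_op S \<and> S \<circ> S = (\<lambda>x. x - cadjoint T (T x))"
  proof (rule ex1_positive_sqrt)
    show "bounded_clinear (\<lambda>x. cadjoint T (T x))"
      by (rule bounded_clinear_compose[OF bounded_clinear_cadjoint[OF bT] bT])
    show "norm (cadjoint T (T x)) \<le> norm x" for x
      using norm_cadjoint_le[OF bT, of 1 "T x"] contractionD(2)[OF T]
      by (intro order_trans[OF _ contractionD(2)[OF T, of x]]) simp
    show "cinner (cadjoint T (T x)) y = cinner x (cadjoint T (T y))" for x y
      by (simp add: cadjoint'[OF bT] cadjoint[OF bT])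
  qed
  from theI'[OF this] show "positive_op (defect_op T)" "defect_op T (defect_op T x) = x - cadjoint T (T x)"
    unfolding defect_op_def sqrt_op_def by (simp_all add: fun_eq_iff)
qed

lemma bounded_clinear_defect: "bounded_clinear (defect_op T)"
  using positive_op_defect by (simp add: positive_op_def)

lemma defect_op_selfadjoint: "cinner (defect_op T x) y = cinner x (defect_op T y)"
  by (rule positive_op_selfadjoint[OF positive_op_defect])

lemma defect_op_mem: "defect_op T x \<in> defect_space T"
  unfolding defect_space_def by (rule subsetD[OF closure_subset rangeI])

lemma closed_csubspace_defect_space: "closed_csubspace (defect_space T)"
proof -
  note D = bounded_clinear_defect
  have "chilbert.subspace (closure (range (defect_op T)))"
  proof (rule chilbert.subspaceI)
    have "defect_op T 0 \<in> closure (range (defect_op T))" by (rule subsetD[OF closure_subset rangeI])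
    thus "0 \<in> closure (range (defect_op T))" by (simp add: bounded_clinear_zero[OF D])
  next
    fix x y assume "x \<in> closure (range (defect_op T))" "y \<in> closure (range (defect_op T))"
    then obtain u v where u: "\<And>n. u n \<in> range (defect_op T)" "u \<longlonglongrightarrow> x"
      and v: "\<And>n. v n \<in> range (defect_op T)" "v \<longlonglongrightarrow> y" unfolding closure_sequential by blast
    have "u n + v n \<in> range (defect_op T)" for n
    proof -
      obtain a b where "u n = defect_op T a" "v n = defect_op T b" using u(1)[of n] v(1)[of n] by blast
      hence "u n + v n = defect_op T (a + b)" by (simp only: bounded_clinear_add[OF D])
      thus ?thesis by (rule range_eqI)
    qed
    thus "x + y \<in> closure (range (defect_op T))"
      unfolding closure_sequential using tendsto_add[OF u(2) v(2)]
      by (intro exI[of _ "\<lambda>n. u n + v n"]) simp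
  next
    fix c x assume "x \<in> closure (range (defect_op T))"
    then obtain u where u: "\<And>n. u n \<in> range (defect_op T)" "u \<longlonglongrightarrow> x"
      unfolding closure_sequential by blast
    have "c *\<^sub>C u n \<in> range (defect_op T)" for n
    proof -
      obtain a where "u n = defect_op T a" using u(1)[of n] by blast
      hence "c *\<^sub>C u n = defect_op T (c *\<^sub>C a)" by (simp only: bounded_clinear_scaleC[OF D])
      thus ?thesis by (rule range_eqI)
    qed
    thus "c *\<^sub>C x \<in> closure (range (defect_op T))"
      unfolding closure_sequential
      using bounded_clinear_tendsto[OF bounded_clinear_scale[OF bounded_clinear_id] u(2)]
      by (intro exI[of _ "\<lambda>n. c *\<^sub>C u n"]) simp
  qed
  thus ?thesis by (simp add: closed_csubspace_def defect_space_def)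
qed

text \<open>The kernel of a self-adjoint operator is orthogonal to its range, and y is a limit of
  vectors in the range. This lets the defect operator be cancelled on its own space.\<close>

lemma defect_op_injective:
  assumes "y \<in> defect_space T" "defect_op T y = 0"
  shows "y = 0"
proof -
  obtain u where u: "\<And>n. u n \<in> range (defect_op T)" "u \<longlonglongrightarrow> y"
    using assms(1) unfolding defect_space_def closure_sequential by blast
  have "cinner y (u n) = 0" for n
  proof -
    obtain a where "u n = defect_op T a" using u(1)[of n] by blast
    thus ?thesis using defect_op_selfadjoint[of y a] assms(2) by simp
  qed
  moreover have "(\<lambda>n. cinner y (u n)) \<longlonglongrightarrow> cinner y y"
    by (intro tendsto_cinner tendsto_const u)
  ultimately have "cinner y y = 0" by (simp add: LIMSEQ_const_iff)
  thus ?thesis by (simp add: chilbert.ip_self)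
qed

end

subsection \<open>Numerical radius and normal operators\<close>

text \<open>Pearcy's argument for the power inequality, for the exponent two.\<close>

lemma numerical_radius_square:
  fixes L :: "'a::chilbert_space \<Rightarrow> 'a"
  assumes L: "bounded_clinear L"
    and w: "\<And>x. cmod (cinner (L x) x) \<le> (norm x)\<^sup>2"
  shows "cmod (cinner (L (L x)) x) \<le> (norm x)\<^sup>2"
proof -
  have main: "Re (c\<^sup>2 * cinner (L (L x)) x) \<le> (norm x)\<^sup>2" if c: "cmod c = 1" for c
  proof -
    note lin = bounded_clinear_add[OF L] bounded_clinear_diff[OF L] bounded_clinear_scaleC[OF L]
    define K where "K y = c *\<^sub>C L y" for y
    have K: "K (a + b) = K a + K b" "K (a - b) = K a - K b" for a b
      by (simp_all add: K_def lin chilbert.scale_right_distrib chilbert.scale_right_diff_distrib)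
    have le: "\<bar>Re (cinner (K y) y)\<bar> \<le> (norm y)\<^sup>2" for y
    proof -
      have "\<bar>Re (cinner (K y) y)\<bar> \<le> cmod (cinner (K y) y)" by (rule abs_Re_le_cmod)
      also have "\<dots> = cmod (cinner (L y) y)" by (simp add: K_def chilbert.ip_sc_left norm_mult c)
      finally show ?thesis using w[of y] by simp
    qed
    \<comment> \<open>From 1 - K^2 = (1 - K) (1 + K): both (1 - K) u and (1 + K) v equal (1 - K^2)
      x, and u + v = 2 x.\<close>
    define u where "u = x + K x"
    define v where "v = x - K x"
    have "0 \<le> Re (cinner (u - K u) u) + Re (cinner (v + K v) v)"
      using le[of u] le[of v] by (simp add: chilbert.ip_diff_left chilbert.ip_add_left chilbert.ip_self)
    also have "u - K u = x - K (K x)" by (simp add: u_def K)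
    also have "v + K v = x - K (K x)" by (simp add: v_def K)
    also have "Re (cinner (x - K (K x)) u) + Re (cinner (x - K (K x)) v) = 2 * Re (cinner (x - K (K x)) x)"
      by (simp add: u_def v_def chilbert.ip_add_right chilbert.ip_diff_right)
    also have "cinner (x - K (K x)) x = (norm x)\<^sup>2 - c\<^sup>2 * cinner (L (L x)) x"
      by (simp add: K_def lin chilbert.ip_diff_left chilbert.ip_sc_left chilbert.ip_self power2_eq_square mult.assoc)
    finally show ?thesis by simp
  qed
  define z where "z = cinner (L (L x)) x"
  show ?thesis
  proof (cases "z = 0")
    case False
    \<comment> \<open>The phase for which c^2 z is the modulus of z.\<close>
    define c where "c = csqrt (cnj z / cmod z)"
    have c2: "c\<^sup>2 = cnj z / cmod z" by (simp add: c_def)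
    have "(cmod c)\<^sup>2 = 1" using False by (simp add: c2 norm_divide flip: norm_power)
    hence "cmod c = 1" using norm_ge_zero[of c] by (simp add: power2_eq_1_iff)
    from main[OF this] have "Re (cnj z / cmod z * z) \<le> (norm x)\<^sup>2" by (simp add: c2 z_def)
    moreover have "cnj z / cmod z * z = complex_of_real (cmod z)"
    proof -
      have "cnj z * z = complex_of_real (cmod z) * complex_of_real (cmod z)"
        by (metis complex_norm_square mult.commute of_real_mult power2_eq_square)
      thus ?thesis using False by simp
    qed
    ultimately have "Re (complex_of_real (cmod z)) \<le> (norm x)\<^sup>2" by (simp only:)
    thus ?thesis by (simp add: z_def)
  qed (simp add: z_def)
qed

text \<open>Polarization and the parallelogram law bound the form at x, y by
  \<parallel>x\<parallel>^2 + \<parallel>y\<parallel>^2; the multiple y of L x with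
  \<parallel>y\<parallel> = \<parallel>x\<parallel> then gives the factor 2.\<close>

lemma norm_le_numerical_radius:
  fixes L :: "'a::chilbert_space \<Rightarrow> 'a"
  assumes L: "bounded_clinear L"
    and w: "\<And>x. cmod (cinner (L x) x) \<le> (norm x)\<^sup>2"
  shows "norm (L x) \<le> 2 * norm x"
proof -
  note lin = bounded_clinear_add[OF L] bounded_clinear_diff[OF L] bounded_clinear_scaleC[OF L]
  have bound: "cmod (cinner (L x) y) \<le> (norm x)\<^sup>2 + (norm y)\<^sup>2" for x y
  proof -
    define q where "q z = cinner (L z) z" for z
    have id: "4 * cinner (L x) y = q (x + y) - q (x - y) + \<i> * q (x + \<i> *\<^sub>C y) - \<i> * q (x - \<i> *\<^sub>C y)"
      by (simp add: q_def lin chilbert.ip_add_left chilbert.ip_add_right chilbert.ip_diff_left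
          chilbert.ip_diff_right chilbert.ip_sc_left chilbert.ip_sc_right algebra_simps)
    have par: "(norm (a + b))\<^sup>2 + (norm (a - b))\<^sup>2 = 2 * (norm a)\<^sup>2 + 2 * (norm b)\<^sup>2" for a b :: 'a
      by (simp add: power2_norm_eq_inner inner_add_left inner_add_right inner_diff_left inner_diff_right inner_commute)
    have "4 * cmod (cinner (L x) y) = cmod (4 * cinner (L x) y)" by (simp add: norm_mult)
    also have "\<dots> \<le> cmod (q (x + y)) + cmod (q (x - y)) + cmod (\<i> * q (x + \<i> *\<^sub>C y)) + cmod (\<i> * q (x - \<i> *\<^sub>C y))"
      unfolding id by (intro order_trans[OF norm_triangle_ineq4] order_trans[OF norm_triangle_ineq] add_mono order_refl)
    also have "\<dots> \<le> (norm (x + y))\<^sup>2 + (norm (x - y))\<^sup>2 + (norm (x + \<i> *\<^sub>C y))\<^sup>2 + (norm (x - \<i> *\<^sub>C y))\<^sup>2"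
      unfolding q_def norm_mult by (intro add_mono) (simp_all add: w)
    also have "\<dots> = 4 * ((norm x)\<^sup>2 + (norm y)\<^sup>2)"
      using par[of x y] par[of x "\<i> *\<^sub>C y"] by (simp add: chilbert.nrm_sc)
    finally show ?thesis by simp
  qed
  show ?thesis
  proof (cases "L x = 0")
    case False
    hence "x \<noteq> 0" using bounded_clinear_zero[OF L] by auto
    define t where "t = norm x / norm (L x)"
    have "cmod (cinner (L x) (complex_of_real t *\<^sub>C L x)) = t * (norm (L x))\<^sup>2"
      by (simp add: chilbert.ip_sc_right chilbert.ip_self norm_mult norm_power norm_divide t_def)
    also have "\<dots> = norm x * norm (L x)" using False by (simp add: t_def power2_eq_square)
    finally have "norm x * norm (L x) \<le> (norm x)\<^sup>2 + (norm (complex_of_real t *\<^sub>C L x))\<^sup>2"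
      using bound[of x "complex_of_real t *\<^sub>C L x"] by simp
    also have "norm (complex_of_real t *\<^sub>C L x) = norm x"
      using False by (simp add: chilbert.nrm_sc norm_divide t_def)
    finally have "norm x * norm (L x) \<le> norm x * (2 * norm x)" by (simp add: power2_eq_square)
    thus ?thesis using \<open>x \<noteq> 0\<close> by simp
  qed simp
qed

lemma bounded_clinear_funpow: "bounded_clinear L \<Longrightarrow> bounded_clinear (L ^^ n)"
proof (induction n)
  case 0
  show ?case by (simp add: id_def bounded_clinear_id)
next
  case (Suc n)
  from bounded_clinear_compose[OF Suc.prems Suc.IH[OF Suc.prems]] show ?case by (simp add: comp_def)
qed

text \<open>The powers N^(2^k) keep numerical radius at most 1 and hence norm at most 2. Normality
  gives \<parallel>N^m x\<parallel>^2 \<le> \<parallel>x\<parallel> \<parallel>N^(2 m) x\<parallel>,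
  and repeated doubling removes the 2.\<close>

lemma normal_contraction:
  fixes N N' :: "'a::chilbert_space \<Rightarrow> 'a"
  assumes N: "bounded_clinear N"
    and adj: "\<And>x y. cinner (N x) y = cinner x (N' y)"
    and normal: "\<And>x. N (N' x) = N' (N x)"
    and w: "\<And>x. cmod (cinner (N x) x) \<le> (norm x)\<^sup>2"
  shows "norm (N x) \<le> norm x"
proof -
  have w_pow: "cmod (cinner ((N ^^ (2 ^ k)) x) x) \<le> (norm x)\<^sup>2" for k x
  proof (induction k arbitrary: x)
    case (Suc k)
    have "(N ^^ (2 ^ Suc k)) x = (N ^^ (2 ^ k)) ((N ^^ (2 ^ k)) x)"
      by (simp add: mult_2 funpow_add)
    thus ?case using numerical_radius_square[OF bounded_clinear_funpow[OF N] Suc] by simp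
  qed (simp add: w)
  have adj_pow: "cinner ((N ^^ m) x) y = cinner x ((N' ^^ m) y)" for m x y
    by (induction m arbitrary: x y) (simp_all add: adj funpow_swap1)
  have adj_pow': "cinner ((N' ^^ m) x) y = cinner x ((N ^^ m) y)" for m x y
    by (subst (1 2) cinner_commute) (simp only: adj_pow)
  have norm_eq: "norm ((N' ^^ m) x) = norm ((N ^^ m) x)" for m x
  proof (rule chilbert.nrm_eqI)
    show "cinner ((N' ^^ m) x) ((N' ^^ m) x) = cinner ((N ^^ m) x) ((N ^^ m) x)"
      by (simp only: adj_pow' adj_pow funpow_commute_both[of N N', OF normal])
  qed
  have "norm ((N ^^ (2 ^ 0)) x) \<le> 1 * norm x"
  proof (rule doubling_growth_bound)
    fix k
    define m :: nat where "m = 2 ^ k"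
    have "complex_of_real ((norm ((N ^^ m) x))\<^sup>2) = cinner x ((N' ^^ m) ((N ^^ m) x))"
      unfolding chilbert.ip_self[symmetric] by (rule adj_pow)
    hence "(norm ((N ^^ m) x))\<^sup>2 = cmod (cinner x ((N' ^^ m) ((N ^^ m) x)))"
      by (metis norm_of_real abs_of_nonneg zero_le_power2)
    also have "\<dots> \<le> norm x * norm ((N' ^^ m) ((N ^^ m) x))" by (rule chilbert.cauchy_schwarz)
    also have "norm ((N' ^^ m) ((N ^^ m) x)) = norm ((N ^^ (m + m)) x)"
      by (simp add: norm_eq funpow_add)
    also have "m + m = 2 ^ Suc k" by (simp add: m_def)
    finally show "(norm ((N ^^ (2 ^ k)) x))\<^sup>2 \<le> norm x * norm ((N ^^ (2 ^ Suc k)) x)"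
      by (simp only: m_def)
    have "norm ((N ^^ (2 ^ k)) x) \<le> 2 * norm x"
      by (rule norm_le_numerical_radius[OF bounded_clinear_funpow[OF N] w_pow])
    also have "\<dots> \<le> (2 * norm x) * 4 ^ k"
      using mult_left_mono[of 1 "4 ^ k" "2 * norm x"] one_le_power[of "4::real" k] by simp
    finally show "norm ((N ^^ (2 ^ k)) x) \<le> (2 * norm x) * 4 ^ k * 1 ^ (2 ^ k)" by simp
  qed auto
  thus ?thesis by simp
qed

subsection \<open>Toeplitz operators with a contractive symbol\<close>

lemma discrete_parseval:
  fixes v :: "nat \<Rightarrow> 'a::chilbert_space"
  shows "(\<Sum>a<R. (norm (\<Sum>k<R. cis (2 * pi * real a / real R * real k) *\<^sub>C v k))\<^sup>2) = real R * (\<Sum>k<R. (norm (v k))\<^sup>2)"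
proof -
  define \<theta> where "\<theta> a = 2 * pi * real a / real R" for a
  have "complex_of_real (\<Sum>a<R. (norm (\<Sum>k<R. cis (\<theta> a * real k) *\<^sub>C v k))\<^sup>2)
      = (\<Sum>a<R. cinner (\<Sum>k<R. cis (\<theta> a * real k) *\<^sub>C v k) (\<Sum>k<R. cis (\<theta> a * real k) *\<^sub>C v k))"
    by (simp add: chilbert.ip_self)
  also have "\<dots> = (\<Sum>a<R. \<Sum>k<R. \<Sum>l<R. cis (\<theta> a * of_int (int k - int l)) * cinner (v k) (v l))"
  proof (intro sum.cong refl)
    fix a
    show "cinner (\<Sum>k<R. cis (\<theta> a * real k) *\<^sub>C v k) (\<Sum>k<R. cis (\<theta> a * real k) *\<^sub>C v k)
        = (\<Sum>k<R. \<Sum>l<R. cis (\<theta> a * of_int (int k - int l)) * cinner (v k) (v l))"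
      unfolding chilbert.ip_sum_left
    proof (intro sum.cong refl)
      fix k
      show "cinner (cis (\<theta> a * real k) *\<^sub>C v k) (\<Sum>k<R. cis (\<theta> a * real k) *\<^sub>C v k)
          = (\<Sum>l<R. cis (\<theta> a * of_int (int k - int l)) * cinner (v k) (v l))"
        unfolding chilbert.ip_sum_right
      proof (intro sum.cong refl)
        fix l
        have "cis (\<theta> a * of_int (int k - int l)) = cis (\<theta> a * real k) * cnj (cis (\<theta> a * real l))"
          by (simp add: cis_cnj cis_mult algebra_simps)
        thus "cinner (cis (\<theta> a * real k) *\<^sub>C v k) (cis (\<theta> a * real l) *\<^sub>C v l)
            = cis (\<theta> a * of_int (int k - int l)) * cinner (v k) (v l)"
          by (simp only: chilbert.ip_sc_left chilbert.ip_sc_right mult_ac)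
      qed
    qed
  qed
  also have "\<dots> = (\<Sum>k<R. \<Sum>l<R. \<Sum>a<R. cis (\<theta> a * of_int (int k - int l)) * cinner (v k) (v l))"
    by (subst sum.swap, rule sum.cong[OF refl], rule sum.swap)
  also have "\<dots> = (\<Sum>k<R. \<Sum>l<R. (if k = l then of_nat R * cinner (v k) (v k) else 0))"
  proof (intro sum.cong refl)
    fix k l assume kl: "k \<in> {..<R}" "l \<in> {..<R}"
    have "(\<Sum>a<R. cis (\<theta> a * of_int (int k - int l))) = (if int k - int l = 0 then of_nat R else 0)"
      unfolding \<theta>_def by (rule sum_cis_multiples) (use kl in auto)
    thus "(\<Sum>a<R. cis (\<theta> a * of_int (int k - int l)) * cinner (v k) (v l))
        = (if k = l then of_nat R * cinner (v k) (v k) else 0)"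
      unfolding sum_distrib_right[symmetric] by simp
  qed
  also have "\<dots> = complex_of_real (real R * (\<Sum>k<R. (norm (v k))\<^sup>2))"
    by (simp add: chilbert.ip_self sum_distrib_left)
  finally show ?thesis unfolding \<theta>_def of_real_eq_iff .
qed

text \<open>The discrete Fourier transform turns the bidiagonal Toeplitz operator into
  multiplication by F + z G at roots of unity. The image of a has n + 1 entries, so with n + 1
  sample points nothing wraps around.\<close>

lemma toeplitz_contraction:
  fixes F G :: "'a::chilbert_space \<Rightarrow> 'a"
  assumes F: "bounded_clinear F" and G: "bounded_clinear G"
    and symbol: "\<And>z x. cmod z = 1 \<Longrightarrow> norm (F x + z *\<^sub>C G x) \<le> norm x"
    and supp: "\<And>k. k \<ge> n \<Longrightarrow> a k = 0"
  shows "(\<Sum>k<Suc n. (norm (F (a k) + (case k of 0 \<Rightarrow> 0 | Suc j \<Rightarrow> G (a j))))\<^sup>2) \<le> (\<Sum>k<Suc n. (norm (a k))\<^sup>2)"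
proof -
  define b where "b k = F (a k) + (case k of 0 \<Rightarrow> 0 | Suc j \<Rightarrow> G (a j))" for k
  define \<theta> where "\<theta> c = 2 * pi * real c / real (Suc n)" for c
  have conv: "(\<Sum>k<Suc n. cis (t * real k) *\<^sub>C b k)
      = F (\<Sum>k<Suc n. cis (t * real k) *\<^sub>C a k) + cis t *\<^sub>C G (\<Sum>k<Suc n. cis (t * real k) *\<^sub>C a k)" for t
  proof -
    have "(\<Sum>k<Suc n. cis (t * real k) *\<^sub>C b k)
        = (\<Sum>k<Suc n. cis (t * real k) *\<^sub>C F (a k))
          + (\<Sum>k<Suc n. cis (t * real k) *\<^sub>C (case k of 0 \<Rightarrow> 0 | Suc j \<Rightarrow> G (a j)))"
      by (simp only: b_def chilbert.scale_right_distrib sum.distrib)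
    also have "(\<Sum>k<Suc n. cis (t * real k) *\<^sub>C (case k of 0 \<Rightarrow> 0 | Suc j \<Rightarrow> G (a j)))
        = (\<Sum>k<n. cis (t * real (Suc k)) *\<^sub>C G (a k))"
      by (subst sum.lessThan_Suc_shift) simp
    \<comment> \<open>The added term is 0 because a n = 0.\<close>
    also have "\<dots> = (\<Sum>k<Suc n. cis (t * real (Suc k)) *\<^sub>C G (a k))"
      by (simp add: supp bounded_clinear_zero[OF G])
    also have "\<dots> = cis t *\<^sub>C G (\<Sum>k<Suc n. cis (t * real k) *\<^sub>C a k)"
    proof -
      have "cis (t * real (Suc k)) = cis t * cis (t * real k)" for k
        by (simp add: cis_mult algebra_simps)
      thus ?thesis
        by (simp only: bounded_clinear_sum[OF G] bounded_clinear_scaleC[OF G] chilbert.scale_sum_right chilbert.scale_scale)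
    qed
    finally show ?thesis by (simp only: bounded_clinear_sum[OF F] bounded_clinear_scaleC[OF F])
  qed
  have "real (Suc n) * (\<Sum>k<Suc n. (norm (b k))\<^sup>2)
      = (\<Sum>c<Suc n. (norm (\<Sum>k<Suc n. cis (\<theta> c * real k) *\<^sub>C b k))\<^sup>2)"
    unfolding \<theta>_def by (rule discrete_parseval[symmetric])
  also have "\<dots> \<le> (\<Sum>c<Suc n. (norm (\<Sum>k<Suc n. cis (\<theta> c * real k) *\<^sub>C a k))\<^sup>2)"
    unfolding conv by (intro sum_mono power_mono symbol) simp_all
  also have "\<dots> = real (Suc n) * (\<Sum>k<Suc n. (norm (a k))\<^sup>2)"
    unfolding \<theta>_def by (rule discrete_parseval)
  finally have "(\<Sum>k<Suc n. (norm (b k))\<^sup>2) \<le> (\<Sum>k<Suc n. (norm (a k))\<^sup>2)"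
    by (subst (asm) mult_le_cancel_left_pos) simp_all
  thus ?thesis by (simp only: b_def)
qed

section \<open>Finitely supported sequences\<close>

definition seq_scale :: "complex \<Rightarrow> (nat \<Rightarrow>\<^sub>0 'a::chilbert_space) \<Rightarrow> (nat \<Rightarrow>\<^sub>0 'a)" where
  "seq_scale c x = Abs_poly_mapping (\<lambda>n. c *\<^sub>C Poly_Mapping.lookup x n)"

definition seq_ip :: "(nat \<Rightarrow>\<^sub>0 'a::chilbert_space) \<Rightarrow> (nat \<Rightarrow>\<^sub>0 'a) \<Rightarrow> complex" where
  "seq_ip x y = (\<Sum>n\<in>Poly_Mapping.keys x. cinner (Poly_Mapping.lookup x n) (Poly_Mapping.lookup y n))"

lemma finite_support_bound:
  obtains N where "\<And>n. N \<le> n \<Longrightarrow> Poly_Mapping.lookup (x :: nat \<Rightarrow>\<^sub>0 'a::zero) n = 0"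
proof -
  obtain N where "\<forall>n\<in>Poly_Mapping.keys x. n < N"
    using finite_nat_set_iff_bounded finite_keys by blast
  note N = this
  have "Poly_Mapping.lookup x n = 0" if "N \<le> n" for n
  proof (rule ccontr)
    assume "Poly_Mapping.lookup x n \<noteq> 0"
    hence "n \<in> Poly_Mapping.keys x" by (simp add: in_keys_iff)
    with N have "n < N" by (rule bspec)
    with that show False by simp
  qed
  thus thesis by (rule that)
qed

lemma lookup_Abs_bounded:
  assumes "\<And>n. N \<le> n \<Longrightarrow> f n = 0"
  shows "Poly_Mapping.lookup (Abs_poly_mapping f) = (f :: nat \<Rightarrow> 'a::zero)"
proof (rule lookup_Abs_poly_mapping)
  have "{n. f n \<noteq> 0} \<subseteq> {..<N}" using assms by (auto simp: not_less[symmetric])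
  thus "finite {n. f n \<noteq> 0}" by (rule finite_subset) simp
qed

lemma lookup_seq_scale [simp]: "Poly_Mapping.lookup (seq_scale c x) n = c *\<^sub>C Poly_Mapping.lookup x n"
proof -
  obtain N where "\<And>n. N \<le> n \<Longrightarrow> Poly_Mapping.lookup x n = 0" using finite_support_bound by blast
  hence "\<And>n. N \<le> n \<Longrightarrow> c *\<^sub>C Poly_Mapping.lookup x n = 0" by simp
  from lookup_Abs_bounded[OF this] show ?thesis by (simp add: seq_scale_def)
qed

lemma seq_ip_eq_sum:
  assumes "\<And>n. N \<le> n \<Longrightarrow> Poly_Mapping.lookup x n = 0"
  shows "seq_ip x y = (\<Sum>n<N. cinner (Poly_Mapping.lookup x n) (Poly_Mapping.lookup y n))"
  unfolding seq_ip_def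
proof (rule sum.mono_neutral_left)
  show "Poly_Mapping.keys x \<subseteq> {..<N}" using assms by (auto simp: in_keys_iff not_less[symmetric])
qed (auto simp: in_keys_iff)

interpretation fin_seq: hermitian_form "seq_scale :: complex \<Rightarrow> (nat \<Rightarrow>\<^sub>0 'a::chilbert_space) \<Rightarrow> _" seq_ip
proof
  fix a b :: complex and x y z :: "nat \<Rightarrow>\<^sub>0 'a"
  show "seq_scale a (x + y) = seq_scale a x + seq_scale a y"
    "seq_scale (a + b) x = seq_scale a x + seq_scale b x"
    "seq_scale a (seq_scale b x) = seq_scale (a * b) x" "seq_scale 1 x = x"
    by (auto intro!: poly_mapping_eqI simp: lookup_add chilbert.scale_right_distrib chilbert.scale_left_distrib)
  obtain N1 N2 where "\<And>n. N1 \<le> n \<Longrightarrow> Poly_Mapping.lookup x n = 0" "\<And>n. N2 \<le> n \<Longrightarrow> Poly_Mapping.lookup y n = 0"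
    using finite_support_bound[of x] finite_support_bound[of y] by metis
  hence N: "\<And>n. max N1 N2 \<le> n \<Longrightarrow> Poly_Mapping.lookup x n = 0" "\<And>n. max N1 N2 \<le> n \<Longrightarrow> Poly_Mapping.lookup y n = 0"
    by simp_all
  hence N': "\<And>n. max N1 N2 \<le> n \<Longrightarrow> Poly_Mapping.lookup (x + y) n = 0" by (simp add: lookup_add)
  show "seq_ip (x + y) z = seq_ip x z + seq_ip y z"
    by (simp only: seq_ip_eq_sum[OF N(1)] seq_ip_eq_sum[OF N(2)] seq_ip_eq_sum[OF N'] lookup_add
        chilbert.ip_add_left sum.distrib)
  have "\<And>n. max N1 N2 \<le> n \<Longrightarrow> Poly_Mapping.lookup (seq_scale a x) n = 0" using N(1) by simp
  from seq_ip_eq_sum[OF this] show "seq_ip (seq_scale a x) y = a * seq_ip x y"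
    by (simp only: seq_ip_eq_sum[OF N(1)] lookup_seq_scale chilbert.ip_sc_left sum_distrib_left)
  have "seq_ip x y = (\<Sum>n<max N1 N2. cinner (Poly_Mapping.lookup x n) (Poly_Mapping.lookup y n))"
    by (rule seq_ip_eq_sum[OF N(1)])
  also have "\<dots> = (\<Sum>n<max N1 N2. cnj (cinner (Poly_Mapping.lookup y n) (Poly_Mapping.lookup x n)))"
    by (rule sum.cong[OF refl]) (rule cinner_commute)
  also have "\<dots> = cnj (\<Sum>n<max N1 N2. cinner (Poly_Mapping.lookup y n) (Poly_Mapping.lookup x n))"
    by (rule cnj_sum[symmetric])
  also have "(\<Sum>n<max N1 N2. cinner (Poly_Mapping.lookup y n) (Poly_Mapping.lookup x n)) = seq_ip y x"
    by (rule seq_ip_eq_sum[OF N(2), symmetric])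
  finally show "seq_ip x y = cnj (seq_ip y x)" .
  have "seq_ip x x = (\<Sum>n<max N1 N2. cinner (Poly_Mapping.lookup x n) (Poly_Mapping.lookup x n))"
    by (rule seq_ip_eq_sum[OF N(1)])
  thus "0 \<le> Re (seq_ip x x)" by (simp add: sum_nonneg chilbert.ip_nonneg)
qed

lemma seq_norm_square:
  assumes "\<And>n. N \<le> n \<Longrightarrow> Poly_Mapping.lookup x n = 0"
  shows "(fin_seq.nrm x)\<^sup>2 = (\<Sum>n<N. (norm (Poly_Mapping.lookup x n))\<^sup>2)"
proof -
  have "complex_of_real ((fin_seq.nrm x)\<^sup>2) = seq_ip x x" by (rule fin_seq.ip_self[symmetric])
  also have "\<dots> = (\<Sum>n<N. cinner (Poly_Mapping.lookup x n) (Poly_Mapping.lookup x n))"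
    by (rule seq_ip_eq_sum[OF assms])
  also have "\<dots> = complex_of_real (\<Sum>n<N. (norm (Poly_Mapping.lookup x n))\<^sup>2)"
    by (simp add: chilbert.ip_self)
  finally show ?thesis by (simp only: of_real_eq_iff)
qed

lemma seq_norm_single: "fin_seq.nrm (Poly_Mapping.single k h) = norm h"
proof -
  have "(fin_seq.nrm (Poly_Mapping.single k h))\<^sup>2 = (\<Sum>n<Suc k. (norm (Poly_Mapping.lookup (Poly_Mapping.single k h) n))\<^sup>2)"
    by (rule seq_norm_square) (simp add: lookup_single)
  also have "\<dots> = (\<Sum>n<Suc k. if n = k then (norm h)\<^sup>2 else 0)"
    by (intro sum.cong refl) (simp add: lookup_single)
  also have "\<dots> = (norm h)\<^sup>2" by (simp add: sum.delta)
  finally show ?thesis by (simp add: power2_eq_iff_nonneg)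
qed

lemma norm_lookup_le: "norm (Poly_Mapping.lookup x k) \<le> fin_seq.nrm x"
proof -
  obtain N where N: "\<And>n. N \<le> n \<Longrightarrow> Poly_Mapping.lookup x n = 0" using finite_support_bound by blast
  show ?thesis
  proof (cases "k < N")
    case True
    have "(norm (Poly_Mapping.lookup x k))\<^sup>2 \<le> (\<Sum>n<N. (norm (Poly_Mapping.lookup x n))\<^sup>2)"
      by (rule member_le_sum) (use True in auto)
    also have "\<dots> = (fin_seq.nrm x)\<^sup>2" by (rule seq_norm_square[OF N, symmetric])
    finally show ?thesis by (rule power2_le_imp_le) simp
  qed (simp add: N)
qed

text \<open>The block operator on \<open>H \<oplus> H \<oplus> H \<oplus> \<dots>\<close> with first column \<open>(T, E, 0, \<dots>)\<close>,
  \<open>F\<close> on the remaining diagonal and \<open>G\<close> below it.\<close>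

definition block_entry :: "('a \<Rightarrow> 'a::chilbert_space) \<Rightarrow> ('a \<Rightarrow> 'a) \<Rightarrow> ('a \<Rightarrow> 'a) \<Rightarrow> ('a \<Rightarrow> 'a) \<Rightarrow> (nat \<Rightarrow> 'a) \<Rightarrow> nat \<Rightarrow> 'a" where
  "block_entry T E F G a n = (case n of 0 \<Rightarrow> T (a 0)
     | Suc m \<Rightarrow> F (a (Suc m)) + (case m of 0 \<Rightarrow> E (a 0) | Suc j \<Rightarrow> G (a m)))"

definition block_op :: "('a \<Rightarrow> 'a::chilbert_space) \<Rightarrow> ('a \<Rightarrow> 'a) \<Rightarrow> ('a \<Rightarrow> 'a) \<Rightarrow> ('a \<Rightarrow> 'a) \<Rightarrow> (nat \<Rightarrow>\<^sub>0 'a) \<Rightarrow> (nat \<Rightarrow>\<^sub>0 'a)" where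
  "block_op T E F G x = Abs_poly_mapping (block_entry T E F G (Poly_Mapping.lookup x))"

lemma block_entry_simps:
  "block_entry T E F G a 0 = T (a 0)"
  "block_entry T E F G a (Suc 0) = F (a (Suc 0)) + E (a 0)"
  "block_entry T E F G a (Suc (Suc m)) = F (a (Suc (Suc m))) + G (a (Suc m))"
  by (simp_all add: block_entry_def)

lemma nat_cases_012: "P 0 \<Longrightarrow> P (Suc 0) \<Longrightarrow> (\<And>m. P (Suc (Suc m))) \<Longrightarrow> P n"
  by (cases n; cases "n - 1") auto

lemma seq_eqI:
  assumes "Poly_Mapping.lookup x 0 = Poly_Mapping.lookup y 0"
    "Poly_Mapping.lookup x (Suc 0) = Poly_Mapping.lookup y (Suc 0)"
    "\<And>m. Poly_Mapping.lookup x (Suc (Suc m)) = Poly_Mapping.lookup y (Suc (Suc m))"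
  shows "x = y"
  by (rule poly_mapping_eqI, rule nat_cases_012[of "\<lambda>n. Poly_Mapping.lookup x n = Poly_Mapping.lookup y n"]) (rule assms)+

context
  fixes T E F G :: "'a::chilbert_space \<Rightarrow> 'a"
  assumes bT: "bounded_clinear T" and bE: "bounded_clinear E"
    and bF: "bounded_clinear F" and bG: "bounded_clinear G"
begin

lemma lookup_block_op: "Poly_Mapping.lookup (block_op T E F G x) = block_entry T E F G (Poly_Mapping.lookup x)"
proof -
  obtain N where N: "\<And>n. N \<le> n \<Longrightarrow> Poly_Mapping.lookup x n = 0" using finite_support_bound by blast
  have "block_entry T E F G (Poly_Mapping.lookup x) n = 0" if "Suc (Suc N) \<le> n" for n
  proof -
    define j where "j = n - 2"
    have n: "n = Suc (Suc j)" "N \<le> j" using that by (simp_all add: j_def)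
    thus ?thesis by (simp add: block_entry_simps N bounded_clinear_zero[OF bF] bounded_clinear_zero[OF bG])
  qed
  from lookup_Abs_bounded[OF this] show ?thesis by (simp add: block_op_def)
qed

lemma module_hom_block_op: "module_hom seq_scale seq_scale (block_op T E F G)"
proof -
  note simps = lookup_block_op lookup_add block_entry_simps chilbert.scale_right_distrib
    bounded_clinear_add[OF bT] bounded_clinear_add[OF bE] bounded_clinear_add[OF bF] bounded_clinear_add[OF bG]
    bounded_clinear_scaleC[OF bT] bounded_clinear_scaleC[OF bE] bounded_clinear_scaleC[OF bF] bounded_clinear_scaleC[OF bG]
  have "block_op T E F G (x + y) = block_op T E F G x + block_op T E F G y" for x y
    by (rule seq_eqI) (simp_all add: simps)
  moreover have "block_op T E F G (seq_scale c x) = seq_scale c (block_op T E F G x)" for c x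
    by (rule seq_eqI) (simp_all add: simps)
  ultimately show ?thesis
    by (simp add: module_hom_def module_hom_axioms_def fin_seq.module_axioms)
qed

lemma block_op_single: "block_op T E F G (Poly_Mapping.single 0 h) = Poly_Mapping.single 0 (T h) + Poly_Mapping.single 1 (E h)"
  by (rule seq_eqI)
    (simp_all add: lookup_block_op block_entry_simps lookup_add lookup_single
      bounded_clinear_zero[OF bF] bounded_clinear_zero[OF bG])

context
  assumes T_norm: "\<And>x. norm (T x) \<le> norm x"
    and symbol: "\<And>z x. cmod z = 1 \<Longrightarrow> norm (F x + z *\<^sub>C G x) \<le> norm x"
begin

text \<open>Sequences that start with 0 never meet T or E; on them the operator is Toeplitz with
  symbol F + z G.\<close>

lemma block_op_tail:
  assumes "Poly_Mapping.lookup y 0 = 0"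
  shows "Poly_Mapping.lookup (block_op T E F G y) 0 = 0" "fin_seq.nrm (block_op T E F G y) \<le> fin_seq.nrm y"
proof -
  let ?V = "block_op T E F G"
  show V0: "Poly_Mapping.lookup (?V y) 0 = 0"
    by (simp add: lookup_block_op block_entry_simps assms bounded_clinear_zero[OF bT])
  obtain N where N: "\<And>n. N \<le> n \<Longrightarrow> Poly_Mapping.lookup y n = 0" using finite_support_bound by blast
  define a where "a k = Poly_Mapping.lookup y (Suc k)" for k
  have a0: "a k = 0" if "k \<ge> N" for k using that by (simp add: a_def N)
  have entry: "Poly_Mapping.lookup (?V y) (Suc k) = F (a k) + (case k of 0 \<Rightarrow> 0 | Suc j \<Rightarrow> G (a j))" for k
    by (cases k) (simp_all add: a_def lookup_block_op block_entry_simps assms bounded_clinear_zero[OF bE])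
  have "(fin_seq.nrm (?V y))\<^sup>2 = (\<Sum>n<Suc (Suc N). (norm (Poly_Mapping.lookup (?V y) n))\<^sup>2)"
  proof (rule seq_norm_square)
    fix n assume n: "Suc (Suc N) \<le> n"
    define j where "j = n - 2"
    have "n = Suc (Suc j)" "N \<le> j" using n by (simp_all add: j_def)
    thus "Poly_Mapping.lookup (?V y) n = 0"
      by (simp add: entry a0 bounded_clinear_zero[OF bF] bounded_clinear_zero[OF bG])
  qed
  also have "\<dots> = (\<Sum>k<Suc N. (norm (F (a k) + (case k of 0 \<Rightarrow> 0 | Suc j \<Rightarrow> G (a j))))\<^sup>2)"
    by (subst sum.lessThan_Suc_shift) (simp only: V0 entry norm_zero power_zero_numeral add_0)
  also have "\<dots> \<le> (\<Sum>k<Suc N. (norm (a k))\<^sup>2)"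
    by (rule toeplitz_contraction[OF bF bG symbol a0])
  also have "\<dots> = (\<Sum>n<Suc (Suc N). (norm (Poly_Mapping.lookup y n))\<^sup>2)"
    by (subst (2) sum.lessThan_Suc_shift) (simp only: assms a_def norm_zero power_zero_numeral add_0)
  also have "\<dots> = (fin_seq.nrm y)\<^sup>2"
    by (rule seq_norm_square[symmetric]) (simp add: N)
  finally show "fin_seq.nrm (?V y) \<le> fin_seq.nrm y" by (rule power2_le_imp_le) simp
qed

text \<open>Each step sends a vector of norm at most K \<parallel>h\<parallel> from the first entry
  into the tail, where norms no longer grow, so n steps accumulate at most n such
  contributions.\<close>

lemma block_op_linear_growth: "\<exists>C. \<forall>n. fin_seq.nrm ((block_op T E F G ^^ n) x) \<le> C * real (n + 1)"
proof -
  let ?V = "block_op T E F G"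
  have hom: "module_hom seq_scale seq_scale (?V ^^ n)" for n
    by (intro module_hom_funpow module_hom_block_op)
  have tail: "fin_seq.nrm ((?V ^^ n) y) \<le> fin_seq.nrm y" if "Poly_Mapping.lookup y 0 = 0" for y n
    using that
  proof (induction n arbitrary: y)
    case (Suc n)
    have "(?V ^^ Suc n) y = (?V ^^ n) (?V y)" by (simp add: funpow_swap1)
    thus ?case using Suc.IH[OF block_op_tail(1)[OF Suc.prems]] block_op_tail(2)[OF Suc.prems] by simp
  qed simp
  obtain K where K: "K \<ge> 0" "\<And>x. norm (E x) \<le> K * norm x" using bounded_clinear_bound[OF bE] by blast
  have head: "fin_seq.nrm ((?V ^^ n) (Poly_Mapping.single 0 h)) \<le> (1 + real n * K) * norm h" for n h
  proof (induction n arbitrary: h)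
    case (Suc n)
    have split: "(?V ^^ Suc n) (Poly_Mapping.single 0 h)
        = (?V ^^ n) (Poly_Mapping.single 0 (T h)) + (?V ^^ n) (Poly_Mapping.single 1 (E h))"
      unfolding funpow_Suc_right comp_apply block_op_single by (rule module_hom.add[OF hom])
    have "fin_seq.nrm ((?V ^^ Suc n) (Poly_Mapping.single 0 h))
        \<le> fin_seq.nrm ((?V ^^ n) (Poly_Mapping.single 0 (T h)))
        + fin_seq.nrm ((?V ^^ n) (Poly_Mapping.single 1 (E h)))"
      unfolding split by (rule fin_seq.nrm_triangle)
    also have "\<dots> \<le> (1 + real n * K) * norm (T h) + fin_seq.nrm (Poly_Mapping.single 1 (E h))"
      by (rule add_mono[OF Suc tail]) (simp add: lookup_single)
    also have "\<dots> \<le> (1 + real n * K) * norm h + K * norm h"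
      by (rule add_mono[OF mult_left_mono[OF T_norm]]) (simp_all add: seq_norm_single K)
    finally show ?case by (simp add: algebra_simps)
  qed (simp add: seq_norm_single)
  define h where "h = Poly_Mapping.lookup x 0"
  define y where "y = x - Poly_Mapping.single 0 h"
  have y0: "Poly_Mapping.lookup y 0 = 0" by (simp add: y_def h_def lookup_minus)
  have x: "x = Poly_Mapping.single 0 h + y" by (simp add: y_def)
  have "fin_seq.nrm ((?V ^^ n) x) \<le> ((1 + K) * norm h + fin_seq.nrm y) * real (n + 1)" for n
  proof -
    have "(?V ^^ n) x = (?V ^^ n) (Poly_Mapping.single 0 h) + (?V ^^ n) y"
      by (subst x) (rule module_hom.add[OF hom])
    hence "fin_seq.nrm ((?V ^^ n) x) \<le> fin_seq.nrm ((?V ^^ n) (Poly_Mapping.single 0 h)) + fin_seq.nrm ((?V ^^ n) y)"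
      by (simp only: fin_seq.nrm_triangle)
    also have "\<dots> \<le> (1 + real n * K) * norm h + fin_seq.nrm y"
      by (rule add_mono[OF head tail[OF y0]])
    also have "\<dots> \<le> ((1 + K) * real (n + 1)) * norm h + fin_seq.nrm y * real (n + 1)"
    proof (intro add_mono mult_right_mono)
      have "fin_seq.nrm y * 1 \<le> fin_seq.nrm y * real (n + 1)" by (intro mult_left_mono) simp_all
      thus "fin_seq.nrm y \<le> fin_seq.nrm y * real (n + 1)" by simp
    qed (use K in \<open>simp_all add: algebra_simps\<close>)
    finally show ?thesis by (simp add: algebra_simps)
  qed
  thus ?thesis by blast
qed

end

end

section \<open>The isometric dilation\<close>

text \<open>\<open>F1\<close>, \<open>F2\<close> are the fundamental operators, extended by \<open>0\<close> from the defect space of \<open>T3\<close> to the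
  whole space; \<open>D\<close> is the defect operator of \<open>T3\<close>.\<close>

locale tetrablock_dilation =
  fixes T1 T2 T3 D F1 F2 G1 G2 :: "'a::chilbert_space \<Rightarrow> 'a"
  assumes bcl: "bounded_clinear T1" "bounded_clinear T2" "bounded_clinear T3" "bounded_clinear D"
      "bounded_clinear F1" "bounded_clinear F2" "bounded_clinear G1" "bounded_clinear G2"
    and F1_adj: "cinner (F1 x) y = cinner x (G1 y)"
    and F2_adj: "cinner (F2 x) y = cinner x (G2 y)"
    and T2_norm: "norm (T2 x) \<le> norm x"
    and T12: "T1 (T2 x) = T2 (T1 x)" and T13: "T1 (T3 x) = T3 (T1 x)" and T23: "T2 (T3 x) = T3 (T2 x)"
    and D_adj: "cinner (D x) y = cinner x (D y)"
    and D_square: "cinner (T3 x) (T3 y) + cinner (D x) (D y) = cinner x y"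
    and fundamental1: "cinner (T1 x) y - cinner (T3 x) (T2 y) = cinner (F1 (D x)) (D y)"
    and fundamental2: "cinner (T2 x) y - cinner (T3 x) (T1 y) = cinner (F2 (D x)) (D y)"
    and D_T1: "D (T1 x) = F1 (D x) + G2 (D (T3 x))"
    and D_T2: "D (T2 x) = F2 (D x) + G1 (D (T3 x))"
    and F12: "F1 (F2 x) = F2 (F1 x)"
    and G12: "G1 (G2 x) = G2 (G1 x)"
    and FG: "F1 (G1 x) + G2 (F2 x) = F2 (G2 x) + G1 (F1 x)"
    and symbol: "cmod z = 1 \<Longrightarrow> norm (F2 x + z *\<^sub>C G1 x) \<le> norm x"
begin

definition V1 :: "(nat \<Rightarrow>\<^sub>0 'a) \<Rightarrow> (nat \<Rightarrow>\<^sub>0 'a)" where "V1 = block_op T1 (\<lambda>x. G2 (D x)) F1 G2"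
definition V2 :: "(nat \<Rightarrow>\<^sub>0 'a) \<Rightarrow> (nat \<Rightarrow>\<^sub>0 'a)" where "V2 = block_op T2 (\<lambda>x. G1 (D x)) F2 G1"
definition V3 :: "(nat \<Rightarrow>\<^sub>0 'a) \<Rightarrow> (nat \<Rightarrow>\<^sub>0 'a)" where "V3 = block_op T3 D (\<lambda>x. 0) (\<lambda>x. x)"

lemmas bcl_E1 = bounded_clinear_compose[OF bcl(8) bcl(4)]
lemmas bcl_E2 = bounded_clinear_compose[OF bcl(7) bcl(4)]

lemmas lookup_V =
  lookup_block_op[OF bcl(1) bcl_E1 bcl(5) bcl(8), folded V1_def]
  lookup_block_op[OF bcl(2) bcl_E2 bcl(6) bcl(7), folded V2_def]
  lookup_block_op[OF bcl(3) bcl(4) bounded_clinear_zero_op bounded_clinear_id, folded V3_def]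

lemma lookup_V1:
  "Poly_Mapping.lookup (V1 x) 0 = T1 (Poly_Mapping.lookup x 0)"
  "Poly_Mapping.lookup (V1 x) (Suc 0) = F1 (Poly_Mapping.lookup x (Suc 0)) + G2 (D (Poly_Mapping.lookup x 0))"
  "Poly_Mapping.lookup (V1 x) (Suc (Suc m)) = F1 (Poly_Mapping.lookup x (Suc (Suc m))) + G2 (Poly_Mapping.lookup x (Suc m))"
  by (simp_all add: lookup_V block_entry_simps)

lemma lookup_V2:
  "Poly_Mapping.lookup (V2 x) 0 = T2 (Poly_Mapping.lookup x 0)"
  "Poly_Mapping.lookup (V2 x) (Suc 0) = F2 (Poly_Mapping.lookup x (Suc 0)) + G1 (D (Poly_Mapping.lookup x 0))"
  "Poly_Mapping.lookup (V2 x) (Suc (Suc m)) = F2 (Poly_Mapping.lookup x (Suc (Suc m))) + G1 (Poly_Mapping.lookup x (Suc m))"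
  by (simp_all add: lookup_V block_entry_simps)

lemma lookup_V3:
  "Poly_Mapping.lookup (V3 x) 0 = T3 (Poly_Mapping.lookup x 0)"
  "Poly_Mapping.lookup (V3 x) (Suc 0) = D (Poly_Mapping.lookup x 0)"
  "Poly_Mapping.lookup (V3 x) (Suc (Suc m)) = Poly_Mapping.lookup x (Suc m)"
  by (simp_all add: lookup_V block_entry_simps)

section \<open>Commutation of the block operators\<close>

lemmas lin = bcl(5-8)[THEN bounded_clinear_add]

text \<open>The three diagonals of the Toeplitz products agree by \<open>F12\<close>,
  \<open>FG\<close> and \<open>G12\<close>. In the first column, \<open>D_T1\<close> and
  \<open>D_T2\<close> first move D past T1 and T2, and then the same relations apply.\<close>

lemma V12: "V1 (V2 x) = V2 (V1 x)"
proof (rule seq_eqI)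
  define a where "a = Poly_Mapping.lookup x"
  have FG': "F1 (G1 x) = F2 (G2 x) + G1 (F1 x) - G2 (F2 x)" for x
    using FG[of x] by (simp add: eq_diff_eq)
  show "Poly_Mapping.lookup (V1 (V2 x)) 0 = Poly_Mapping.lookup (V2 (V1 x)) 0"
    by (simp add: lookup_V1 lookup_V2 T12)
  show "Poly_Mapping.lookup (V1 (V2 x)) (Suc 0) = Poly_Mapping.lookup (V2 (V1 x)) (Suc 0)"
    by (simp add: lookup_V1 lookup_V2 lin D_T1 D_T2 F12 G12 FG')
  fix m
  show "Poly_Mapping.lookup (V1 (V2 x)) (Suc (Suc m)) = Poly_Mapping.lookup (V2 (V1 x)) (Suc (Suc m))"
    by (cases m) (simp_all add: lookup_V1 lookup_V2 lin F12 G12 FG')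
qed

lemma V13: "V1 (V3 x) = V3 (V1 x)"
proof (rule seq_eqI)
  fix m
  show "Poly_Mapping.lookup (V1 (V3 x)) (Suc (Suc m)) = Poly_Mapping.lookup (V3 (V1 x)) (Suc (Suc m))"
    by (cases m) (simp_all add: lookup_V1 lookup_V3)
qed (simp_all add: lookup_V1 lookup_V3 T13 D_T1)

lemma V23: "V2 (V3 x) = V3 (V2 x)"
proof (rule seq_eqI)
  fix m
  show "Poly_Mapping.lookup (V2 (V3 x)) (Suc (Suc m)) = Poly_Mapping.lookup (V3 (V2 x)) (Suc (Suc m))"
    by (cases m) (simp_all add: lookup_V2 lookup_V3)
qed (simp_all add: lookup_V2 lookup_V3 T23 D_T2)

section \<open>Adjoint relations of the block operators\<close>

lemma seq_ip_split:
  assumes "\<And>n. N \<le> n \<Longrightarrow> Poly_Mapping.lookup x n = 0 \<or> Poly_Mapping.lookup y n = 0"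
  shows "seq_ip x y = cinner (Poly_Mapping.lookup x 0) (Poly_Mapping.lookup y 0)
    + cinner (Poly_Mapping.lookup x (Suc 0)) (Poly_Mapping.lookup y (Suc 0))
    + (\<Sum>m<N. cinner (Poly_Mapping.lookup x (Suc (Suc m))) (Poly_Mapping.lookup y (Suc (Suc m))))"
proof -
  obtain M where M: "\<And>n. M \<le> n \<Longrightarrow> Poly_Mapping.lookup x n = 0" using finite_support_bound by blast
  let ?f = "\<lambda>n. cinner (Poly_Mapping.lookup x n) (Poly_Mapping.lookup y n)"
  have "seq_ip x y = (\<Sum>n<Suc (Suc (max M N)). ?f n)"
    by (rule seq_ip_eq_sum) (simp add: M)
  also have "\<dots> = (\<Sum>n<Suc (Suc N). ?f n)"
  proof (rule sum.mono_neutral_right)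
    show "\<forall>n\<in>{..<Suc (Suc (max M N))} - {..<Suc (Suc N)}. ?f n = 0"
    proof
      fix n assume "n \<in> {..<Suc (Suc (max M N))} - {..<Suc (Suc N)}"
      hence "N \<le> n" by simp
      from assms[OF this] show "?f n = 0" by auto
    qed
  qed auto
  also have "\<dots> = ?f 0 + (\<Sum>n<Suc N. ?f (Suc n))" by (rule sum.lessThan_Suc_shift)
  also have "(\<Sum>n<Suc N. ?f (Suc n)) = ?f (Suc 0) + (\<Sum>n<N. ?f (Suc (Suc n)))" by (rule sum.lessThan_Suc_shift)
  finally show ?thesis by (simp only: add.assoc)
qed

lemma common_bound:
  obtains N where "\<And>n. N \<le> n \<Longrightarrow> Poly_Mapping.lookup (x :: nat \<Rightarrow>\<^sub>0 'a) n = 0"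
    "\<And>n. N \<le> n \<Longrightarrow> Poly_Mapping.lookup (y :: nat \<Rightarrow>\<^sub>0 'a) n = 0"
proof -
  obtain N1 where "\<And>n. N1 \<le> n \<Longrightarrow> Poly_Mapping.lookup x n = 0" using finite_support_bound by blast
  moreover obtain N2 where "\<And>n. N2 \<le> n \<Longrightarrow> Poly_Mapping.lookup y n = 0" using finite_support_bound by blast
  ultimately show thesis using that[of "max N1 N2"] by simp
qed

lemma sum_shift:
  assumes "f N = (0::complex)"
  shows "(\<Sum>m<N. f m) = f 0 + (\<Sum>m<N. f (Suc m))"
proof -
  have "(\<Sum>m<N. f m) = (\<Sum>m<Suc N. f m)" by (simp add: assms)
  also have "\<dots> = f 0 + (\<Sum>m<N. f (Suc m))" by (rule sum.lessThan_Suc_shift)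
  finally show ?thesis .
qed

lemma V3_isometry: "seq_ip (V3 x) (V3 y) = seq_ip x y"
proof -
  obtain N where N: "\<And>n. N \<le> n \<Longrightarrow> Poly_Mapping.lookup x n = 0" "\<And>n. N \<le> n \<Longrightarrow> Poly_Mapping.lookup y n = 0"
    using common_bound[of x y] by blast
  let ?f = "\<lambda>m. cinner (Poly_Mapping.lookup x (Suc m)) (Poly_Mapping.lookup y (Suc m))"
  have "seq_ip (V3 x) (V3 y) = cinner (Poly_Mapping.lookup x 0) (Poly_Mapping.lookup y 0) + (\<Sum>m<Suc N. ?f m)"
  proof (subst seq_ip_split[of "Suc (Suc N)"])
    fix n assume "Suc (Suc N) \<le> n"
    define j where "j = n - 2"
    have "n = Suc (Suc j)" "N \<le> Suc j" using \<open>Suc (Suc N) \<le> n\<close> by (simp_all add: j_def)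
    thus "Poly_Mapping.lookup (V3 x) n = 0 \<or> Poly_Mapping.lookup (V3 y) n = 0" by (simp add: lookup_V3 N)
  next
    show "cinner (Poly_Mapping.lookup (V3 x) 0) (Poly_Mapping.lookup (V3 y) 0)
        + cinner (Poly_Mapping.lookup (V3 x) (Suc 0)) (Poly_Mapping.lookup (V3 y) (Suc 0))
        + (\<Sum>m<Suc (Suc N). cinner (Poly_Mapping.lookup (V3 x) (Suc (Suc m))) (Poly_Mapping.lookup (V3 y) (Suc (Suc m))))
      = cinner (Poly_Mapping.lookup x 0) (Poly_Mapping.lookup y 0) + (\<Sum>m<Suc N. ?f m)"
      by (simp add: lookup_V3 D_square N)
  qed
  also have "(\<Sum>m<Suc N. ?f m) = ?f 0 + (\<Sum>m<N. ?f (Suc m))" by (rule sum.lessThan_Suc_shift)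
  also have "cinner (Poly_Mapping.lookup x 0) (Poly_Mapping.lookup y 0) + \<dots> = seq_ip x y"
    by (subst seq_ip_split[of N]) (simp_all add: N)
  finally show ?thesis .
qed

text \<open>V3 shifts by one entry, so V^* V3 has the adjoint F' of G' on the diagonal and the
  adjoint G of F below it, which is the pattern of V'. Only the corner mixes T, T3 and D; there the
  assumption \<open>T\<close> is a fundamental equation. V1 and V2 exchange roles in the two
  applications.\<close>

lemma V_adj_general:
  assumes F: "\<And>u v. cinner (F u) v = cinner u (G v)" and F': "\<And>u v. cinner (F' u) v = cinner u (G' v)"
    and T: "\<And>x y. cinner (T x) (T3 y) + cinner (G' (D x)) (D y) = cinner x (T' y)"
    and V: "\<And>x. Poly_Mapping.lookup (V x) 0 = T (Poly_Mapping.lookup x 0)"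
      "\<And>x. Poly_Mapping.lookup (V x) (Suc 0) = F (Poly_Mapping.lookup x (Suc 0)) + G' (D (Poly_Mapping.lookup x 0))"
      "\<And>x m. Poly_Mapping.lookup (V x) (Suc (Suc m)) = F (Poly_Mapping.lookup x (Suc (Suc m))) + G' (Poly_Mapping.lookup x (Suc m))"
    and V': "\<And>x. Poly_Mapping.lookup (V' x) 0 = T' (Poly_Mapping.lookup x 0)"
      "\<And>x. Poly_Mapping.lookup (V' x) (Suc 0) = F' (Poly_Mapping.lookup x (Suc 0)) + G (D (Poly_Mapping.lookup x 0))"
      "\<And>x m. Poly_Mapping.lookup (V' x) (Suc (Suc m)) = F' (Poly_Mapping.lookup x (Suc (Suc m))) + G (Poly_Mapping.lookup x (Suc m))"
  shows "seq_ip (V x) (V3 y) = seq_ip x (V' y)"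
proof -
  obtain N0 where N0: "\<And>n. N0 \<le> n \<Longrightarrow> Poly_Mapping.lookup x n = 0" "\<And>n. N0 \<le> n \<Longrightarrow> Poly_Mapping.lookup y n = 0"
    using common_bound[of x y] by blast
  define N where "N = Suc N0"
  have N: "Poly_Mapping.lookup x n = 0" "Poly_Mapping.lookup y n = 0" if "N \<le> n" for n
    using that by (simp_all add: N0 N_def)
  have F'_adj: "cinner (G' u) v = cinner u (F' v)" for u v
    by (subst (1 2) cinner_commute) (simp only: F')
  let ?x = "Poly_Mapping.lookup x" and ?y = "Poly_Mapping.lookup y"
  let ?f = "\<lambda>m. cinner (?x (Suc m)) (F' (?y (Suc m)))"
  let ?g = "\<lambda>m. cinner (?x (Suc (Suc m))) (G (?y (Suc m)))"
  have "seq_ip (V x) (V3 y) = cinner (?x 0) (T' (?y 0)) + cinner (?x (Suc 0)) (G (D (?y 0)))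
      + ((\<Sum>m<N. ?g m) + (\<Sum>m<N. ?f m))"
  proof (subst seq_ip_split[of "N"])
    show "Poly_Mapping.lookup (V x) n = 0 \<or> Poly_Mapping.lookup (V3 y) n = 0" if "N \<le> n" for n
    proof -
      define j where "j = n - 1"
      have j: "n = Suc j" "N0 \<le> j" using that by (simp_all add: N_def j_def)
      have "Poly_Mapping.lookup (V3 y) (Suc j) = 0"
        using j(2) by (cases j) (simp_all add: lookup_V3 N0 bounded_clinear_zero[OF bcl(4)])
      thus ?thesis by (simp add: j(1))
    qed
    show "cinner (Poly_Mapping.lookup (V x) 0) (Poly_Mapping.lookup (V3 y) 0)
        + cinner (Poly_Mapping.lookup (V x) (Suc 0)) (Poly_Mapping.lookup (V3 y) (Suc 0))
        + (\<Sum>m<N. cinner (Poly_Mapping.lookup (V x) (Suc (Suc m))) (Poly_Mapping.lookup (V3 y) (Suc (Suc m))))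
      = cinner (?x 0) (T' (?y 0)) + cinner (?x (Suc 0)) (G (D (?y 0))) + ((\<Sum>m<N. ?g m) + (\<Sum>m<N. ?f m))"
      by (simp add: V lookup_V3 chilbert.ip_add_left F F'_adj sum.distrib flip: T)
  qed
  also have "(\<Sum>m<N. ?f m) = ?f 0 + (\<Sum>m<N. ?f (Suc m))"
    by (rule sum_shift) (simp add: N)
  also have "cinner (?x 0) (T' (?y 0)) + cinner (?x (Suc 0)) (G (D (?y 0))) + ((\<Sum>m<N. ?g m) + \<dots>) = seq_ip x (V' y)"
    by (subst seq_ip_split[of N]) (simp_all add: N V' chilbert.ip_add_right sum.distrib algebra_simps)
  finally show ?thesis .
qed

lemma V1_adj: "seq_ip (V1 x) (V3 y) = seq_ip x (V2 y)"
proof (rule V_adj_general)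
  fix x y
  have "cinner (G2 (D x)) (D y) = cinner (D x) (F2 (D y))"
    by (subst (1 2) cinner_commute) (simp only: F2_adj)
  also have "\<dots> = cnj (cinner (F2 (D y)) (D x))" by (rule cinner_commute)
  also have "\<dots> = cnj (cinner (T2 y) x) - cnj (cinner (T3 y) (T1 x))"
    by (simp only: fundamental2[symmetric] complex_cnj_diff)
  also have "\<dots> = cinner x (T2 y) - cinner (T1 x) (T3 y)" by (simp only: cinner_commute[symmetric])
  finally show "cinner (T1 x) (T3 y) + cinner (G2 (D x)) (D y) = cinner x (T2 y)" by simp
qed (rule F1_adj F2_adj lookup_V1 lookup_V2)+

lemma V2_adj: "seq_ip (V2 x) (V3 y) = seq_ip x (V1 y)"
proof (rule V_adj_general)
  fix x y
  have "cinner (G1 (D x)) (D y) = cinner (D x) (F1 (D y))"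
    by (subst (1 2) cinner_commute) (simp only: F1_adj)
  also have "\<dots> = cnj (cinner (F1 (D y)) (D x))" by (rule cinner_commute)
  also have "\<dots> = cnj (cinner (T1 y) x) - cnj (cinner (T3 y) (T2 x))"
    by (simp only: fundamental1[symmetric] complex_cnj_diff)
  also have "\<dots> = cinner x (T1 y) - cinner (T2 x) (T3 y)" by (simp only: cinner_commute[symmetric])
  finally show "cinner (T2 x) (T3 y) + cinner (G1 (D x)) (D y) = cinner x (T1 y)" by simp
qed (rule F1_adj F2_adj lookup_V1 lookup_V2)+

sublocale isometry_form: tetrablock_isometry_form seq_scale seq_ip V1 V2 V3
proof (rule tetrablock_isometry_form.intro[OF fin_seq.hermitian_form_axioms tetrablock_isometry_form_axioms.intro])
  show "module_hom seq_scale seq_scale V1" unfolding V1_def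
    by (rule module_hom_block_op[OF bcl(1) bcl_E1 bcl(5) bcl(8)])
  show "module_hom seq_scale seq_scale V2" unfolding V2_def
    by (rule module_hom_block_op[OF bcl(2) bcl_E2 bcl(6) bcl(7)])
  show "module_hom seq_scale seq_scale V3" unfolding V3_def
    by (rule module_hom_block_op[OF bcl(3) bcl(4) bounded_clinear_zero_op bounded_clinear_id])
qed (rule V12 V13 V23 V3_isometry V1_adj V2_adj)+

sublocale isometry: tetrablock_isometry seq_scale seq_ip V1 V2 V3
proof
  fix x
  from block_op_linear_growth[OF bcl(2) bcl_E2 bcl(6) bcl(7) T2_norm symbol, folded V2_def, of x]
  obtain C where "\<And>n. fin_seq.nrm ((V2 ^^ n) x) \<le> C * real (n + 1)" by blast
  thus "fin_seq.nrm (V2 x) \<le> fin_seq.nrm x" by (rule isometry_form.V2_contractive_if_linear_growth)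
qed

text \<open>The first entry of the image depends only on the first entry of x, so compression to
  that entry respects products.\<close>

lemma lookup_funpow:
  "Poly_Mapping.lookup ((V1 ^^ i) x) 0 = (T1 ^^ i) (Poly_Mapping.lookup x 0)"
  "Poly_Mapping.lookup ((V2 ^^ i) x) 0 = (T2 ^^ i) (Poly_Mapping.lookup x 0)"
  "Poly_Mapping.lookup ((V3 ^^ i) x) 0 = (T3 ^^ i) (Poly_Mapping.lookup x 0)"
  by (induction i) (simp_all add: lookup_V1 lookup_V2 lookup_V3)

lemma lookup_opl:
  "Poly_Mapping.lookup (isometry_form.opl ts x) 0
    = (\<Sum>(c, i, j, k)\<leftarrow>ts. c *\<^sub>C (T1 ^^ i) ((T2 ^^ j) ((T3 ^^ k) (Poly_Mapping.lookup x 0))))"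
  by (induction ts) (auto simp: isometry_form.opl_Nil isometry_form.opl_Cons isometry_form.mon_def lookup_add lookup_funpow)

theorem compression_von_neumann:
  assumes "\<And>x u. cmod x \<le> 1 \<Longrightarrow> cmod u = 1 \<Longrightarrow> cmod (terms_eval ts (cnj x * u) x u) \<le> M"
  shows "norm (\<Sum>(c, i, j, k)\<leftarrow>ts. c *\<^sub>C (T1 ^^ i) ((T2 ^^ j) ((T3 ^^ k) h))) \<le> M * norm h"
proof -
  let ?x = "Poly_Mapping.single 0 h :: nat \<Rightarrow>\<^sub>0 'a"
  have "norm (Poly_Mapping.lookup (isometry_form.opl ts ?x) 0) \<le> fin_seq.nrm (isometry_form.opl ts ?x)"
    by (rule norm_lookup_le)
  also have "\<dots> \<le> M * fin_seq.nrm ?x" by (rule isometry.von_neumann_inequality) (rule assms)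
  finally show ?thesis by (simp add: lookup_opl seq_norm_single)
qed

text \<open>\<open>nrm_pencil\<close> at \<open>single 0 x\<close> is too weak, because 1 - w V2
  adds a second entry to x - w T2 x. The right vector has first entry x and is mapped by 1 - w V2 to
  \<open>single 0 h\<close>. Its Neumann series may have infinite support, so the partial sums
  \<open>s N\<close> are used; their first entries x - q N tend to x and the remainders p N tend to
  0.\<close>

lemma compression_pencil:
  assumes w: "cmod w < 1"
  shows "norm (T1 x - w *\<^sub>C T3 x) \<le> norm (x - w *\<^sub>C T2 x)"
proof -
  define h where "h = x - w *\<^sub>C T2 x"
  define \<iota> where "\<iota> = (Poly_Mapping.single 0 h :: nat \<Rightarrow>\<^sub>0 'a)"
  define p where "p k = seq_scale (w ^ k) ((V2 ^^ k) \<iota>)" for k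
  define q where "q k = w ^ k *\<^sub>C (T2 ^^ k) x" for k
  have V2_p: "seq_scale w (V2 (p k)) = p (Suc k)" for k
    by (simp add: p_def isometry_form.hom_sc mult.commute)
  have nrm_V2_funpow: "fin_seq.nrm ((V2 ^^ k) y) \<le> fin_seq.nrm y" for k y
    by (induction k) (auto intro: order_trans[OF isometry.V2_contractive])
  have head_p: "Poly_Mapping.lookup (p k) 0 = q k - q (Suc k)" for k
  proof -
    note lin = bounded_clinear_funpow[OF bcl(2), of k]
    have "(T2 ^^ k) h = (T2 ^^ k) x - w *\<^sub>C (T2 ^^ Suc k) x"
      unfolding h_def bounded_clinear_diff[OF lin] bounded_clinear_scaleC[OF lin] funpow_Suc_right comp_apply ..
    thus ?thesis
      by (simp add: p_def q_def \<iota>_def lookup_funpow chilbert.scale_right_diff_distrib mult.commute)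
  qed
  define s where "s N = (\<Sum>k<N. p k)" for N
  have s_step: "s N - seq_scale w (V2 (s N)) = \<iota> - p N" for N
  proof (induction N)
    case 0
    have "V2 0 = 0" by (rule module_hom.zero[OF isometry_form.hom(2)])
    moreover have "p 0 = \<iota>" by (simp add: p_def)
    ultimately show ?case by (simp add: s_def)
  next
    case (Suc N)
    have "s (Suc N) - seq_scale w (V2 (s (Suc N)))
        = (s N - seq_scale w (V2 (s N))) + (p N - seq_scale w (V2 (p N)))"
      by (simp add: s_def isometry_form.hom_add fin_seq.scale_right_distrib)
    thus ?case by (simp add: Suc V2_p)
  qed
  have head_s: "Poly_Mapping.lookup (s N) 0 = x - q N" for N
    by (induction N) (simp_all add: s_def lookup_add head_p, simp add: q_def)
  have le: "norm (T1 (x - q N) - w *\<^sub>C T3 (x - q N)) \<le> norm h + cmod w ^ N * norm h" for N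
  proof -
    have "norm (T1 (x - q N) - w *\<^sub>C T3 (x - q N)) = norm (Poly_Mapping.lookup (V1 (s N) - seq_scale w (V3 (s N))) 0)"
      by (simp add: lookup_minus lookup_V1 lookup_V3 head_s)
    also have "\<dots> \<le> fin_seq.nrm (V1 (s N) - seq_scale w (V3 (s N)))" by (rule norm_lookup_le)
    also have "\<dots> \<le> fin_seq.nrm (s N - seq_scale w (V2 (s N)))"
      using w by (intro isometry.nrm_pencil) simp
    also have "s N - seq_scale w (V2 (s N)) = \<iota> + seq_scale (- 1) (p N)"
      by (simp add: s_step fin_seq.scale_minus_left)
    also have "fin_seq.nrm (\<iota> + seq_scale (- 1) (p N)) \<le> fin_seq.nrm \<iota> + fin_seq.nrm (seq_scale (- 1) (p N))"
      by (rule fin_seq.nrm_triangle)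
    also have "\<dots> = fin_seq.nrm \<iota> + cmod w ^ N * fin_seq.nrm ((V2 ^^ N) \<iota>)"
      by (simp add: fin_seq.nrm_sc p_def norm_power norm_mult del: fin_seq.scale_minus_left)
    also have "\<dots> \<le> fin_seq.nrm \<iota> + cmod w ^ N * fin_seq.nrm \<iota>"
      by (intro add_left_mono mult_left_mono nrm_V2_funpow) simp
    finally show ?thesis by (simp add: \<iota>_def seq_norm_single)
  qed
  have w0: "(\<lambda>N. cmod w ^ N) \<longlonglongrightarrow> 0" using w by (intro LIMSEQ_power_zero) simp
  have norm_T2_funpow: "norm ((T2 ^^ k) x) \<le> norm x" for k
    by (induction k) (auto intro: order_trans[OF T2_norm])
  have q0: "q \<longlonglongrightarrow> 0"
  proof (rule Lim_null_comparison)
    show "\<forall>\<^sub>F N in sequentially. norm (q N) \<le> cmod w ^ N * norm x"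
      by (simp add: q_def chilbert.nrm_sc norm_power mult_left_mono norm_T2_funpow)
    show "(\<lambda>N. cmod w ^ N * norm x) \<longlonglongrightarrow> 0" using tendsto_mult_left_zero[OF w0] .
  qed
  have lim: "(\<lambda>N. x - q N) \<longlonglongrightarrow> x" using tendsto_diff[OF tendsto_const q0, of x] by simp
  have "(\<lambda>N. norm (T1 (x - q N) - w *\<^sub>C T3 (x - q N))) \<longlonglongrightarrow> norm (T1 x - w *\<^sub>C T3 x)"
    by (intro tendsto_norm tendsto_diff bounded_clinear_tendsto[OF bcl(1) lim]
        bounded_clinear_tendsto[OF bounded_clinear_scale[OF bcl(3)] lim])
  moreover have "(\<lambda>N. norm h + cmod w ^ N * norm h) \<longlonglongrightarrow> norm h + 0"
    by (intro tendsto_add tendsto_const tendsto_mult_left_zero[OF w0])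
  ultimately have "norm (T1 x - w *\<^sub>C T3 x) \<le> norm h + 0"
    using le by (intro tendsto_le[OF sequentially_bot, rotated]) auto
  thus ?thesis by (simp add: h_def)
qed

end

section \<open>The tetrablock\<close>

text \<open>Passing to (r x1, r x2, r^2 x3) with r < 1 amounts to replacing z, w by r z, r w, which
  moves the closed bidisc into the open one.\<close>

lemma closure_tetrablockI:
  assumes "\<And>z w. cmod z < 1 \<Longrightarrow> cmod w < 1 \<Longrightarrow> 1 - z * x1 - w * x2 + z * w * x3 \<noteq> 0"
  shows "(x1, x2, x3) \<in> closure tetrablock"
proof -
  define r where "r n = complex_of_real (real n / real (Suc n))" for n
  have r_norm: "cmod (r n) < 1" for n unfolding r_def norm_of_real by simp
  have r_lim: "r \<longlonglongrightarrow> 1"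
  proof -
    have "r \<longlonglongrightarrow> complex_of_real 1"
      unfolding r_def by (rule tendsto_of_real[OF LIMSEQ_n_over_Suc_n])
    thus ?thesis by simp
  qed
  have "(r n * x1, r n * x2, r n * r n * x3) \<in> tetrablock" for n
  proof -
    have "1 - z * (r n * x1) - w * (r n * x2) + z * w * (r n * r n * x3) \<noteq> 0"
      if "cmod z \<le> 1" "cmod w \<le> 1" for z w
    proof -
      have lt: "cmod (z * r n) < 1" if "cmod z \<le> 1" for z
      proof -
        have "cmod (z * r n) \<le> 1 * cmod (r n)" unfolding norm_mult using that by (intro mult_right_mono) auto
        thus ?thesis using r_norm[of n] by simp
      qed
      show ?thesis using assms[OF lt[OF that(1)] lt[OF that(2)]] by (simp add: mult_ac)
    qed
    thus ?thesis by (simp add: tetrablock_def)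
  qed
  moreover have "(\<lambda>n. (r n * x1, r n * x2, r n * r n * x3)) \<longlonglongrightarrow> (1 * x1, 1 * x2, 1 * 1 * x3)"
    by (intro tendsto_Pair tendsto_mult r_lim tendsto_const)
  ultimately show ?thesis unfolding closure_sequential by (intro exI[of _ "\<lambda>n. (r n * x1, r n * x2, r n * r n * x3)"]) simp
qed

text \<open>A zero would give |1 - w x| = |z| |cnj x - w|. But |1 - w x|^2 - |cnj x - w|^2 = (1 -
  |w|^2) (1 - |x|^2) is nonnegative and |z| < 1, which forces w x = 1.\<close>

lemma distinguished_boundary_mem_closure:
  assumes x: "cmod x \<le> 1" and u: "cmod u = 1"
  shows "(cnj x * u, x, u) \<in> closure tetrablock"
proof (rule closure_tetrablockI)
  fix z w assume z: "cmod z < 1" and w: "cmod w < 1"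
  show "1 - z * (cnj x * u) - w * x + z * w * u \<noteq> 0"
  proof
    assume "1 - z * (cnj x * u) - w * x + z * w * u = 0"
    hence eq: "1 - w * x = z * (u * (cnj x - w))" by (simp add: algebra_simps)
    have "complex_of_real ((cmod (1 - w * x))\<^sup>2 - (cmod (cnj x - w))\<^sup>2)
        = complex_of_real ((1 - (cmod w)\<^sup>2) * (1 - (cmod x)\<^sup>2))"
      by (simp only: of_real_diff of_real_mult of_real_1 complex_norm_square) (simp add: algebra_simps)
    hence "(cmod (1 - w * x))\<^sup>2 - (cmod (cnj x - w))\<^sup>2 = (1 - (cmod w)\<^sup>2) * (1 - (cmod x)\<^sup>2)"
      by (simp only: of_real_eq_iff)
    moreover have "0 \<le> (1 - (cmod w)\<^sup>2) * (1 - (cmod x)\<^sup>2)"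
      using x w by (intro mult_nonneg_nonneg) (simp_all add: power_le_one)
    ultimately have "(cmod (cnj x - w))\<^sup>2 \<le> (cmod (1 - w * x))\<^sup>2" by linarith
    hence le: "cmod (cnj x - w) \<le> cmod (1 - w * x)" by (rule power2_le_imp_le) simp
    have "cmod (1 - w * x) = cmod z * cmod (cnj x - w)" by (simp add: eq norm_mult u)
    also have "\<dots> \<le> cmod z * cmod (1 - w * x)" using le by (intro mult_left_mono) auto
    finally have "(1 - cmod z) * cmod (1 - w * x) \<le> 0" by (simp add: algebra_simps)
    hence "cmod (1 - w * x) = 0" using z by (simp add: mult_le_0_iff)
    hence "w * x = 1" by simp
    hence "cmod w * cmod x = 1" by (metis norm_mult norm_one)
    moreover have "cmod w * cmod x \<le> cmod w * 1" using x by (intro mult_left_mono) auto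
    ultimately show False using w by simp
  qed
qed

text \<open>Gives the suprema over the closed tetrablock their meaning, since the real
  \<open>SUP\<close> of an unbounded set carries no information.\<close>

lemma bounded_tetrablock: "bounded tetrablock"
proof -
  have "norm p \<le> 5" if "p \<in> tetrablock" for p
  proof -
    obtain x1 x2 x3 where p: "p = (x1, x2, x3)" by (cases p)
    have nz: "1 - z * x1 - w * x2 + z * w * x3 \<noteq> 0" if "cmod z \<le> 1" "cmod w \<le> 1" for z w
      using \<open>p \<in> tetrablock\<close> that by (auto simp: tetrablock_def p)
    have x1: "cmod x1 \<le> 1"
    proof (rule ccontr)
      assume "\<not> cmod x1 \<le> 1"
      hence "1 < cmod x1" by simp
      hence "cmod (1 / x1) \<le> 1" "x1 \<noteq> 0" by (auto simp: norm_divide divide_le_eq_1)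
      with nz[of "1 / x1" 0] show False by simp
    qed
    have x2: "cmod x2 \<le> 1"
    proof (rule ccontr)
      assume "\<not> cmod x2 \<le> 1"
      hence "1 < cmod x2" by simp
      hence "cmod (1 / x2) \<le> 1" "x2 \<noteq> 0" by (auto simp: norm_divide divide_le_eq_1)
      with nz[of 0 "1 / x2"] show False by simp
    qed
    \<comment> \<open>For w = 1 the expression is (1 - x2) - z (x1 - x3), with zero z = (1 - x2) /
      (x1 - x3). If |x3| > 3 then |x1 - x3| \<ge> 2 \<ge> |1 - x2|, so this z lies in the closed
      disc.\<close>
    have x3: "cmod x3 \<le> 3"
    proof (rule ccontr)
      assume gt: "\<not> cmod x3 \<le> 3"
      have d: "cmod x3 \<le> cmod (x1 - x3) + cmod x1"
        using norm_triangle_ineq4[of x1 "x1 - x3"] by simp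
      have n: "cmod (1 - x2) \<le> 2" using norm_triangle_ineq4[of 1 x2] x2 by simp
      have "cmod (x1 - x3) \<ge> 2" using d x1 gt by linarith
      hence "cmod ((1 - x2) / (x1 - x3)) \<le> 1" "x1 - x3 \<noteq> 0" using n by (auto simp: norm_divide divide_le_eq)
      with nz[of "(1 - x2) / (x1 - x3)" 1] show False
        by (simp add: field_simps)
    qed
    have "norm p \<le> norm x1 + norm (x2, x3)" unfolding p by (rule norm_Pair_le)
    also have "\<dots> \<le> norm x1 + (norm x2 + norm x3)" using norm_Pair_le[of x2 x3] by simp
    finally show ?thesis using x1 x2 x3 by simp
  qed
  thus ?thesis by (rule boundedI)
qed

lemma bdd_above_poly3_eval: "bdd_above ((\<lambda>x. cmod (poly3_eval p x)) ` closure tetrablock)"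
proof -
  have "continuous_on (closure tetrablock) (\<lambda>x. cmod (poly3_eval p x))"
    unfolding poly3_eval_def case_prod_beta by (intro continuous_intros)
  moreover have "compact (closure tetrablock)"
    using bounded_tetrablock by (simp add: compact_closure)
  ultimately have "compact ((\<lambda>x. cmod (poly3_eval p x)) ` closure tetrablock)"
    by (rule compact_continuous_image)
  thus ?thesis by (intro bounded_imp_bdd_above compact_imp_bounded)
qed

section \<open>Exactness of the Koszul complex\<close>

text \<open>Contraction with the vector a is a homotopy between 0 and multiplication by Q = a1 S1 +
  a2 S2 + a3 S3 on the Koszul complex. Composed with the inverse R of Q it is a contracting
  homotopy, and every preimage chosen in the proof is R applied to such a contraction.\<close>

lemma koszul_exact_if_invertible_combination:
  fixes S1 S2 S3 :: "'a::chilbert_space \<Rightarrow> 'a"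
  assumes b: "bounded_clinear S1" "bounded_clinear S2" "bounded_clinear S3"
    and comm: "\<And>x. S1 (S2 x) = S2 (S1 x)" "\<And>x. S1 (S3 x) = S3 (S1 x)" "\<And>x. S2 (S3 x) = S3 (S2 x)"
    and bij: "bij (\<lambda>x. a1 *\<^sub>C S1 x + a2 *\<^sub>C S2 x + a3 *\<^sub>C S3 x)"
  shows "koszul_exact S1 S2 S3"
proof -
  define Q where "Q x = a1 *\<^sub>C S1 x + a2 *\<^sub>C S2 x + a3 *\<^sub>C S3 x" for x
  define R where "R = inv Q"
  note add = b[THEN bounded_clinear_add]
  note diff = b[THEN bounded_clinear_diff]
  note scale = b[THEN bounded_clinear_scaleC]
  note dist = chilbert.scale_right_distrib chilbert.scale_right_diff_distrib
  have bijQ: "bij Q" using bij by (simp add: Q_def[abs_def])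
  have RQ: "R (Q x) = x" for x using bijQ by (simp add: R_def bij_is_inj)
  have QR: "Q (R x) = x" for x using bijQ by (simp add: R_def bij_is_surj surj_f_inv_f)
  have inj: "x = y" if "Q x = Q y" for x y using RQ that by metis
  have Q_add: "Q (x + y) = Q x + Q y" for x y by (simp add: Q_def add dist)
  have Q_scale: "Q (c *\<^sub>C x) = c *\<^sub>C Q x" for c x by (simp add: Q_def scale dist mult.commute)
  have R_add: "R (x + y) = R x + R y" for x y by (rule inj) (simp add: Q_add QR)
  have R_scale: "R (c *\<^sub>C x) = c *\<^sub>C R x" for c x by (rule inj) (simp add: Q_scale QR)
  have R_zero: "R 0 = 0" using R_scale[of 0 0] by simp
  have Q_S: "Q (S1 x) = S1 (Q x)" "Q (S2 x) = S2 (Q x)" "Q (S3 x) = S3 (Q x)" for x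
    by (simp_all add: Q_def add scale comm)
  have S_R: "S1 (R x) = R (S1 x)" "S2 (R x) = R (S2 x)" "S3 (R x) = R (S3 x)" for x
    by (rule inj, simp add: Q_S QR)+
  have S_zero: "S1 0 = 0" "S2 0 = 0" "S3 0 = 0" using b by (simp_all add: bounded_clinear_zero)
  have R_cong: "R y = x" if "y = Q x" for x y using that RQ by simp
  have 0: "{x. koszul0 S1 S2 S3 x = 0} = {0}"
  proof (intro equalityI subsetI)
    fix x assume "x \<in> {x. koszul0 S1 S2 S3 x = 0}"
    hence "Q x = 0" by (simp add: koszul0_def zero_prod_def Q_def)
    hence "x = R 0" using RQ[of x] by simp
    thus "x \<in> {0}" by (simp add: R_zero)
  qed (simp add: koszul0_def zero_prod_def S_zero)
  have 1: "{x. koszul1 S1 S2 S3 x = 0} = range (koszul0 S1 S2 S3)"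
  proof (intro equalityI subsetI)
    fix v assume "v \<in> {x. koszul1 S1 S2 S3 x = 0}"
    moreover obtain x1 x2 x3 where v: "v = (x1, x2, x3)" by (cases v)
    ultimately have eq: "S1 x2 = S2 x1" "S1 x3 = S3 x1" "S2 x3 = S3 x2"
      by (simp_all add: koszul1_def zero_prod_def)
    define x where "x = R (a1 *\<^sub>C x1 + a2 *\<^sub>C x2 + a3 *\<^sub>C x3)"
    have "S1 x = x1" unfolding x_def S_R by (rule R_cong) (simp add: Q_def add scale eq)
    moreover have "S2 x = x2" unfolding x_def S_R by (rule R_cong) (simp add: Q_def add scale eq)
    moreover have "S3 x = x3" unfolding x_def S_R by (rule R_cong) (simp add: Q_def add scale eq)
    ultimately show "v \<in> range (koszul0 S1 S2 S3)" by (auto simp: koszul0_def v intro!: image_eqI[of _ _ x])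
  qed (auto simp: koszul0_def koszul1_def zero_prod_def comm)
  have 2: "{y. koszul2 S1 S2 S3 y = 0} = range (koszul1 S1 S2 S3)"
  proof (intro equalityI subsetI)
    fix v assume "v \<in> {y. koszul2 S1 S2 S3 y = 0}"
    moreover obtain y12 y13 y23 where v: "v = (y12, y13, y23)" by (cases v)
    ultimately have eq: "S2 y13 = S1 y23 + S3 y12"
      by (simp add: koszul2_def algebra_simps)
    \<comment> \<open>The contraction of e_i \<and> e_j with a is a_i e_j - a_j e_i, which explains
      the signs.\<close>
    define x1 where "x1 = R ((- a2) *\<^sub>C y12 + (- a3) *\<^sub>C y13)"
    define x2 where "x2 = R (a1 *\<^sub>C y12 + (- a3) *\<^sub>C y23)"
    define x3 where "x3 = R (a1 *\<^sub>C y13 + a2 *\<^sub>C y23)"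
    have neg: "S1 (- x) = - S1 x" "S2 (- x) = - S2 x" "S3 (- x) = - S3 x" for x
      using diff[of 0 x] S_zero by simp_all
    have R_diff: "R x - R y = R (x - y)" for x y using R_add[of "x - y" y] by simp
    have "S1 x2 - S2 x1 = y12" unfolding x1_def x2_def S_R R_diff
      by (rule R_cong) (simp add: Q_def add diff neg scale eq dist algebra_simps)
    moreover have "S1 x3 - S3 x1 = y13" unfolding x1_def x3_def S_R R_diff
      by (rule R_cong) (simp add: Q_def add diff neg scale eq dist algebra_simps)
    moreover have "S2 x3 - S3 x2 = y23" unfolding x2_def x3_def S_R R_diff
      by (rule R_cong) (simp add: Q_def add diff neg scale eq dist algebra_simps)
    ultimately show "v \<in> range (koszul1 S1 S2 S3)"
      by (auto simp: koszul1_def v intro!: image_eqI[of _ _ "(x1, x2, x3)"])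
  qed (auto simp: koszul1_def koszul2_def diff comm)
  have 3: "range (koszul2 S1 S2 S3) = UNIV"
  proof (intro equalityI subsetI)
    fix y
    \<comment> \<open>The triple (a3, - a2, a1) is the contraction of e1 \<and> e2 \<and> e3 with
      a.\<close>
    have "koszul2 S1 S2 S3 (a3 *\<^sub>C R y, (- a2) *\<^sub>C R y, a1 *\<^sub>C R y) = Q (R y)"
      by (simp add: koszul2_def Q_def scale del: chilbert.scale_minus_left) simp
    hence "y = koszul2 S1 S2 S3 (a3 *\<^sub>C R y, (- a2) *\<^sub>C R y, a1 *\<^sub>C R y)" by (simp only: QR)
    thus "y \<in> range (koszul2 S1 S2 S3)" by (rule range_eqI)
  qed simp
  show ?thesis using 0 1 2 3 by (simp add: koszul_exact_def)
qed

text \<open>B - z C = (1 - z C B^(-1)) B, where the norm inequality makes C B^(-1) contractive;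
  Banach's fixed point theorem solves for u = B x.\<close>

lemma bij_perturbation:
  fixes B C :: "'a::chilbert_space \<Rightarrow> 'a"
  assumes B: "bounded_clinear B" "bij B" and C: "bounded_clinear C"
    and le: "\<And>x. norm (C x) \<le> norm (B x)" and z: "cmod z < 1"
  shows "bij (\<lambda>x. B x - z *\<^sub>C C x)"
proof (rule bijI)
  have inj: "x = y" if "B x - z *\<^sub>C C x = B y - z *\<^sub>C C y" for x y
  proof -
    have "B (x - y) = z *\<^sub>C C (x - y)"
      using that by (simp add: bounded_clinear_diff[OF B(1)] bounded_clinear_diff[OF C]
          chilbert.scale_right_diff_distrib algebra_simps)
    hence "norm (B (x - y)) = cmod z * norm (C (x - y))" by (simp only: chilbert.nrm_sc)
    also have "\<dots> \<le> cmod z * norm (B (x - y))" by (rule mult_left_mono[OF le]) simp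
    finally have "(1 - cmod z) * norm (B (x - y)) \<le> 0" by (simp add: algebra_simps)
    hence "norm (B (x - y)) = 0" using z by (simp add: mult_le_0_iff)
    hence "B x = B y" by (simp add: bounded_clinear_diff[OF B(1)])
    thus ?thesis using B(2) by (simp add: bij_is_inj inj_eq)
  qed
  thus "inj (\<lambda>x. B x - z *\<^sub>C C x)" by (rule injI)
  show "surj (\<lambda>x. B x - z *\<^sub>C C x)"
  proof (rule surjI)
    fix y
    have BB: "B (inv B u) = u" for u using B(2) by (simp add: bij_is_surj surj_f_inv_f)
    define f where "f u = y + z *\<^sub>C C (inv B u)" for u
    have "\<exists>!u. f u = u"
    proof (rule banach_fix_type[of "cmod z"])
      show "\<forall>u v. dist (f u) (f v) \<le> cmod z * dist u v"
      proof (intro allI)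
        fix u v
        have "dist (f u) (f v) = norm (z *\<^sub>C C (inv B u - inv B v))"
          by (simp add: f_def dist_norm bounded_clinear_diff[OF C] chilbert.scale_right_diff_distrib)
        also have "\<dots> = cmod z * norm (C (inv B u - inv B v))" by (rule chilbert.nrm_sc)
        also have "\<dots> \<le> cmod z * norm (B (inv B u - inv B v))" by (rule mult_left_mono[OF le]) simp
        also have "B (inv B u - inv B v) = u - v" by (simp add: bounded_clinear_diff[OF B(1)] BB)
        finally show "dist (f u) (f v) \<le> cmod z * dist u v" by (simp add: dist_norm)
      qed
    qed (use z in simp_all)
    then obtain u where u: "f u = u" by blast
    have "B (inv B u) - z *\<^sub>C C (inv B u) = y"
      unfolding BB using u by (simp add: f_def diff_eq_eq)
    thus "B (SOME x. B x - z *\<^sub>C C x = y) - z *\<^sub>C C (SOME x. B x - z *\<^sub>C C x = y) = y"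
      by (rule someI)
  qed
qed

section \<open>Tetrablock contractions\<close>

lemma numerical_radius_bound:
  assumes M: "closed_csubspace M" and A: "bounded_clinear_on M A" and x: "x \<in> M"
  shows "cmod (cinner (A x) x) \<le> numerical_radius_on M A * (norm x)\<^sup>2"
proof (cases "x = 0")
  case False
  obtain K where K: "\<And>x. x \<in> M \<Longrightarrow> norm (A x) \<le> K * norm x"
    using A unfolding bounded_clinear_on_def by blast
  let ?S = "insert 0 {cmod (cinner (A x) x) |x. x \<in> M \<and> norm x = 1}"
  have "bdd_above ?S"
  proof (rule bdd_aboveI[of _ "\<bar>K\<bar>"])
    fix r assume "r \<in> ?S"
    then consider "r = 0" | v where "r = cmod (cinner (A v) v)" "v \<in> M" "norm v = 1" by blast
    thus "r \<le> \<bar>K\<bar>"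
    proof cases
      case 2
      have "r \<le> norm (A v) * norm v" unfolding 2(1) by (rule chilbert.cauchy_schwarz)
      also have "\<dots> \<le> \<bar>K\<bar>" using K[OF 2(2)] by (simp add: 2)
      finally show ?thesis .
    qed simp
  qed
  define t where "t = complex_of_real (1 / norm x)"
  have tM: "t *\<^sub>C x \<in> M" by (rule closed_csubspaceD(5)[OF M x])
  have "norm (t *\<^sub>C x) = 1" using False by (simp add: chilbert.nrm_sc t_def norm_divide)
  hence "cmod (cinner (A (t *\<^sub>C x)) (t *\<^sub>C x)) \<in> ?S" using tM by blast
  hence "cmod (cinner (A (t *\<^sub>C x)) (t *\<^sub>C x)) \<le> numerical_radius_on M A"
    unfolding numerical_radius_on_def using \<open>bdd_above ?S\<close> by (rule cSup_upper)
  moreover have "A (t *\<^sub>C x) = t *\<^sub>C A x" using A x by (simp add: bounded_clinear_on_def)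
  moreover have "cmod t = 1 / norm x" by (simp add: t_def norm_divide)
  ultimately show ?thesis using False
    by (simp add: chilbert.ip_sc_left chilbert.ip_sc_right norm_mult field_simps power2_eq_square)
qed simp

text \<open>Turns the bound for A1 + z A2 over the whole circle into a bound for the sum of the
  moduli of the two quadratic forms.\<close>

lemma exists_aligning_phase: "\<exists>z. cmod z = 1 \<and> cmod (a + z * b) = cmod a + cmod b"
proof (cases "a = 0 \<or> b = 0")
  case True
  thus ?thesis by (intro exI[of _ 1]) auto
next
  case False
  define z where "z = sgn a * cnj (sgn b)"
  have "cnj b * b = complex_of_real (cmod b) * complex_of_real (cmod b)"
    by (metis complex_norm_square mult.commute of_real_mult power2_eq_square)
  hence "cnj (sgn b) * b = complex_of_real (cmod b)" using False by (simp add: sgn_eq)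
  hence zb: "z * b = sgn a * complex_of_real (cmod b)" by (simp add: z_def mult.assoc)
  have "sgn a * complex_of_real (cmod a + cmod b) = sgn a * complex_of_real (cmod a) + sgn a * complex_of_real (cmod b)"
    by (simp add: distrib_left)
  also have "sgn a * complex_of_real (cmod a) = a" using False by (simp add: sgn_eq)
  finally have "a + z * b = sgn a * complex_of_real (cmod a + cmod b)" by (simp only: zb)
  hence "cmod (a + z * b) = cmod (sgn a) * \<bar>cmod a + cmod b\<bar>" by (simp only: norm_mult norm_of_real)
  moreover have "cmod z = 1" using False by (simp add: z_def norm_mult norm_sgn)
  ultimately show ?thesis using False by (intro exI[of _ z]) (simp add: norm_sgn)
qed

lemma poly3_as_terms:
  obtains ts where "\<And>x1 x2 x3. poly3_eval p (x1, x2, x3) = terms_eval ts x1 x2 x3"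
    "\<And>(T1 :: 'a::chilbert_space \<Rightarrow> 'a) T2 T3 x. poly3_op p T1 T2 T3 x
      = (\<Sum>(c, i, j, k)\<leftarrow>ts. c *\<^sub>C (T1 ^^ i) ((T2 ^^ j) ((T3 ^^ k) x)))"
proof -
  obtain xs where xs: "distinct xs" "set xs = Poly_Mapping.keys p"
    using finite_distinct_list[OF finite_keys[of p]] by blast
  define ts where "ts = map (\<lambda>(i, j, k). (Poly_Mapping.lookup p (i, j, k), i, j, k)) xs"
  have conv: "(\<Sum>t\<in>Poly_Mapping.keys p. f t) = (\<Sum>t\<leftarrow>xs. f t)" for f :: "_ \<Rightarrow> 'b::comm_monoid_add"
    using xs by (simp add: sum_list_distinct_conv_sum_set)
  show thesis
  proof (rule that[of ts])
    fix x1 x2 x3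
    show "poly3_eval p (x1, x2, x3) = terms_eval ts x1 x2 x3"
      unfolding poly3_eval_def terms_eval_def ts_def
      by (simp add: conv comp_def split_def)
  next
    fix T1 T2 T3 :: "'a \<Rightarrow> 'a" and x
    show "poly3_op p T1 T2 T3 x = (\<Sum>(c, i, j, k)\<leftarrow>ts. c *\<^sub>C (T1 ^^ i) ((T2 ^^ j) ((T3 ^^ k) x)))"
      unfolding poly3_op_def ts_def by (simp add: conv comp_def split_def)
  qed
qed

context tetrablock_dilation
begin

lemma onorm_poly3_op_le:
  "onorm (poly3_op p T1 T2 T3) \<le> (SUP x\<in>closure tetrablock. cmod (poly3_eval p x))"
proof -
  define M where "M = (SUP x\<in>closure tetrablock. cmod (poly3_eval p x))"
  obtain ts where eval: "\<And>x1 x2 x3. poly3_eval p (x1, x2, x3) = terms_eval ts x1 x2 x3"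
    and op: "\<And>(T1 :: 'a \<Rightarrow> 'a) T2 T3 x. poly3_op p T1 T2 T3 x
      = (\<Sum>(c, i, j, k)\<leftarrow>ts. c *\<^sub>C (T1 ^^ i) ((T2 ^^ j) ((T3 ^^ k) x)))"
    by (rule poly3_as_terms[where 'a = 'a and p = p]) blast
  have bound: "cmod (terms_eval ts (cnj x * u) x u) \<le> M" if "cmod x \<le> 1" "cmod u = 1" for x u
    unfolding eval[symmetric] M_def
    by (rule cSUP_upper[OF distinguished_boundary_mem_closure[OF that] bdd_above_poly3_eval])
  have "0 \<le> M" using order_trans[OF norm_ge_zero bound[of 0 1]] by simp
  moreover have "norm (poly3_op p T1 T2 T3 x) \<le> M * norm x" for x
    unfolding op by (rule compression_von_neumann[OF bound])
  ultimately show ?thesis unfolding M_def[symmetric] by (rule onorm_bound)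
qed

lemma taylor_spectrum_subset: "taylor_spectrum T1 T2 T3 \<subseteq> closure tetrablock"
proof
  fix l assume spec: "l \<in> taylor_spectrum T1 T2 T3"
  obtain l1 l2 l3 where l: "l = (l1, l2, l3)" by (cases l)
  show "l \<in> closure tetrablock"
  proof (rule ccontr)
    assume "l \<notin> closure tetrablock"
    then obtain z w where zw: "cmod z < 1" "cmod w < 1" and zero: "1 - z * l1 - w * l2 + z * w * l3 = 0"
      using closure_tetrablockI[of l1 l2 l3] unfolding l by blast
    note scaled = bounded_clinear_scale[OF bcl(2), of w] bounded_clinear_scale[OF bcl(3), of w]
    \<comment> \<open>Two perturbations: the identity by w T2, then 1 - w T2 by z (T1 - w T3), which
      \<open>compression_pencil\<close> allows.\<close>
    have "bij (\<lambda>x. x - w *\<^sub>C T2 x)"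
      by (rule bij_perturbation[OF bounded_clinear_id bij_id[unfolded id_def] bcl(2) T2_norm zw(2)])
    from bij_perturbation[OF bounded_clinear_minus[OF bounded_clinear_id scaled(1)] this
        bounded_clinear_minus[OF bcl(1) scaled(2)] compression_pencil[OF zw(2)] zw(1)]
    have bij: "bij (\<lambda>x. (x - w *\<^sub>C T2 x) - z *\<^sub>C (T1 x - w *\<^sub>C T3 x))" .
    define S1 where "S1 x = T1 x - l1 *\<^sub>C x" for x
    define S2 where "S2 x = T2 x - l2 *\<^sub>C x" for x
    define S3 where "S3 x = T3 x - l3 *\<^sub>C x" for x
    \<comment> \<open>The pencil is affine in T1, T2, T3 and its scalar version vanishes at (l1, l2,
      l3), so it is a linear combination of the shifted operators.\<close>
    have pencil: "(x - w *\<^sub>C T2 x) - z *\<^sub>C (T1 x - w *\<^sub>C T3 x)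
        = (- z) *\<^sub>C S1 x + (- w) *\<^sub>C S2 x + (z * w) *\<^sub>C S3 x" for x
    proof -
      have "(- z) *\<^sub>C S1 x + (- w) *\<^sub>C S2 x + (z * w) *\<^sub>C S3 x
          = ((z * l1 + w * l2 - z * w * l3) *\<^sub>C x - w *\<^sub>C T2 x) - z *\<^sub>C (T1 x - w *\<^sub>C T3 x)"
        by (simp add: S1_def S2_def S3_def chilbert.scale_right_diff_distrib
            chilbert.scale_left_distrib chilbert.scale_left_diff_distrib mult.assoc)
      also have "z * l1 + w * l2 - z * w * l3 = 1" using zero by (simp add: algebra_simps)
      finally show ?thesis by simp
    qed
    note lin = bcl(1-3)[THEN bounded_clinear_diff] bcl(1-3)[THEN bounded_clinear_scaleC]
    have "koszul_exact S1 S2 S3"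
    proof (rule koszul_exact_if_invertible_combination)
      show "bij (\<lambda>x. (- z) *\<^sub>C S1 x + (- w) *\<^sub>C S2 x + (z * w) *\<^sub>C S3 x)"
        using bij by (simp only: pencil)
      show "bounded_clinear S1" "bounded_clinear S2" "bounded_clinear S3"
        unfolding S1_def S2_def S3_def
        by (rule bounded_clinear_minus[OF _ bounded_clinear_scale[OF bounded_clinear_id]], rule bcl)+
      show "S1 (S2 x) = S2 (S1 x)" "S1 (S3 x) = S3 (S1 x)" "S2 (S3 x) = S3 (S2 x)" for x
        by (simp_all add: S1_def S2_def S3_def lin T12 T13 T23 chilbert.scale_right_diff_distrib mult.commute)
    qed
    thus False using spec by (simp add: l taylor_spectrum_def S1_def[abs_def] S2_def[abs_def] S3_def[abs_def])
  qed
qed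

theorem tetrablock_contraction: "tetrablock_contraction T1 T2 T3"
  unfolding tetrablock_contraction_def commuting_triple_def
  using taylor_spectrum_subset onorm_poly3_op_le bcl(1-3) by (simp add: fun_eq_iff T12 T13 T23)

end

section \<open>From the operator hypotheses to the dilation data\<close>

theorem theorem3p3:
  fixes T1 T2 T3 A1 A2 :: "'a::chilbert_space \<Rightarrow> 'a"
  assumes "contraction T1" "contraction T2" "contraction T3"
    and "commuting_triple T1 T2 T3"
    and "bounded_clinear_on (defect_space T3) A1" "bounded_clinear_on (defect_space T3) A2"
    and "\<And>x. x \<in> defect_space T3 \<Longrightarrow> A1 (A2 x) = A2 (A1 x)"
    and "\<And>x. T1 x - cadjoint T2 (T3 x) = defect_op T3 (A1 (defect_op T3 x))"
    and "\<And>x. T2 x - cadjoint T1 (T3 x) = defect_op T3 (A2 (defect_op T3 x))"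
    and "\<And>x. x \<in> defect_space T3 \<Longrightarrow>
           commutator (adjoint_on (defect_space T3) A1) A1 x =
           commutator (adjoint_on (defect_space T3) A2) A2 x"
    and "\<And>z. cmod z = 1 \<Longrightarrow>
           numerical_radius_on (defect_space T3) (\<lambda>x. A1 x + z *\<^sub>C A2 x) \<le> 1"
  shows "tetrablock_contraction T1 T2 T3"
proof -
  define M where "M = defect_space T3"
  define D where "D = defect_op T3"
  define F1 where "F1 x = A1 (proj_on M x)" for x
  define F2 where "F2 x = A2 (proj_on M x)" for x
  define G1 where "G1 = cadjoint F1"
  define G2 where "G2 = cadjoint F2"
  note T = contractionD(1)[OF assms(1)] contractionD(1)[OF assms(2)] contractionD(1)[OF assms(3)]
  have comm: "T1 (T2 x) = T2 (T1 x)" "T1 (T3 x) = T3 (T1 x)" "T2 (T3 x) = T3 (T2 x)" for x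
    using assms(4) by (auto simp: commuting_triple_def fun_eq_iff)
  have M: "closed_csubspace M" unfolding M_def by (rule closed_csubspace_defect_space[OF assms(3)])
  note M' = closed_csubspaceD[OF M]
  have A: "bounded_clinear_on M A1" "bounded_clinear_on M A2" using assms(5,6) by (simp_all add: M_def)
  have bF: "bounded_clinear F1" "bounded_clinear F2"
    unfolding F1_def F2_def by (rule bounded_clinear_extension[OF M A(1)] bounded_clinear_extension[OF M A(2)])+
  have bG: "bounded_clinear G1" "bounded_clinear G2"
    unfolding G1_def G2_def by (rule bounded_clinear_cadjoint bF)+
  have G: "G1 = adjoint_on M A1" "G2 = adjoint_on M A2"
    unfolding G1_def G2_def F1_def F2_def
    by (rule cadjoint_extension[OF M A(1)] cadjoint_extension[OF M A(2)])+
  have adj: "cinner (F1 x) y = cinner x (G1 y)" "cinner (F2 x) y = cinner x (G2 y)" for x y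
    unfolding G1_def G2_def by (rule cadjoint[OF bF(1)] cadjoint[OF bF(2)])+
  have adj': "cinner (G1 x) y = cinner x (F1 y)" "cinner (G2 x) y = cinner x (F2 y)" for x y
    unfolding G1_def G2_def by (rule cadjoint'[OF bF(1)] cadjoint'[OF bF(2)])+
  have P_mem: "proj_on M x \<in> M" for x by (rule proj_on_mem[OF M])
  have FM: "F1 x \<in> M" "F2 x \<in> M" for x
    using A P_mem[of x] by (auto simp: F1_def F2_def bounded_clinear_on_def)
  have GM: "G1 x \<in> M" "G2 x \<in> M" for x
    unfolding G by (rule adjoint_on_mem[OF M A(1)] adjoint_on_mem[OF M A(2)])+
  have F_on: "F1 x = A1 x" "F2 x = A2 x" if "x \<in> M" for x
    using proj_on_id[OF M that] by (simp_all add: F1_def F2_def)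
  have F_P: "F1 (proj_on M x) = F1 x" "F2 (proj_on M x) = F2 x" for x
    using F_on[OF P_mem[of x]] by (simp_all add: F1_def F2_def)
  have G_P: "G1 (proj_on M x) = G1 x" "G2 (proj_on M x) = G2 x" for x
    by (rule cinner_eqI, simp only: adj[symmetric] cinner_proj_on[OF M FM(1)] cinner_proj_on[OF M FM(2)])+
  have F12: "F1 (F2 x) = F2 (F1 x)" for x
    unfolding F_on[OF FM(1)] F_on[OF FM(2)] using assms(7)[of "proj_on M x"] P_mem[of x]
    by (simp add: F1_def F2_def M_def)
  have G12: "G1 (G2 x) = G2 (G1 x)" for x
    by (rule cinner_eqI) (simp only: adj[symmetric] F12)
  have FG: "F1 (G1 x) + G2 (F2 x) = F2 (G2 x) + G1 (F1 x)" for x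
  proof -
    let ?x = "proj_on M x"
    have "G1 (A1 ?x) - A1 (G1 ?x) = G2 (A2 ?x) - A2 (G2 ?x)"
      using assms(10)[of ?x] P_mem[of x] by (simp add: commutator_def G M_def)
    hence "G1 (F1 x) - F1 (G1 x) = G2 (F2 x) - F2 (G2 x)"
      unfolding F_on[OF P_mem, symmetric] F_P G_P F_on[OF GM(1), symmetric] F_on[OF GM(2), symmetric] .
    thus ?thesis by (simp add: algebra_simps)
  qed
  have bD: "bounded_clinear D" unfolding D_def by (rule bounded_clinear_defect[OF assms(3)])
  have D_adj: "cinner (D x) y = cinner x (D y)" for x y
    unfolding D_def by (rule defect_op_selfadjoint[OF assms(3)])
  have DM: "D x \<in> M" for x unfolding D_def M_def by (rule defect_op_mem[OF assms(3)])
  have D_square: "cinner (T3 x) (T3 y) + cinner (D x) (D y) = cinner x y" for x y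
  proof -
    have "cinner (D x) (D y) = cinner (D (D x)) y" by (rule D_adj[symmetric])
    also have "D (D x) = x - cadjoint T3 (T3 x)" unfolding D_def by (rule defect_op_square[OF assms(3)])
    finally show ?thesis by (simp add: chilbert.ip_diff_left cadjoint'[OF T(3)])
  qed
  have fund1: "cinner (T1 x) y - cinner (T3 x) (T2 y) = cinner (F1 (D x)) (D y)" for x y
  proof -
    have "T1 x - cadjoint T2 (T3 x) = D (F1 (D x))"
      unfolding F_on[OF DM] unfolding D_def by (rule assms(8))
    hence "cinner (T1 x - cadjoint T2 (T3 x)) y = cinner (D (F1 (D x))) y" by simp
    thus ?thesis by (simp only: chilbert.ip_diff_left cadjoint'[OF T(2)] D_adj)
  qed
  have fund2: "cinner (T2 x) y - cinner (T3 x) (T1 y) = cinner (F2 (D x)) (D y)" for x y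
  proof -
    have "T2 x - cadjoint T1 (T3 x) = D (F2 (D x))"
      unfolding F_on[OF DM] unfolding D_def by (rule assms(9))
    hence "cinner (T2 x - cadjoint T1 (T3 x)) y = cinner (D (F2 (D x))) y" by simp
    thus ?thesis by (simp only: chilbert.ip_diff_left cadjoint'[OF T(1)] D_adj)
  qed
  \<comment> \<open>Both sides lie in the defect space, where D is injective, so they are compared
    after applying D. By D D = 1 - T3^* T3 and the two fundamental equations both become S x - T3^*
    S T3 x.\<close>
  have D_intertwine: "D (S x) = F (D x) + G' (D (T3 x))"
    if S3: "\<And>x. S (T3 x) = T3 (S x)" and FGM: "\<And>x. F x \<in> M" "\<And>x. G' x \<in> M"
      and f: "\<And>x y. cinner (S x) y - cinner (T3 x) (S' y) = cinner (F (D x)) (D y)"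
      and f': "\<And>x y. cinner (S' x) y - cinner (T3 x) (S y) = cinner (F' (D x)) (D y)"
      and a: "\<And>x y. cinner (G' x) y = cinner x (F' y)" for S S' F F' G' x
  proof -
    define e where "e = D (S x) - (F (D x) + G' (D (T3 x)))"
    have "e \<in> M" unfolding e_def by (intro M'(3,4) DM FGM)
    moreover have "D e = 0"
    proof (rule cinner_eqI)
      fix y
      have DS: "cinner y (D (D (S x))) = cinner y (S x) - cinner (T3 y) (S (T3 x))"
        using D_square[of y "S x"] by (simp add: D_adj[symmetric] S3 algebra_simps)
      have "cinner y (D (F (D x))) = cnj (cinner (F (D x)) (D y))"
        by (rule trans[OF D_adj[symmetric] cinner_commute])
      also have "\<dots> = cinner y (S x) - cinner (S' y) (T3 x)"
        unfolding f[symmetric] complex_cnj_diff cinner_commute[symmetric] ..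
      finally have DF: "cinner y (D (F (D x))) = cinner y (S x) - cinner (S' y) (T3 x)" .
      have "cinner y (D (G' (D (T3 x)))) = cnj (cinner (G' (D (T3 x))) (D y))"
        by (rule trans[OF D_adj[symmetric] cinner_commute])
      also have "\<dots> = cinner (F' (D y)) (D (T3 x))" unfolding a by (rule cinner_commute[symmetric])
      also have "\<dots> = cinner (S' y) (T3 x) - cinner (T3 y) (S (T3 x))" by (rule f'[symmetric])
      finally have DG: "cinner y (D (G' (D (T3 x)))) = cinner (S' y) (T3 x) - cinner (T3 y) (S (T3 x))" .
      show "cinner y (D e) = cinner y 0"
        by (simp add: e_def bounded_clinear_diff[OF bD] bounded_clinear_add[OF bD]
            chilbert.ip_diff_right chilbert.ip_add_right DS DF DG)
    qed
    ultimately have "e = 0" unfolding M_def D_def by (rule defect_op_injective[OF assms(3)])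
    thus ?thesis by (simp add: e_def)
  qed
  have numerical: "cmod (cinner (A1 u) u) + cmod (cinner (A2 u) u) \<le> (norm u)\<^sup>2" if u: "u \<in> M" for u
  proof -
    obtain z where z: "cmod z = 1"
      and align: "cmod (cinner (A1 u) u + z * cinner (A2 u) u) = cmod (cinner (A1 u) u) + cmod (cinner (A2 u) u)"
      using exists_aligning_phase by blast
    obtain K1 where K1: "\<And>x. x \<in> M \<Longrightarrow> norm (A1 x) \<le> K1 * norm x"
      using A(1) unfolding bounded_clinear_on_def by blast
    obtain K2 where K2: "\<And>x. x \<in> M \<Longrightarrow> norm (A2 x) \<le> K2 * norm x"
      using A(2) unfolding bounded_clinear_on_def by blast
    note K = K1 K2
    have "bounded_clinear_on M (\<lambda>x. A1 x + z *\<^sub>C A2 x)"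
      unfolding bounded_clinear_on_def
    proof (intro conjI ballI allI exI[of _ "K1 + K2"])
      show "(\<lambda>x. A1 x + z *\<^sub>C A2 x) ` M \<subseteq> M"
        using A M'(3,5) by (auto simp: bounded_clinear_on_def image_subset_iff)
      show "norm (A1 x + z *\<^sub>C A2 x) \<le> (K1 + K2) * norm x" if "x \<in> M" for x
      proof -
        have "norm (A1 x + z *\<^sub>C A2 x) \<le> norm (A1 x) + norm (z *\<^sub>C A2 x)" by (rule norm_triangle_ineq)
        also have "\<dots> \<le> K1 * norm x + K2 * norm x"
          using K that by (intro add_mono) (simp_all add: chilbert.nrm_sc z)
        finally show ?thesis by (simp add: distrib_right)
      qed
    qed (use A in \<open>simp_all add: bounded_clinear_on_def chilbert.scale_right_distrib mult.commute add_ac\<close>)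
    from numerical_radius_bound[OF M this u]
    have "cmod (cinner (A1 u + z *\<^sub>C A2 u) u) \<le> numerical_radius_on M (\<lambda>x. A1 x + z *\<^sub>C A2 x) * (norm u)\<^sup>2" .
    also have "\<dots> \<le> 1 * (norm u)\<^sup>2"
      using assms(11)[OF z] by (intro mult_right_mono) (simp_all add: M_def)
    finally show ?thesis by (simp add: chilbert.ip_add_left chilbert.ip_sc_left align)
  qed
  have symbol: "norm (F2 x + z *\<^sub>C G1 x) \<le> norm x" if z: "cmod z = 1" for z x
  proof (rule normal_contraction)
    have zz: "z * cnj z = 1" using complex_norm_square[of z] z by simp
    show "bounded_clinear (\<lambda>x. F2 x + z *\<^sub>C G1 x)"
      by (rule bounded_clinear_plus[OF bF(2) bounded_clinear_scale[OF bG(1)]])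
    show "cinner (F2 x + z *\<^sub>C G1 x) y = cinner x (G2 y + cnj z *\<^sub>C F1 y)" for x y
      by (simp add: chilbert.ip_add_left chilbert.ip_add_right chilbert.ip_sc_left chilbert.ip_sc_right adj adj')
    \<comment> \<open>The constant terms agree by \<open>FG\<close> and z * cnj z = 1, those with
      cnj z by \<open>F12\<close>, those with z by \<open>G12\<close>.\<close>
    show "F2 (G2 x + cnj z *\<^sub>C F1 x) + z *\<^sub>C G1 (G2 x + cnj z *\<^sub>C F1 x)
        = G2 (F2 x + z *\<^sub>C G1 x) + cnj z *\<^sub>C F1 (F2 x + z *\<^sub>C G1 x)" for x
    proof -
      note lin = bF[THEN bounded_clinear_add] bG[THEN bounded_clinear_add]
        bF[THEN bounded_clinear_scaleC] bG[THEN bounded_clinear_scaleC]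
      have "F2 (G2 x + cnj z *\<^sub>C F1 x) + z *\<^sub>C G1 (G2 x + cnj z *\<^sub>C F1 x)
          = (F2 (G2 x) + G1 (F1 x)) + (cnj z *\<^sub>C F2 (F1 x) + z *\<^sub>C G1 (G2 x))"
        by (simp add: lin chilbert.scale_right_distrib zz add_ac)
      also have "\<dots> = (F1 (G1 x) + G2 (F2 x)) + (cnj z *\<^sub>C F1 (F2 x) + z *\<^sub>C G2 (G1 x))"
        by (simp only: FG F12 G12)
      also have "\<dots> = G2 (F2 x + z *\<^sub>C G1 x) + cnj z *\<^sub>C F1 (F2 x + z *\<^sub>C G1 x)"
        by (simp add: lin chilbert.scale_right_distrib mult.commute[of "cnj z" z] zz add_ac)
      finally show ?thesis .
    qed
    \<comment> \<open>G1 is the adjoint of F1, so their forms at x have equal modulus, and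
      \<open>numerical\<close> applies at the projection of x.\<close>
    show "cmod (cinner (F2 x + z *\<^sub>C G1 x) x) \<le> (norm x)\<^sup>2" for x
    proof -
      let ?u = "proj_on M x"
      have F_u: "cinner (F1 x) x = cinner (A1 ?u) ?u" "cinner (F2 x) x = cinner (A2 ?u) ?u"
        using cinner_proj_on[OF M FM(1), of x x] cinner_proj_on[OF M FM(2), of x x] by (simp_all add: F1_def F2_def)
      have "cinner (G1 x) x = cnj (cinner (F1 x) x)"
        unfolding adj' by (rule cinner_commute)
      hence "cmod (cinner (F2 x + z *\<^sub>C G1 x) x) \<le> cmod (cinner (F2 x) x) + cmod (cinner (F1 x) x)"
        unfolding chilbert.ip_add_left chilbert.ip_sc_left
        by (intro order_trans[OF norm_triangle_ineq]) (simp add: norm_mult z)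
      also have "\<dots> \<le> (norm ?u)\<^sup>2" using numerical[OF P_mem[of x]] by (simp add: F_u)
      also have "\<dots> \<le> (norm x)\<^sup>2" by (intro power_mono norm_proj_on_le[OF M]) simp
      finally show ?thesis .
    qed
  qed
  interpret tetrablock_dilation T1 T2 T3 D F1 F2 G1 G2
  proof
    show "D (T1 x) = F1 (D x) + G2 (D (T3 x))" for x
      by (rule D_intertwine[OF comm(2) FM(1) GM(2) fund1 fund2 adj'(2)])
    show "D (T2 x) = F2 (D x) + G1 (D (T3 x))" for x
      by (rule D_intertwine[OF comm(3) FM(2) GM(1) fund2 fund1 adj'(1)])
  qed (fact T bD bF bG adj contractionD(2)[OF assms(2)] comm D_adj D_square fund1 fund2 F12 G12 FG symbol)+
  show ?thesis by (rule tetrablock_contraction)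
qed

end
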